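(* Let $d$ be an odd integer with $d\ge 3$, let $X=\{0,1,\dots,d-1\}$, and let $D=\langle a_0,\dots,a_{d-1}\rangle\le \mathrm{Aut}(X^* )$ be the group defined in the context. Then: (i) $D$ is a self-similar, self-replicating, contracting, regular branch group, branching over its commutator subgroup $D'$. (ii) $D/\mathrm{St}_D(1)= D(d)$, the dihedral group of order $2d$. (iii) The group $D/D'$ is the elementary abelian $2$-group of rank $d$ and $|D':X\ast D'|=d\cdot 2^{(d-1)(d-2)}$. (iv) The rigid level stabiliser $R_n=\mathrm{Rst}_D(n)$ of level $n$ is $X^n\ast D'$. For $n\ge 1$, $$|D:R_n| = 2^{(d-2)d^n+2}\cdot d^{\frac{d^n-1}{d-1}}.$$ (v) The rigid kernel of $D$ is an elementary abelian $2$-group $A\times\prod_{X^*\setminus\{\epsilon\}}B$, where $A$ and $B$ are elementary abelian $2$-groups, $A$ has rank $(d-1)(d-2)$ and $B$ has rank $(d-1)(d-3)$. In particular, the rigid kernel is a Klein $4$-group when $d=3$ and is isomorphic to $\prod_{\mathbb N}\mathbb Z/2\mathbb Z$ when $d>3$. (vi) The closure $\overline{D}$ of $D$ in $\mathrm{Aut}(X^* )$ is a finitely constrained group defined by the following allowed patterns of size $2$: a pattern of size $2$ with root label $\pi\in D(d)$ and label $\pi_x\in D(d)$ at each $x\in X$ is allowed if and only if the permutation $\pi\pi_0\pi_1\cdots\pi_{d-1}$ is a rotation in $D(d)$ (that is, the number of mirror symmetries among $\pi,\pi_0,\dots,\pi_{d-1}$ is even). (vii) The closure $\overline{D}$ is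 a regular branch group branching over the stabiliser of level $1$ in $\overline{D}$. For $n\ge1$, $$|D:\mathrm{St}_D(n)|=|\overline{D}:\overline{\mathrm{St}_D(n)}|=2^{d^{n-1}}\cdot d^{\frac{d^n-1}{d-1}},$$ and the Hausdorff dimension of $\overline{D}$ is $1-\frac1d\cdot\frac{\log 2}{\log 2d}$.
   Context: Tree automorphisms. $X^*$ is the set of finite words over the finite alphabet $X$ (with empty word $\epsilon$), viewed as a regular rooted tree whose level $n$ is $X^n$. $\mathrm{Aut}(X^* )$ is its automorphism group (acting on the left). Each $g\in\mathrm{Aut}(X^* )$ is identified with its portrait $(g(u))_{u\in X^*}\in \mathrm{Sym}(X)^{X^*}$, where $g[x_1\cdots x_n]=y_1\cdots y_n$ with $y_i=g(x_1\cdots x_{i-1})(x_i)$; multiplication is $(fg)(u)=f(g[u])g(u)$. For $v\in X^*$ the section (shift) $g_v$ is given by $g_v(u)=g(vu)$. A group $G\le \mathrm{Aut}(X^* )$ is self-similar if $g_v\in G$ for all $g\in G,v\in X^*$; it is self-replicating if moreover for each $x\in X$ the map $G\to G$, $g\mapsto g_x$, is onto. It is contracting if there is a finite subset $N\subseteq G$ such that for each $g\in G$ there is $k$ with $g_v\in N$ for all $v$ of length at least $k$. Stabilisers and branching. $\mathrm{St}(n)$ is the pointwise stabiliser of $X^n$ and $\mathrm{St}_G(n)=G\cap\mathrm{St}(n)$. $\mathrm{Aut}(X^* )$ is a profinite group with the $\mathrm{St}(n)$ as basic neighbourhoods of the identity; bars denote closure. For $g\in\mathrm{Aut}(X^* )$,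 $v\in X^*$, $\delta_v(g)$ is the automorphism that acts as $g$ on the subtree rooted at $v$ and fixes the rest of $X^*$; for $H\le \mathrm{Aut}(X^* )$, $X^n\ast H=\prod_{v\in X^n}\delta_v(H)$ and $X\ast H=X^1\ast H$. A self-similar group $G$ branches over $K\le G$ if $X\ast K\le K$; it is regular branch if it branches over some finite-index normal subgroup. $\mathrm{Rst}_G(v)$ is the subgroup of elements of $G$ fixing all vertices outside the subtree rooted at $v$, and $\mathrm{Rst}_G(n)=\prod_{v\in X^n}\mathrm{Rst}_G(v)$. The rigid kernel of $G$ is the kernel of the natural map $\varprojlim_n G/\mathrm{Rst}_G(n)\to\varprojlim_n G/\mathrm{St}_G(n)=\overline{G}$. Patterns. A pattern of size $2$ is a function from $\{\epsilon\}\cup X$ to $D(d)$; it appears in $f\in D(d)^{X^*}$ at $u$ if it equals the restriction of $f_u$ to $\{\epsilon\}\cup X$. The finitely constrained group defined by a set of allowed patterns of size $2$ is a group consisting exactly of those portraits in $D(d)^{X^*}$ in which every pattern of size $2$ that appears is allowed. The group $D$. Write $d=2k+1$. For $i\in X$, $\mu_i\in\mathrm{Sym}(X)$ is the involution $\mu_i=(i-1\ \, i+1)(i-2\ \, i+2)\cdots(i-k\ \, i+k)$ with entries modulo $d$, i.e. the mirror symmetry of the regular $d$-gon with vertices $0,\dots,d-1$ in the axis through vertex $i$. $D(d)=\langle\mu_0,\dots,\mu_{d-1}\rangle\leq \mathrm{Sym}(X)$ is the dihedral group, consisting of the $d$ mirror symmetries $\mu_i$ and the $d$ rotations $\rho^i$,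 $\rho=(0\,1\,\dots\,d-1)$. The automorphism $a_i$ is defined recursively by: its root permutation is $\mu_i$, its section at $i$ is $a_i$, and its sections at all other $x\in X$ are trivial. $D=\langle a_0,\dots,a_{d-1}\rangle$, and $D'$ is its commutator subgroup. The identification in (ii) is via the action on $X$. Hausdorff dimension. For a closed subgroup $\Gamma\le D(d)^{X^*}$, its Hausdorff dimension is taken relative to the infinitely iterated wreath product $D(d)^{X^*}$ of $D(d)$: $\mathrm{hdim}(\Gamma)=\liminf_{n\to\infty}\frac{(d-1)\log_{2d}|\Gamma:\mathrm{St}_\Gamma(n)|}{d^n-1}$. *)

theory Defs
  imports
    "HOL-Analysis.Analysis"
    "HOL-Algebra.Generated_Groups"
    "HOL-Algebra.Product_Groups"
begin

text \<open>The alphabet is \<open>X = {..<d}\<close>; vertices of the tree are the lists over it.\<close>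

definition words :: "nat \<Rightarrow> nat list set" where
  "words d = lists {..<d}"

definition level :: "nat \<Rightarrow> nat \<Rightarrow> nat list set" where
  "level d n = {w \<in> words d. length w = n}"

definition sym_X :: "nat \<Rightarrow> (nat \<Rightarrow> nat) monoid" where
  "sym_X d = \<lparr>carrier = {p. p permutes {..<d}}, monoid.mult = (\<circ>), one = id\<rparr>"

text \<open>For \<open>i < d\<close>, the letter \<open>(i + d - j) mod d\<close> is \<open>i - j\<close> modulo \<open>d\<close>, since \<open>j \<le> d\<close>. The
  transpositions are disjoint for odd \<open>d\<close>, so their order is immaterial.\<close>

definition mirror :: "nat \<Rightarrow> nat \<Rightarrow> nat \<Rightarrow> nat" where
  "mirror d i =
     foldr (\<lambda>j p. Transposition.transpose ((i + d - j) mod d) ((i + j) mod d) \<circ> p)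
       [1..<Suc ((d - 1) div 2)] id"

definition rho :: "nat \<Rightarrow> nat \<Rightarrow> nat" where
  "rho d x = (if x < d then (x + 1) mod d else x)"

definition rotations :: "nat \<Rightarrow> (nat \<Rightarrow> nat) set" where
  "rotations d = {rho d ^^ i | i. i < d}"

definition mirrors :: "nat \<Rightarrow> (nat \<Rightarrow> nat) set" where
  "mirrors d = mirror d ` {..<d}"

definition dihedral :: "nat \<Rightarrow> (nat \<Rightarrow> nat) monoid" where
  "dihedral d = (sym_X d)\<lparr>carrier := generate (sym_X d) (mirrors d)\<rparr>"

text \<open>An automorphism of the rooted tree is represented by its portrait, with the value \<open>id\<close>
  outside the tree so that equality of portraits is equality of functions.\<close>

type_synonym portrait = "nat list \<Rightarrow> nat \<Rightarrow> nat"

definition act :: "portrait \<Rightarrow> nat list \<Rightarrow> nat list" where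
  "act g w = map (\<lambda>i. g (take i w) (w ! i)) [0..<length w]"

definition tree_aut :: "nat \<Rightarrow> portrait monoid" where
  "tree_aut d =
     \<lparr>carrier = {g. (\<forall>u\<in>words d. g u permutes {..<d}) \<and> (\<forall>u. u \<notin> words d \<longrightarrow> g u = id)},
      monoid.mult = (\<lambda>f g u. f (act g u) \<circ> g u),
      one = (\<lambda>u. id)\<rparr>"

definition sect :: "nat list \<Rightarrow> portrait \<Rightarrow> portrait" where
  "sect v g = (\<lambda>u. g (v @ u))"

abbreviation subgrp :: "nat \<Rightarrow> portrait set \<Rightarrow> portrait monoid" where
  "subgrp d H \<equiv> (tree_aut d)\<lparr>carrier := H\<rparr>"

text \<open>The index is \<open>0\<close> when there are infinitely many cosets.\<close>

definition index :: "nat \<Rightarrow> portrait set \<Rightarrow> portrait set \<Rightarrow> nat" where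
  "index d G H = card (rcosets\<^bsub>subgrp d G\<^esub> H)"

definition self_similar :: "nat \<Rightarrow> portrait set \<Rightarrow> bool" where
  "self_similar d G \<longleftrightarrow>
     subgroup G (tree_aut d) \<and> (\<forall>g\<in>G. \<forall>v\<in>words d. sect v g \<in> G)"

definition self_replicating :: "nat \<Rightarrow> portrait set \<Rightarrow> bool" where
  "self_replicating d G \<longleftrightarrow> self_similar d G \<and> (\<forall>x<d. sect [x] ` G = G)"

definition contracting :: "nat \<Rightarrow> portrait set \<Rightarrow> bool" where
  "contracting d G \<longleftrightarrow> self_similar d G \<and>
     (\<exists>N\<subseteq>G. finite N \<and> (\<forall>g\<in>G. \<exists>k. \<forall>v\<in>words d. k \<le> length v \<longrightarrow> sect v g \<in> N))"

definition St :: "nat \<Rightarrow> nat \<Rightarrow> portrait set" where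
  "St d n = {g \<in> carrier (tree_aut d). \<forall>w\<in>level d n. act g w = w}"

definition delta :: "nat list \<Rightarrow> portrait \<Rightarrow> portrait" where
  "delta v g u = (if take (length v) u = v then g (drop (length v) u) else id)"

text \<open>Finite products of pairwise commuting subgroups are rendered as the subgroup that they
  generate.\<close>

definition star :: "nat \<Rightarrow> nat \<Rightarrow> portrait set \<Rightarrow> portrait set" where
  "star d n H = generate (tree_aut d) (\<Union>v\<in>level d n. delta v ` H)"

definition Rst_vertex :: "nat \<Rightarrow> portrait set \<Rightarrow> nat list \<Rightarrow> portrait set" where
  "Rst_vertex d G v = {g \<in> G. \<forall>w\<in>words d. take (length v) w \<noteq> v \<longrightarrow> act g w = w}"

definition Rst :: "nat \<Rightarrow> portrait set \<Rightarrow> nat \<Rightarrow> portrait set" where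
  "Rst d G n = generate (tree_aut d) (\<Union>v\<in>level d n. Rst_vertex d G v)"

definition branches_over :: "nat \<Rightarrow> portrait set \<Rightarrow> portrait set \<Rightarrow> bool" where
  "branches_over d G K \<longleftrightarrow> self_similar d G \<and> subgroup K (subgrp d G) \<and> star d 1 K \<subseteq> K"

definition regular_branch_over :: "nat \<Rightarrow> portrait set \<Rightarrow> portrait set \<Rightarrow> bool" where
  "regular_branch_over d G K \<longleftrightarrow>
     branches_over d G K \<and> K \<lhd> subgrp d G \<and> finite (rcosets\<^bsub>subgrp d G\<^esub> K)"

definition regular_branch :: "nat \<Rightarrow> portrait set \<Rightarrow> bool" where
  "regular_branch d G \<longleftrightarrow> (\<exists>K. regular_branch_over d G K)"

definition aut_topology :: "nat \<Rightarrow> portrait topology" where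
  "aut_topology d =
     topology_generated_by {g <#\<^bsub>tree_aut d\<^esub> St d n | g n. g \<in> carrier (tree_aut d)}"

definition clos :: "nat \<Rightarrow> portrait set \<Rightarrow> portrait set" where
  "clos d S = aut_topology d closure_of S"

definition hdim :: "nat \<Rightarrow> portrait set \<Rightarrow> ereal" where
  "hdim d \<Gamma> = liminf (\<lambda>n.
     ereal ((real d - 1) * log (2 * real d) (real (index d \<Gamma> (\<Gamma> \<inter> St d n))) / (real d ^ n - 1)))"

text \<open>For \<open>N m \<supseteq> N n\<close> normal in \<open>G\<close>, the natural map \<open>G / N n \<rightarrow> G / N m\<close> sends a coset \<open>C\<close> to
  \<open>N m <#> C\<close>, the coset of \<open>N m\<close> containing \<open>C\<close>.\<close>

definition inverse_limit ::
    "('a, 'b) monoid_scheme \<Rightarrow> (nat \<Rightarrow> 'a set) \<Rightarrow> (nat \<Rightarrow> 'a set) monoid" where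
  "inverse_limit G N =
     (product_group UNIV (\<lambda>n. G Mod N n))
       \<lparr>carrier := {x \<in> carrier (product_group UNIV (\<lambda>n. G Mod N n)).
                      \<forall>m n. m \<le> n \<longrightarrow> N m <#>\<^bsub>G\<^esub> x n = x m}\<rparr>"

definition rigid_kernel :: "nat \<Rightarrow> portrait set \<Rightarrow> (nat \<Rightarrow> portrait set) monoid" where
  "rigid_kernel d G =
     (inverse_limit (subgrp d G) (Rst d G))
       \<lparr>carrier := kernel (inverse_limit (subgrp d G) (Rst d G))
                         (inverse_limit (subgrp d G) (\<lambda>n. G \<inter> St d n))
                         (\<lambda>x n. (G \<inter> St d n) <#>\<^bsub>subgrp d G\<^esub> x n)\<rparr>"

definition elem_abelian_2 :: "('a, 'b) monoid_scheme \<Rightarrow> bool" where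
  "elem_abelian_2 G \<longleftrightarrow> comm_group G \<and> (\<forall>x\<in>carrier G. x \<otimes>\<^bsub>G\<^esub> x = \<one>\<^bsub>G\<^esub>)"

definition elem_abelian_2_rank :: "('a, 'b) monoid_scheme \<Rightarrow> nat \<Rightarrow> bool" where
  "elem_abelian_2_rank G r \<longleftrightarrow>
     elem_abelian_2 G \<and> G \<cong> product_group {..<r} (\<lambda>_. integer_mod_group 2)"

definition wreath :: "nat \<Rightarrow> portrait set" where
  "wreath d = {g \<in> carrier (tree_aut d). \<forall>u\<in>words d. g u \<in> carrier (dihedral d)}"

definition pattern_dom :: "nat \<Rightarrow> nat list set" where
  "pattern_dom d = level d 0 \<union> level d 1"

definition patterns :: "nat \<Rightarrow> portrait set" where
  "patterns d = pattern_dom d \<rightarrow>\<^sub>E carrier (dihedral d)"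

definition appears_at :: "nat \<Rightarrow> portrait \<Rightarrow> portrait \<Rightarrow> nat list \<Rightarrow> bool" where
  "appears_at d p f u \<longleftrightarrow> p = restrict (sect u f) (pattern_dom d)"

definition finitely_constrained :: "nat \<Rightarrow> portrait set \<Rightarrow> portrait set" where
  "finitely_constrained d P =
     {f \<in> wreath d. \<forall>u\<in>words d. \<forall>p\<in>patterns d. appears_at d p f u \<longrightarrow> p \<in> P}"

text \<open>The product is \<open>\<pi> \<pi>\<^sub>0 \<pi>\<^sub>1 \<dots>\<close>, with \<open>\<pi> = p []\<close> and \<open>\<pi>\<^sub>x = p [x]\<close>.\<close>

definition allowed :: "nat \<Rightarrow> portrait \<Rightarrow> bool" where
  "allowed d p \<longleftrightarrow> p [] \<circ> foldr (\<circ>) (map (\<lambda>x. p [x]) [0..<d]) id \<in> rotations d"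

primrec gen_a :: "nat \<Rightarrow> nat \<Rightarrow> portrait" where
  "gen_a d i [] = mirror d i"
| "gen_a d i (x # u) = (if x = i then gen_a d i u else id)"

definition grpD :: "nat \<Rightarrow> portrait set" where
  "grpD d = generate (tree_aut d) (gen_a d ` {..<d})"

definition grpD' :: "nat \<Rightarrow> portrait set" where
  "grpD' d = derived (tree_aut d) (grpD d)"

end

theory Submission
  imports Defs "HOL-Library.Z2" "HOL-Library.Function_Algebras"
begin

text \<open>
  The theorem rests on a description of \<open>D\<close> by parities. A word in the generators is a walk in the
  Cayley graph of the dihedral group with respect to the mirrors, and this graph is the complete
  bipartite graph on \<open>d\<close> rotations and \<open>d\<close> mirrors. At each step of the walk exactly one letter \<open>x\<close>
  receives a new letter \<open>i\<close> in its section, and the \<open>d\<^sup>2\<close> pairs \<open>(x, i)\<close> correspond to the \<open>d\<^sup>2\<close> edges.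
  Let \<open>par g i\<close> be the parity of the number of letters \<open>i\<close> in a word for \<open>g\<close>; this is well defined, and
  \<open>D'\<close> is its kernel (\<open>derived_eq\<close>). The matrix of the parities of the first-level sections of \<open>g\<close> is then
  a chain modulo 2 with boundary \<open>[id] + [g []]\<close> (\<open>boundary\<close>), and every such chain occurs (\<open>realization\<close>).

  The squares of four-cycles in the graph show that \<open>D\<close> branches over \<open>D'\<close> (\<open>delta_D'\<close>). Together these
  facts determine \<open>D\<close> recursively (\<open>glue_in_D_iff\<close>): a root permutation and sections from \<open>D\<close> fit together to
  an element of \<open>D\<close> if and only if the boundary condition holds. An element of \<open>D\<close> with trivial root label and only one
  nontrivial section at the first level has all parities zero there, which identifies the rigid stabilizers
  (\<open>Rst_eq_star\<close>).

  All indices now come from one recursion (\<open>count_levels\<close>), whose input is the number of solutions of linear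
  systems over the field with two elements: cycles of the graph, the subspace \<open>spaceA\<close> of those with even
  rows, and the subspace \<open>spaceB\<close> of those that have even columns as well. Their dimensions are
  \<open>(d - 1)^2\<close>, \<open>(d - 1) * (d - 2)\<close> and \<open>(d - 1) * (d - 3)\<close>, because the boundary, the row sums and the column
  sums map onto all vectors of even weight.

  For the closure, only the number of mirrors modulo 2 survives of the boundary condition: the elements of
  \<open>D\<close> that fix a given level still attain all even parity vectors (\<open>even_par_in_stabilizer\<close>), so every
  portrait with allowed patterns is approximated by elements of \<open>D\<close> (\<open>constrained_approximation\<close>).

  An element of the rigid kernel assigns to every vertex other than the root the class in \<open>D / D'\<close> of a
  section. The classes below a vertex form a cycle with column sums equal to the class at that vertex
  (\<open>families\<close>). So at the root a matrix in \<open>spaceA\<close> can be chosen freely, and at every other vertex \<open>v\<close>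
  there is a coset of \<open>spaceB\<close> to choose from; an additive section of the column sums trivializes
  these cosets (\<open>families_iso\<close>).
\<close>

section \<open>The dihedral group\<close>

locale odd_gon =
  fixes d :: nat
  assumes odd_d: "odd d" and d_ge_3: "d \<ge> 3"
begin

lemma d_pos: "d > 0" using d_ge_3 by simp

definition pt :: "int \<Rightarrow> nat" where
  "pt z = nat (z mod int d)"

text \<open>Symmetries of the polygon as affine maps modulo \<open>d\<close>: with \<open>s = 1\<close> a rotation and with \<open>s = -1\<close> a
  mirror symmetry. The parameters are integers, so that composition is that of affine maps of \<open>\<int>\<close>.\<close>

definition aff :: "int \<Rightarrow> int \<Rightarrow> nat \<Rightarrow> nat" where
  "aff s r x = (if x < d then pt (s * int x + r) else x)"

lemma pt_less [simp]: "pt z < d"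
  using d_pos by (simp add: pt_def nat_less_iff)

lemma int_pt: "int (pt z) = z mod int d"
  using d_pos by (simp add: pt_def)

lemma pt_eq_iff: "pt a = pt b \<longleftrightarrow> int d dvd a - b"
proof -
  have "pt a = pt b \<longleftrightarrow> a mod int d = b mod int d"
    using int_pt by (metis pt_def)
  then show ?thesis by (simp add: mod_eq_dvd_iff)
qed

lemma pt_of_nat: "x < d \<Longrightarrow> pt (int x) = x"
  by (simp add: pt_def)

lemma pt_affine: "pt (s * int (pt z) + r) = pt (s * z + r)"
  unfolding pt_eq_iff int_pt
  by (metis add_diff_cancel_right dvd_mult minus_mod_eq_mult_div dvd_triv_left right_diff_distrib
      mod_eq_dvd_iff mod_mod_trivial)

lemma aff_less: "x < d \<Longrightarrow> aff s r x < d"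
  by (simp add: aff_def)

lemma aff_comp: "aff s r \<circ> aff s' r' = aff (s * s') (s * r' + r)"
  by (rule ext) (simp add: aff_def pt_affine, simp add: algebra_simps)

lemma aff_id: "aff 1 0 = id"
  by (rule ext) (simp add: aff_def pt_of_nat)

lemma aff_cong_shift: "int d dvd r - r' \<Longrightarrow> aff s r = aff s r'"
  by (rule ext) (simp add: aff_def pt_eq_iff)

lemma not_dvd_two: "\<not> int d dvd 2"
proof
  assume "int d dvd 2"
  then have "int d \<le> 2" by (rule zdvd_imp_le) simp
  then show False using d_ge_3 by simp
qed

lemma aff_eq_iff:
  assumes "s = 1 \<or> s = -1" "s' = 1 \<or> s' = -1"
  shows "aff s r = aff s' r' \<longleftrightarrow> s = s' \<and> int d dvd r - r'"
proof
  assume eq: "aff s r = aff s' r'"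
  have 0: "int d dvd r - r'"
    using fun_cong[OF eq, of 0] d_pos by (simp add: aff_def pt_eq_iff)
  have "int d dvd (s + r) - (s' + r')"
    using fun_cong[OF eq, of 1] d_ge_3 by (simp add: aff_def pt_eq_iff)
  then have "int d dvd ((s + r) - (s' + r')) - (r - r')" using 0 dvd_diff by blast
  then have "int d dvd s - s'" by (simp add: algebra_simps)
  then have "s = s'" using assms not_dvd_two by auto
  then show "s = s' \<and> int d dvd r - r'" using 0 by simp
qed (auto intro: aff_cong_shift)

text \<open>Here the parity of \<open>d\<close> enters: 2 is invertible modulo \<open>d\<close>.\<close>

lemma dvd_two_mult: "int d dvd 2 * z \<longleftrightarrow> int d dvd z"
proof -
  have "coprime (int d) 2" using odd_d by simp
  then show ?thesis by (simp add: coprime_dvd_mult_right_iff)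
qed

text \<open>The factors of a mirror act on the disjoint pairs \<open>{i - j, i + j}\<close>, and on each pair the transposition is the
  restriction of the reflection at \<open>i\<close>.\<close>

lemma foldr_mirror:
  assumes "i < d" "distinct js" "set js \<subseteq> {1..(d - 1) div 2}"
  shows "foldr (\<lambda>j p. Transposition.transpose ((i + d - j) mod d) ((i + j) mod d) \<circ> p) js id x
       = (if \<exists>j\<in>set js. x = pt (int i - int j) \<or> x = pt (int i + int j) then aff (-1) (2 * int i) x
          else x)"
  using assms(2,3)
proof (induction js)
  case Nil
  then show ?case by simp
next
  case (Cons j js)
  let ?F = "\<lambda>j p. Transposition.transpose ((i + d - j) mod d) ((i + j) mod d) \<circ> p"
  define f where "f = foldr ?F js id"
  let ?in = "\<lambda>x js. \<exists>j\<in>set js. x = pt (int i - int j) \<or> x = pt (int i + int j)"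
  let ?R = "aff (-1) (2 * int i)"
  have j: "1 \<le> j" "j \<le> (d - 1) div 2" "j \<notin> set js" using Cons.prems by auto
  have jd: "2 * int j < int d" using j d_ge_3 by linarith
  have IH: "f x = (if ?in x js then ?R x else x)"
    unfolding f_def by (rule Cons.IH) (use Cons.prems in auto)
  have step: "foldr ?F (j # js) id x = Transposition.transpose ((i + d - j) mod d) ((i + j) mod d) (f x)"
    by (simp only: foldr.simps o_apply f_def)
  have minus: "(i + d - j) mod d = pt (int i - int j)"
  proof -
    have "int ((i + d - j) mod d) = (int i - int j + int d) mod int d"
      using jd by (simp add: zmod_int of_nat_diff algebra_simps)
    also have "\<dots> = int (pt (int i - int j))" by (simp add: int_pt)
    finally show ?thesis by simp
  qed
  have plus: "(i + j) mod d = pt (int i + int j)"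
  proof -
    have "int ((i + j) mod d) = int (pt (int i + int j))" by (simp add: int_pt zmod_int)
    then show ?thesis by simp
  qed
  have Rm: "?R (pt (int i - int l)) = pt (int i + int l)"
    and Rp: "?R (pt (int i + int l)) = pt (int i - int l)" for l
    using pt_affine[of "-1" "int i - int l" "2 * int i"] pt_affine[of "-1" "int i + int l" "2 * int i"]
    by (simp_all add: aff_def algebra_simps)
  have small: "int d dvd a \<Longrightarrow> \<bar>a\<bar> < int d \<Longrightarrow> a = 0" for a :: int
    using dvd_imp_le_int[of a "int d"] by auto
  have ne: "pt (int i - int j) \<noteq> pt (int i - int l)" "pt (int i - int j) \<noteq> pt (int i + int l)"
     "pt (int i + int j) \<noteq> pt (int i - int l)" "pt (int i + int j) \<noteq> pt (int i + int l)"
    if "l \<in> set js" for l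
  proof -
    have l: "1 \<le> l" "l \<le> (d - 1) div 2" "l \<noteq> j" using that Cons.prems by auto
    have ld: "2 * int l < int d" using l d_ge_3 by linarith
    show "pt (int i - int j) \<noteq> pt (int i - int l)" "pt (int i - int j) \<noteq> pt (int i + int l)"
     "pt (int i + int j) \<noteq> pt (int i - int l)" "pt (int i + int j) \<noteq> pt (int i + int l)"
      unfolding pt_eq_iff using l ld j jd
      by (auto dest!: small)
  qed
  show ?case
  proof (cases "?in x js")
    case True
    then obtain l where l: "l \<in> set js" "x = pt (int i - int l) \<or> x = pt (int i + int l)" by blast
    have "?R x \<noteq> pt (int i - int j)" "?R x \<noteq> pt (int i + int j)"
      using l ne[OF l(1)] Rm[of l] Rp[of l] by metis+
    then show ?thesis unfolding step using True IH by (auto simp: minus plus)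
  next
    case False
    then show ?thesis unfolding step using IH by (auto simp: minus plus Rm Rp)
  qed
qed

lemma mirror_eq_aff:
  assumes "i < d"
  shows "mirror d i = aff (-1) (2 * int i)"
proof
  fix x
  have "(if \<exists>j\<in>{1..(d - 1) div 2}. x = pt (int i - int j) \<or> x = pt (int i + int j)
         then aff (-1) (2 * int i) x else x) = aff (-1) (2 * int i) x"
  proof (cases "x < d \<and> x \<noteq> i")
    case True
    define a where "a = (int x - int i) mod int d"
    have a: "0 < a" "a < int d"
    proof -
      have "\<not> int d dvd int x - int i"
        using True assms pt_eq_iff[of "int x" "int i"] by (simp add: pt_of_nat)
      then have "a \<noteq> 0" by (simp add: a_def dvd_eq_mod_eq_0)
      moreover have "0 \<le> a" "a < int d" using d_pos by (auto simp: a_def)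
      ultimately show "0 < a" "a < int d" by auto
    qed
    have da: "int d dvd int x - int i - a" by (simp add: a_def minus_mod_eq_mult_div)
    have "\<exists>j\<in>{1..(d - 1) div 2}. x = pt (int i - int j) \<or> x = pt (int i + int j)"
    proof (cases "nat a \<le> (d - 1) div 2")
      case t: True
      have "x = pt (int i + int (nat a))"
        using True a da pt_eq_iff[of "int x" "int i + a"] by (simp add: pt_of_nat algebra_simps)
      then show ?thesis using a t by (intro bexI[of _ "nat a"]) auto
    next
      case f: False
      have "int d dvd int x - int i - a + int d" using da by simp
      then have "x = pt (int i - int (nat (int d - a)))"
        using True a pt_eq_iff[of "int x" "int i - (int d - a)"]
        by (simp add: pt_of_nat algebra_simps)
      moreover have "nat (int d - a) \<le> (d - 1) div 2" using f a odd_d by (auto elim!: oddE)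
      ultimately show ?thesis using a by (intro bexI[of _ "nat (int d - a)"]) auto
    qed
    then show ?thesis by simp
  next
    case False
    then have "aff (-1) (2 * int i) x = x"
      using assms by (auto simp: aff_def pt_of_nat)
    then show ?thesis by simp
  qed
  then show "mirror d i x = aff (-1) (2 * int i) x"
    unfolding mirror_def using foldr_mirror[OF assms, of "[1..<Suc ((d - 1) div 2)]" x]
    by (simp add: atLeastLessThanSuc_atLeastAtMost del: upt_Suc)
qed

lemma rho_funpow: "rho d ^^ i = aff 1 (int i)"
proof (induction i)
  case 0
  then show ?case by (simp add: aff_id)
next
  case (Suc i)
  have rho: "rho d = aff 1 1"
    by (rule ext) (auto simp: rho_def aff_def pt_def nat_mod_distrib nat_add_distrib)
  have "rho d ^^ Suc i = rho d \<circ> rho d ^^ i" by simp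
  also have "\<dots> = aff 1 1 \<circ> aff 1 (int i)" unfolding Suc.IH unfolding rho ..
  finally show ?case by (simp add: aff_comp add.commute)
qed

lemma mod_representative: "\<exists>i<d. int d dvd r - int i"
  by (metis int_pt mod_eq_dvd_iff mod_mod_trivial pt_less)

lemma rotations_eq: "rotations d = range (aff 1)"
proof -
  have "\<exists>i<d. aff 1 r = aff 1 (int i)" for r
    using mod_representative[of r] aff_cong_shift by blast
  then show ?thesis by (auto simp: rotations_def rho_funpow)
qed

lemma mirrors_eq: "mirrors d = range (aff (-1))"
proof -
  have "\<exists>i<d. aff (-1) r = mirror d i" for r
  proof -
    obtain m where m: "d = 2 * m + 1" using odd_d by (auto elim: oddE)
    \<comment> \<open>\<open>m + 1\<close> is the inverse of 2 modulo \<open>d\<close>, so \<open>i\<close> is half of \<open>r\<close>\<close>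
    obtain i where i: "i < d" "int d dvd r * (int m + 1) - int i"
      using mod_representative by blast
    have "int d dvd 2 * (r * (int m + 1) - int i) - int d * r"
      by (intro dvd_diff dvd_mult i(2) dvd_triv_left)
    moreover have "2 * (r * (int m + 1) - int i) - int d * r = r - 2 * int i"
      by (simp add: m algebra_simps)
    ultimately have "int d dvd r - 2 * int i" by (simp only:)
    then show ?thesis using i aff_cong_shift by (auto simp: mirror_eq_aff)
  qed
  then show ?thesis by (force simp: mirrors_def mirror_eq_aff)
qed

definition dih :: "(nat \<Rightarrow> nat) set" where
  "dih = rotations d \<union> mirrors d"

text \<open>The sign character, with values in the field with two elements so that the parity of a number of mirrors
  is a sum.\<close>

definition mir :: "(nat \<Rightarrow> nat) \<Rightarrow> bit" where
  "mir p = of_bool (p \<in> mirrors d)"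

lemma dih_cases:
  assumes "p \<in> dih"
  obtains s r where "s = 1 \<or> s = -1" "p = aff s r"
  using assms by (auto simp: dih_def rotations_eq mirrors_eq)

lemma aff_in_dih: "s = 1 \<or> s = -1 \<Longrightarrow> aff s r \<in> dih"
  by (auto simp: dih_def rotations_eq mirrors_eq)

lemma aff_in_mirrors: "s = 1 \<or> s = -1 \<Longrightarrow> aff s r \<in> mirrors d \<longleftrightarrow> s = -1"
  by (auto simp: mirrors_eq image_iff aff_eq_iff intro: exI[of _ r])

lemma aff_in_rotations: "s = 1 \<or> s = -1 \<Longrightarrow> aff s r \<in> rotations d \<longleftrightarrow> s = 1"
  by (auto simp: rotations_eq image_iff aff_eq_iff intro: exI[of _ r])

lemma rotations_mirrors_disjoint: "rotations d \<inter> mirrors d = {}"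
  by (auto simp: rotations_eq mirrors_eq aff_eq_iff)

lemma dih_comp: "p \<in> dih \<Longrightarrow> q \<in> dih \<Longrightarrow> p \<circ> q \<in> dih"
  by (elim dih_cases) (auto simp: aff_comp intro: aff_in_dih)

lemma mir_comp: "p \<in> dih \<Longrightarrow> q \<in> dih \<Longrightarrow> mir (p \<circ> q) = mir p + mir q"
  by (elim dih_cases) (auto simp: aff_comp mir_def aff_in_mirrors)

lemma mir_eq_0_iff: "p \<in> dih \<Longrightarrow> mir p = 0 \<longleftrightarrow> p \<in> rotations d"
  by (elim dih_cases) (auto simp: mir_def aff_in_mirrors aff_in_rotations)

lemma id_in_dih: "id \<in> dih" by (metis aff_id aff_in_dih)

lemma mir_id [simp]: "mir id = 0"
  by (metis aff_id aff_in_mirrors mir_def of_bool_eq(1) one_neq_neg_one)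

lemma mirror_in_dih: "i < d \<Longrightarrow> mirror d i \<in> dih"
  by (simp add: dih_def mirrors_def)

lemma mir_mirror: "i < d \<Longrightarrow> mir (mirror d i) = 1"
  by (simp add: mir_def mirrors_def)

lemma dih_left_inverse: "p \<in> dih \<Longrightarrow> \<exists>q\<in>dih. q \<circ> p = id \<and> p \<circ> q = id"
proof (elim dih_cases)
  fix s r assume s: "s = 1 \<or> s = -1" and p: "p = aff s r"
  have "aff s (- s * r) \<circ> aff s r = id" "aff s r \<circ> aff s (- s * r) = id"
    using s by (auto simp: aff_comp aff_id)
  then show "\<exists>q\<in>dih. q \<circ> p = id \<and> p \<circ> q = id" using s p aff_in_dih by blast
qed

lemma dih_permutes: "p \<in> dih \<Longrightarrow> p permutes {..<d}"
proof -
  assume p: "p \<in> dih"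
  obtain q where q: "q \<in> dih" "q \<circ> p = id" "p \<circ> q = id" using dih_left_inverse p by blast
  have "\<forall>x. x \<notin> {..<d} \<longrightarrow> p x = x" using p by (elim dih_cases) (auto simp: aff_def)
  moreover have "bij p" using q o_bij by blast
  ultimately show ?thesis by (simp add: permutes_def bij_iff)
qed

lemma dih_less: "p \<in> dih \<Longrightarrow> x < d \<Longrightarrow> p x < d"
  by (elim dih_cases) (simp add: aff_less)

lemma dih_inj: "p \<in> dih \<Longrightarrow> p x = p y \<longleftrightarrow> x = y"
  using dih_permutes permutes_inj by (metis injD)

lemma mirror_mirror: "i < d \<Longrightarrow> mirror d i \<circ> mirror d i = id"
  by (simp add: mirror_eq_aff aff_comp aff_id)

lemma mirror_mirror_apply [simp]: "i < d \<Longrightarrow> mirror d i (mirror d i x) = x"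
  using mirror_mirror by (metis comp_apply id_apply)

lemma mirror_fixes_iff: "i < d \<Longrightarrow> x < d \<Longrightarrow> mirror d i x = x \<longleftrightarrow> x = i"
proof -
  assume i: "i < d" "x < d"
  have "mirror d i x = x \<longleftrightarrow> pt (- int x + 2 * int i) = pt (int x)"
    using i by (simp add: mirror_eq_aff aff_def pt_of_nat)
  also have "\<dots> \<longleftrightarrow> int d dvd 2 * (int i - int x)" by (simp add: pt_eq_iff algebra_simps)
  also have "\<dots> \<longleftrightarrow> pt (int i) = pt (int x)" by (simp only: dvd_two_mult pt_eq_iff)
  finally show ?thesis using i by (auto simp: pt_of_nat)
qed

lemma mirror_less: "i < d \<Longrightarrow> x < d \<Longrightarrow> mirror d i x < d"
  by (simp add: mirror_in_dih dih_less)

lemma dih_eq_iff_apply: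
  assumes "p \<in> dih" "q \<in> dih" "x < d" "mir p = mir q"
  shows "p x = q x \<longleftrightarrow> p = q"
proof
  obtain s r where p: "s = 1 \<or> s = -1" "p = aff s r" using assms dih_cases by blast
  obtain s' r' where q: "s' = 1 \<or> s' = -1" "q = aff s' r'" using assms dih_cases by blast
  have ss: "s = s'" using assms(4) p q by (auto simp: mir_def aff_in_mirrors)
  assume "p x = q x"
  then show "p = q" using assms(3) p q ss
    by (auto simp: aff_def pt_eq_iff fun_eq_iff)
qed simp

text \<open>Two symmetries that agree at \<open>x\<close> differ by an element of the stabilizer of a point, which consists of the
  identity and one mirror.\<close>

lemma dih_agree_iff:
  assumes "p \<in> dih" "q \<in> dih" "x < d" 
  shows "p x = q x \<longleftrightarrow> p = q \<or> p = mirror d (q x) \<circ> q"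
proof -
  have qx: "q x < d" using assms dih_less by blast
  have m: "mir (mirror d (q x) \<circ> q) = 1 + mir q"
    using qx assms by (simp add: mir_comp mirror_in_dih mir_mirror)
  show ?thesis
  proof (cases "mir p = mir q")
    case True
    then have "mir p \<noteq> mir (mirror d (q x) \<circ> q)" using m by (cases "mir p"; cases "mir q") auto
    then have "p \<noteq> mirror d (q x) \<circ> q" by blast
    then show ?thesis using dih_eq_iff_apply[OF assms True] by blast
  next
    case False
    then have "mir p = mir (mirror d (q x) \<circ> q)" using m by (cases "mir p"; cases "mir q") auto
    moreover have "(mirror d (q x) \<circ> q) x = q x" using mirror_fixes_iff[OF qx qx] by simp
    ultimately have "p x = q x \<longleftrightarrow> p = mirror d (q x) \<circ> q"
      using dih_eq_iff_apply[of p "mirror d (q x) \<circ> q" x] assms qx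
      by (metis dih_comp mirror_in_dih)
    then show ?thesis using False by blast
  qed
qed

text \<open>The rotations and the mirrors each form a sharply transitive set of permutations.\<close>

lemma dih_transitive:
  assumes "x < d" "y < d"
  shows "\<exists>!p. p \<in> dih \<and> mir p = b \<and> p x = y"
proof -
  define s :: int where "s = (if b = 1 then -1 else 1)"
  have s: "s = 1 \<or> s = -1" by (simp add: s_def)
  define p where "p = aff s (int y - s * int x)"
  have p: "p \<in> dih" "mir p = b" "p x = y"
    using s assms by (auto simp: p_def aff_in_dih mir_def aff_in_mirrors aff_def pt_of_nat s_def)
  then show ?thesis
  proof (intro ex1I conjI)
    fix q assume "q \<in> dih \<and> mir q = b \<and> q x = y"
    then show "q = p" using p dih_eq_iff_apply[of q p x] assms by simp
  qed
qed

lemma card_rotations: "card (rotations d) = d"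
proof -
  have "rotations d = (\<lambda>i. aff 1 (int i)) ` {..<d}" by (auto simp: rotations_def rho_funpow)
  moreover have "inj_on (\<lambda>i. aff 1 (int i)) {..<d}"
    by (auto intro!: inj_onI simp: aff_eq_iff pt_eq_iff[symmetric] pt_of_nat)
  ultimately show ?thesis by (simp add: card_image)
qed

lemma card_mirrors: "card (mirrors d) = d"
proof -
  have "inj_on (mirror d) {..<d}"
    by (rule inj_onI) (metis lessThan_iff mirror_fixes_iff)
  then show ?thesis by (simp add: mirrors_def card_image)
qed

lemma finite_dih: "finite dih"
  using d_pos card_rotations card_mirrors by (auto simp: dih_def intro: card_ge_0_finite)

lemma card_dih: "card dih = 2 * d"
  unfolding dih_def using d_pos card_rotations card_mirrors rotations_mirrors_disjoint
  by (subst card_Un_disjoint) (auto intro: card_ge_0_finite)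

lemma card_dih_mir: "card {p \<in> dih. mir p = b} = d"
proof (cases b)
  case zero
  then have "{p \<in> dih. mir p = b} = rotations d"
    using mir_eq_0_iff by (auto simp: dih_def)
  then show ?thesis by (simp add: card_rotations)
next
  case one
  then have "{p \<in> dih. mir p = b} = mirrors d"
    by (auto simp: dih_def mir_def)
  then show ?thesis by (simp add: card_mirrors)
qed

lemma group_sym_X: "group (sym_X d)"
proof (rule groupI)
  fix p assume "p \<in> carrier (sym_X d)"
  then have p: "p permutes {..<d}" by (simp add: sym_X_def)
  show "\<exists>q\<in>carrier (sym_X d). q \<otimes>\<^bsub>sym_X d\<^esub> p = \<one>\<^bsub>sym_X d\<^esub>"
    using p permutes_inv[OF p] permutes_inv_o[OF p] by (auto simp: sym_X_def)
qed (auto simp: sym_X_def permutes_compose permutes_id comp_assoc)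

lemma carrier_dihedral: "carrier (dihedral d) = dih"
proof -
  interpret S: group "sym_X d" by (rule group_sym_X)
  have m: "mirrors d \<subseteq> carrier (sym_X d)"
    by (auto simp: sym_X_def dih_def intro!: dih_permutes)
  have "subgroup dih (sym_X d)"
  proof (rule S.subgroupI)
    show "dih \<subseteq> carrier (sym_X d)" by (auto simp: sym_X_def intro: dih_permutes)
    show "dih \<noteq> {}" using id_in_dih by blast
  next
    fix p assume p: "p \<in> dih"
    then obtain q where q: "q \<in> dih" "q \<circ> p = id" using dih_left_inverse by blast
    then have "inv\<^bsub>sym_X d\<^esub> p = q"
      using p by (intro S.inv_equality) (auto simp: sym_X_def intro: dih_permutes)
    then show "inv\<^bsub>sym_X d\<^esub> p \<in> dih" using q by simp
  next
    fix p q assume "p \<in> dih" "q \<in> dih"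
    then show "p \<otimes>\<^bsub>sym_X d\<^esub> q \<in> dih" by (simp add: sym_X_def dih_comp)
  qed
  then have "generate (sym_X d) (mirrors d) \<subseteq> dih"
    by (intro S.generate_subgroup_incl) (auto simp: dih_def)
  moreover have "dih \<subseteq> generate (sym_X d) (mirrors d)"
  proof
    fix p assume "p \<in> dih"
    then obtain s r where s: "s = 1 \<or> s = -1" "p = aff s r" by (rule dih_cases)
    have mir: "aff (-1) z \<in> generate (sym_X d) (mirrors d)" for z
      by (rule generate.incl) (simp add: mirrors_eq)
    have "aff 1 r = aff (-1) r \<otimes>\<^bsub>sym_X d\<^esub> aff (-1) 0"
      by (simp add: sym_X_def aff_comp)
    then have "aff 1 r \<in> generate (sym_X d) (mirrors d)" by (metis mir generate.eng)
    then show "p \<in> generate (sym_X d) (mirrors d)" using s mir by auto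
  qed
  ultimately show ?thesis by (simp add: dihedral_def)
qed

end

section \<open>Portraits and their sections\<close>

lemma words_Nil [simp]: "[] \<in> words d"
  by (simp add: words_def)

lemma words_Cons [simp]: "x # u \<in> words d \<longleftrightarrow> x < d \<and> u \<in> words d"
  by (simp add: words_def)

lemma words_append [simp]: "u @ v \<in> words d \<longleftrightarrow> u \<in> words d \<and> v \<in> words d"
  by (auto simp: words_def)

lemma words_rev [simp]: "rev u \<in> words d \<longleftrightarrow> u \<in> words d"
  by (simp add: words_def in_lists_conv_set)

lemma level_0 [simp]: "level d 0 = {[]}"
  by (auto simp: level_def)

lemma level_Suc: "level d (Suc n) = (\<Union>x<d. (#) x ` level d n)"
  by (auto simp: level_def length_Suc_conv)

lemma finite_level: "finite (level d n)"
  by (induction n) (auto simp: level_Suc)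

lemma level_iff: "v \<in> level d n \<longleftrightarrow> v \<in> words d \<and> length v = n"
  by (auto simp: level_def)

lemma length_act [simp]: "length (act g w) = length w"
  by (simp add: act_def)

lemma act_Nil [simp]: "act g [] = []"
  by (simp add: act_def)

lemma sect_Nil [simp]: "sect [] g = g"
  by (simp add: sect_def)

lemma sect_sect: "sect u (sect v g) = sect (v @ u) g"
  by (simp add: sect_def)

lemma sect_apply: "sect v g u = g (v @ u)"
  by (simp add: sect_def)

lemma act_Cons [simp]: "act g (x # u) = g [] x # act (sect [x] g) u"
proof -
  have "[0..<length (x # u)] = 0 # map Suc [0..<length u]"
    by (simp add: map_Suc_upt upt_conv_Cons del: upt_Suc)
  then show ?thesis by (simp add: act_def sect_def del: upt_Suc)
qed

lemma act_append: "act g (v @ u) = act g v @ act (sect v g) u"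
  by (induction v arbitrary: g) (auto simp: sect_sect)

definition idp :: portrait where
  "idp u = id"

lemma idp_apply: "idp u x = x"
  by (simp add: idp_def)

lemma mult_tree_aut: "f \<otimes>\<^bsub>tree_aut d\<^esub> g = (\<lambda>u. f (act g u) \<circ> g u)"
  by (simp add: tree_aut_def)

lemma one_tree_aut: "\<one>\<^bsub>tree_aut d\<^esub> = idp"
  by (simp add: tree_aut_def idp_def[abs_def])

lemma sect_mult: "sect v (f \<otimes>\<^bsub>tree_aut d\<^esub> g) = sect (act g v) f \<otimes>\<^bsub>tree_aut d\<^esub> sect v g"
  by (simp add: mult_tree_aut sect_def[abs_def] act_append)

lemma root_mult: "(f \<otimes>\<^bsub>tree_aut d\<^esub> g) [] = f [] \<circ> g []"
  by (simp add: mult_tree_aut)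

lemma sect_one [simp]: "sect v idp = idp"
  by (intro ext) (simp add: sect_apply idp_apply)

lemma act_one [simp]: "act idp w = w"
proof (induction w)
  case (Cons x w)
  have "idp [] x = x" by (simp add: idp_def)
  then have "act idp (x # w) = x # act idp w" by (metis act_Cons sect_one)
  then show ?case by (simp only: Cons.IH)
qed simp

lemma act_mult: "act (f \<otimes>\<^bsub>tree_aut d\<^esub> g) w = act f (act g w)"
  by (induction w arbitrary: f g) (auto simp: sect_mult root_mult)

lemma carrier_permutes: "g \<in> carrier (tree_aut d) \<Longrightarrow> g u permutes {..<d}"
  by (cases "u \<in> words d") (auto simp: tree_aut_def permutes_id)

lemma carrier_outside: "g \<in> carrier (tree_aut d) \<Longrightarrow> u \<notin> words d \<Longrightarrow> g u = id"
  by (simp add: tree_aut_def)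

lemma carrier_iff:
  "g \<in> carrier (tree_aut d) \<longleftrightarrow> (\<forall>u\<in>words d. g u permutes {..<d}) \<and> (\<forall>u. u \<notin> words d \<longrightarrow> g u = id)"
  by (simp add: tree_aut_def)

lemma carrier_less: "g \<in> carrier (tree_aut d) \<Longrightarrow> g u x < d \<longleftrightarrow> x < d"
  using permutes_in_image[OF carrier_permutes, of g d u x] by simp

lemma one_in_carrier: "idp \<in> carrier (tree_aut d)"
  by (simp add: carrier_iff permutes_id idp_def)

lemma sect_in_carrier: "g \<in> carrier (tree_aut d) \<Longrightarrow> v \<in> words d \<Longrightarrow> sect v g \<in> carrier (tree_aut d)"
  by (simp add: carrier_iff sect_def)

lemma act_in_words: "g \<in> carrier (tree_aut d) \<Longrightarrow> act g w \<in> words d \<longleftrightarrow> w \<in> words d"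
proof (induction w arbitrary: g)
  case (Cons x w)
  then show ?case by (cases "x < d") (auto simp: carrier_less sect_in_carrier)
qed simp

lemma mult_in_carrier:
  assumes "f \<in> carrier (tree_aut d)" "g \<in> carrier (tree_aut d)"
  shows "f \<otimes>\<^bsub>tree_aut d\<^esub> g \<in> carrier (tree_aut d)"
  using assms carrier_permutes[OF assms(1)] carrier_permutes[OF assms(2)]
  by (subst carrier_iff) (auto simp: mult_tree_aut permutes_compose act_in_words carrier_outside)

primrec preimage :: "portrait \<Rightarrow> nat list \<Rightarrow> nat list" where
  "preimage g [] = []"
| "preimage g (y # u) = inv_into UNIV (g []) y # preimage (sect [inv_into UNIV (g []) y] g) u"

lemma act_preimage: "(\<And>u. g u permutes {..<d}) \<Longrightarrow> act g (preimage g w) = w"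
proof (induction w arbitrary: g)
  case (Cons y w)
  then show ?case by (auto simp: sect_def permutes_inverses(1)[OF Cons.prems])
qed simp

lemma preimage_act: "(\<And>u. g u permutes {..<d}) \<Longrightarrow> preimage g (act g w) = w"
proof (induction w arbitrary: g)
  case (Cons x w)
  then show ?case by (auto simp: sect_def permutes_inverses(2)[OF Cons.prems])
qed simp

lemma group_tree_aut: "group (tree_aut d)"
proof (rule groupI)
  fix g assume g: "g \<in> carrier (tree_aut d)"
  note p = carrier_permutes[OF g]
  define h where "h = (\<lambda>u. inv_into UNIV (g (preimage g u)))"
  have "preimage g u \<in> words d \<longleftrightarrow> u \<in> words d" for u
    using act_in_words[OF g, of "preimage g u"] act_preimage[of g d u] p by simp
  then have "h \<in> carrier (tree_aut d)"
    using p by (auto simp: h_def carrier_iff permutes_inv carrier_outside[OF g] inv_id)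
  moreover have "h \<otimes>\<^bsub>tree_aut d\<^esub> g = \<one>\<^bsub>tree_aut d\<^esub>"
    using p by (intro ext) (simp add: mult_tree_aut one_tree_aut h_def preimage_act[of g d] permutes_inverses(2)[OF p] idp_apply)
  ultimately show "\<exists>h\<in>carrier (tree_aut d). h \<otimes>\<^bsub>tree_aut d\<^esub> g = \<one>\<^bsub>tree_aut d\<^esub>" by blast
next
  fix g assume "g \<in> carrier (tree_aut d)"
  show "\<one>\<^bsub>tree_aut d\<^esub> \<otimes>\<^bsub>tree_aut d\<^esub> g = g"
    by (intro ext) (simp add: mult_tree_aut one_tree_aut idp_apply)
next
  fix f g h :: portrait
  show "f \<otimes>\<^bsub>tree_aut d\<^esub> g \<otimes>\<^bsub>tree_aut d\<^esub> h = f \<otimes>\<^bsub>tree_aut d\<^esub> (g \<otimes>\<^bsub>tree_aut d\<^esub> h)"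
    by (rule ext) (simp add: mult_tree_aut act_mult[unfolded mult_tree_aut] comp_assoc)
qed (auto simp: mult_in_carrier one_tree_aut one_in_carrier)

definition glue :: "nat \<Rightarrow> (nat \<Rightarrow> nat) \<Rightarrow> (nat \<Rightarrow> portrait) \<Rightarrow> portrait" where
  "glue d p h u = (case u of [] \<Rightarrow> p | x # v \<Rightarrow> if x < d then h x v else id)"

lemma glue_Nil [simp]: "glue d p h [] = p"
  by (simp add: glue_def)

lemma glue_Cons [simp]: "glue d p h (x # v) = (if x < d then h x v else id)"
  by (simp add: glue_def)

lemma sect_glue [simp]: "x < d \<Longrightarrow> sect [x] (glue d p h) = h x"
  by (simp add: sect_def)

lemma glue_in_carrier:
  "p permutes {..<d} \<Longrightarrow> (\<And>x. x < d \<Longrightarrow> h x \<in> carrier (tree_aut d)) \<Longrightarrow> glue d p h \<in> carrier (tree_aut d)"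
  unfolding carrier_iff by (auto simp: glue_def split: list.split)

lemma portrait_eqI:
  assumes "g \<in> carrier (tree_aut d)" "h \<in> carrier (tree_aut d)" "g [] = h []"
    "\<And>x. x < d \<Longrightarrow> sect [x] g = sect [x] h"
  shows "g = h"
proof
  fix u
  show "g u = h u"
  proof (cases u)
    case (Cons x v)
    then show ?thesis
      using assms(1,2) fun_cong[OF assms(4), of x v]
      by (cases "x < d") (auto simp: sect_def carrier_iff)
  qed (simp add: assms)
qed

lemma glue_sections:
  "g \<in> carrier (tree_aut d) \<Longrightarrow> (\<And>x. x < d \<Longrightarrow> h x = sect [x] g) \<Longrightarrow> glue d (g []) h = g"
  by (rule portrait_eqI) (auto intro!: glue_in_carrier carrier_permutes sect_in_carrier)

lemma act_id_below: "(\<And>u. u \<in> words d \<Longrightarrow> length u < length w \<Longrightarrow> g u = id) \<Longrightarrow> w \<in> words d \<Longrightarrow> act g w = w"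
  by (induction w arbitrary: g) (auto simp: sect_def)

text \<open>A label above level \<open>n\<close> moves a vertex of level \<open>n\<close> below it unless it is trivial.\<close>

lemma St_iff: "g \<in> St d n \<longleftrightarrow> g \<in> carrier (tree_aut d) \<and> (\<forall>u\<in>words d. length u < n \<longrightarrow> g u = id)"
proof safe
  assume g: "g \<in> St d n"
  show gc: "g \<in> carrier (tree_aut d)" using g by (simp add: St_def)
  fix u assume u: "u \<in> words d" "length u < n"
  show "g u = id"
  proof
    fix x
    show "g u x = id x"
    proof (cases "x < d")
      case True
      define w where "w = u @ [x] @ replicate (n - Suc (length u)) x"
      have "w \<in> level d n"
        using u True by (auto simp: w_def level_iff) (auto simp: words_def)
      then have "act g w = w" using g by (simp add: St_def)
      then show ?thesis by (simp add: w_def act_append sect_def)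
    next
      case False
      then show ?thesis using permutes_not_in[OF carrier_permutes[OF gc]] by simp
    qed
  qed
next
  assume "g \<in> carrier (tree_aut d)" "\<forall>u\<in>words d. length u < n \<longrightarrow> g u = id"
  then show "g \<in> St d n" by (auto simp: St_def level_iff intro!: act_id_below)
qed

lemma St_carrier: "g \<in> St d n \<Longrightarrow> g \<in> carrier (tree_aut d)"
  by (simp add: St_iff)

lemma St_act: "g \<in> St d n \<Longrightarrow> w \<in> words d \<Longrightarrow> length w \<le> n \<Longrightarrow> act g w = w"
  by (rule act_id_below) (auto simp: St_iff)

lemma St_0: "St d 0 = carrier (tree_aut d)"
  by (auto simp: St_iff)

lemma St_Suc: "g \<in> St d (Suc n) \<longleftrightarrow>
    g \<in> carrier (tree_aut d) \<and> g [] = id \<and> (\<forall>x<d. sect [x] g \<in> St d n)"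
proof safe
  assume g: "g \<in> St d (Suc n)"
  then show "g \<in> carrier (tree_aut d)" "g [] = id" by (auto simp: St_iff)
  fix x assume "x < d"
  then show "sect [x] g \<in> St d n" using g by (auto simp: St_iff sect_in_carrier) (simp add: sect_def)
next
  assume g: "g \<in> carrier (tree_aut d)" "g [] = id" "\<forall>x<d. sect [x] g \<in> St d n"
  have "g u = id" if "u \<in> words d" "length u < Suc n" for u
    using that g by (cases u) (auto simp: St_iff sect_def)
  then show "g \<in> St d (Suc n)" using g by (simp add: St_iff)
qed

lemma subgroup_St: "subgroup (St d n) (tree_aut d)"
proof -
  interpret T: group "tree_aut d" by (rule group_tree_aut)
  show ?thesis
  proof (rule T.subgroupI)
    show "St d n \<noteq> {}" using one_in_carrier[of d] by (force simp: St_iff idp_def)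
  next
    fix g assume g: "g \<in> St d n"
    then have gc: "g \<in> carrier (tree_aut d)" by (rule St_carrier)
    have "act (inv\<^bsub>tree_aut d\<^esub> g) w = w" if "w \<in> level d n" for w
    proof -
      have "act g w = w" using g that by (simp add: St_def)
      then have "act (inv\<^bsub>tree_aut d\<^esub> g) w = act (inv\<^bsub>tree_aut d\<^esub> g \<otimes>\<^bsub>tree_aut d\<^esub> g) w"
        by (simp add: act_mult)
      then show ?thesis using gc by (simp add: one_tree_aut)
    qed
    then show "inv\<^bsub>tree_aut d\<^esub> g \<in> St d n" using gc by (simp add: St_def)
  qed (auto simp: St_def act_mult)
qed

lemma inv_root:
  assumes "g \<in> carrier (tree_aut d)"
  shows "(inv\<^bsub>tree_aut d\<^esub> g) [] \<circ> g [] = id"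
proof -
  have "inv\<^bsub>tree_aut d\<^esub> g \<otimes>\<^bsub>tree_aut d\<^esub> g = idp"
    using group.l_inv[OF group_tree_aut assms] by (simp only: one_tree_aut)
  then have "(inv\<^bsub>tree_aut d\<^esub> g \<otimes>\<^bsub>tree_aut d\<^esub> g) [] = id" by (simp add: idp_def)
  then show ?thesis by (simp only: root_mult)
qed

lemma sect_inv:
  assumes "g \<in> carrier (tree_aut d)" "v \<in> words d"
  shows "sect (act g v) (inv\<^bsub>tree_aut d\<^esub> g) = inv\<^bsub>tree_aut d\<^esub> (sect v g)"
proof -
  interpret T: group "tree_aut d" by (rule group_tree_aut)
  have "sect (act g v) (inv\<^bsub>tree_aut d\<^esub> g) \<otimes>\<^bsub>tree_aut d\<^esub> sect v g = \<one>\<^bsub>tree_aut d\<^esub>"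
    using assms by (simp flip: sect_mult add: one_tree_aut)
  then show ?thesis
    using assms by (intro T.inv_equality[symmetric]) (auto simp: sect_in_carrier act_in_words)
qed

lemma delta_Nil [simp]: "delta [] g = g"
  by (rule ext) (simp add: delta_def)

lemma delta_Cons:
  "x < d \<Longrightarrow> delta (x # v) g = glue d id (\<lambda>y. if y = x then delta v g else idp)"
  by (rule ext) (auto simp: delta_def glue_def idp_def split: list.split)

lemma delta_single: "x < d \<Longrightarrow> delta [x] g = glue d id (\<lambda>y. if y = x then g else idp)"
  using delta_Cons[of x d "[]" g, unfolded delta_Nil] .

lemma delta_in_carrier:
  "v \<in> words d \<Longrightarrow> g \<in> carrier (tree_aut d) \<Longrightarrow> delta v g \<in> carrier (tree_aut d)"
  by (induction v) (auto simp: delta_Cons one_in_carrier permutes_id intro!: glue_in_carrier)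

lemma sect_delta: "sect v (delta v g) = g"
  by (simp add: sect_def[abs_def] delta_def)

lemma sect_delta_other: "length w = length v \<Longrightarrow> w \<noteq> v \<Longrightarrow> sect w (delta v g) = idp"
  by (intro ext) (simp add: sect_apply delta_def idp_apply)

lemma delta_in_St: "v \<in> level d n \<Longrightarrow> g \<in> carrier (tree_aut d) \<Longrightarrow> delta v g \<in> St d n"
  by (auto simp: St_iff level_iff delta_in_carrier) (auto simp: delta_def)

lemma delta_sect:
  assumes "g \<in> carrier (tree_aut d)" "v \<in> words d"
    "\<And>u. u \<in> words d \<Longrightarrow> take (length v) u \<noteq> v \<Longrightarrow> g u = id"
  shows "delta v (sect v g) = g"
proof
  fix u
  show "delta v (sect v g) u = g u"
  proof (cases "take (length v) u = v")
    case True
    then have "v @ drop (length v) u = u" by (metis append_take_drop_id)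
    then show ?thesis using True by (simp add: delta_def sect_apply)
  next
    case False
    then show ?thesis using assms by (cases "u \<in> words d") (auto simp: delta_def carrier_outside)
  qed
qed

declare add_bit_eq_xor [simp del] mult_bit_eq_and [simp del]

lemma bit_add_self [simp]: "(a :: bit) + a = 0"
  by (cases a) auto

lemma bit_add_eq_0_iff: "(a :: bit) + b = 0 \<longleftrightarrow> a = b"
  by (cases a; cases b) auto

lemma root_idp: "idp [] = id"
  by (simp add: idp_def)

sublocale odd_gon \<subseteq> T: group "tree_aut d"
  by (rule group_tree_aut)

context odd_gon
begin

abbreviation tree_mult :: "portrait \<Rightarrow> portrait \<Rightarrow> portrait" (infixl \<open>\<odot>\<close> 70) where
  "f \<odot> g \<equiv> f \<otimes>\<^bsub>tree_aut d\<^esub> g"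

abbreviation tree_inv :: "portrait \<Rightarrow> portrait" where
  "tree_inv g \<equiv> inv\<^bsub>tree_aut d\<^esub> g"

abbreviation D :: "portrait set" where
  "D \<equiv> grpD d"

section \<open>Words in the generators and the parity of their letters\<close>

lemma gen_in_carrier:
  assumes "i < d"
  shows "gen_a d i \<in> carrier (tree_aut d)"
proof -
  have "gen_a d i u permutes {..<d}" for u
    using assms by (induction u) (auto simp: permutes_id intro!: dih_permutes mirror_in_dih)
  moreover have "u \<notin> words d \<Longrightarrow> gen_a d i u = id" for u
    using assms by (induction u) auto
  ultimately show ?thesis by (simp add: carrier_iff)
qed

lemma sect_gen: "sect [x] (gen_a d i) = (if x = i then gen_a d i else idp)"
  by (rule ext) (auto simp: sect_apply idp_def)

lemma gen_involution:
  assumes "i < d"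
  shows "gen_a d i \<odot> gen_a d i = idp"
proof
  fix u
  have "gen_a d i (act (gen_a d i) u) \<circ> gen_a d i u = id"
  proof (induction u)
    case Nil
    then show ?case using assms by (simp add: mirror_mirror)
  next
    case (Cons x u)
    have "mirror d i i = i" using assms by (simp add: mirror_fixes_iff)
    moreover have "mirror d i x = i \<longleftrightarrow> x = i"
      using assms calculation dih_inj[OF mirror_in_dih[OF assms], of x i] by simp
    ultimately show ?case using Cons by (simp add: sect_gen)
  qed
  then show "(gen_a d i \<odot> gen_a d i) u = idp u" by (simp add: mult_tree_aut idp_def)
qed

primrec ev :: "nat list \<Rightarrow> portrait" where
  "ev [] = idp"
| "ev (i # w) = gen_a d i \<odot> ev w"

text \<open>A word for the section at \<open>x\<close> of a word: the letters are read from right to left, and a letter \<open>i\<close> survives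
  if it meets the current image of \<open>x\<close> at \<open>i\<close>, the only point where \<open>gen_a d i\<close> has a nontrivial section.\<close>

primrec sw :: "nat \<Rightarrow> nat list \<Rightarrow> nat list" where
  "sw x [] = []"
| "sw x (i # w) = (if ev w [] x = i then i # sw x w else sw x w)"

primrec cnt :: "nat list \<Rightarrow> nat \<Rightarrow> bit" where
  "cnt [] i = 0"
| "cnt (j # w) i = of_bool (i = j) + cnt w i"

lemma ev_in_carrier: "w \<in> words d \<Longrightarrow> ev w \<in> carrier (tree_aut d)"
  by (induction w) (auto simp: one_in_carrier gen_in_carrier)

lemma ev_append: "v \<in> words d \<Longrightarrow> w \<in> words d \<Longrightarrow> ev (v @ w) = ev v \<odot> ev w"
  by (induction v) (auto simp: ev_in_carrier gen_in_carrier T.m_assoc simp flip: one_tree_aut[of d])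

lemma ev_single: "i < d \<Longrightarrow> ev [i] = gen_a d i"
  by (simp add: gen_in_carrier flip: one_tree_aut[of d])

lemma ev_rev: "w \<in> words d \<Longrightarrow> ev (rev w) \<odot> ev w = idp"
proof (induction w)
  case Nil
  then show ?case by (simp flip: one_tree_aut[of d])
next
  case (Cons i w)
  then have i: "i < d" "w \<in> words d" by auto
  have "ev (rev (i # w)) \<odot> ev (i # w) = (ev (rev w) \<odot> ev [i]) \<odot> (gen_a d i \<odot> ev w)"
    using i by (simp add: ev_append)
  also have "\<dots> = ev (rev w) \<odot> (gen_a d i \<odot> gen_a d i) \<odot> ev w"
    using i by (simp add: ev_single gen_in_carrier ev_in_carrier T.m_assoc del: ev.simps)
  also have "\<dots> = ev (rev w) \<odot> ev w"
    using i by (simp add: gen_involution ev_in_carrier flip: one_tree_aut[of d])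
  finally show ?case using Cons i by simp
qed

lemma inv_ev: "w \<in> words d \<Longrightarrow> tree_inv (ev w) = ev (rev w)"
  by (rule T.inv_equality) (auto simp: ev_rev ev_in_carrier one_tree_aut)

lemma D_eq: "D = ev ` words d"
proof
  have "subgroup (ev ` words d) (tree_aut d)"
  proof (rule T.subgroupI)
    fix g h assume "g \<in> ev ` words d" "h \<in> ev ` words d"
    then obtain v w where "v \<in> words d" "w \<in> words d" "g = ev v" "h = ev w" by blast
    then have "g \<odot> h = ev (v @ w)" "v @ w \<in> words d" by (auto simp: ev_append)
    then show "g \<odot> h \<in> ev ` words d" by blast
  next
    fix g assume "g \<in> ev ` words d"
    then obtain w where "w \<in> words d" "g = ev w" by blast
    then have "tree_inv g = ev (rev w)" "rev w \<in> words d" by (auto simp: inv_ev)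
    then show "tree_inv g \<in> ev ` words d" by blast
  qed (auto simp: ev_in_carrier intro: words_Nil)
  moreover have "gen_a d ` {..<d} \<subseteq> ev ` words d"
  proof
    fix g assume "g \<in> gen_a d ` {..<d}"
    then obtain i where "i < d" "g = ev [i]" by (auto simp: ev_single simp del: ev.simps)
    then show "g \<in> ev ` words d" by (intro image_eqI[of _ _ "[i]"]) auto
  qed
  ultimately show "D \<subseteq> ev ` words d"
    unfolding grpD_def by (intro T.generate_subgroup_incl)
  have "ev w \<in> D" if "w \<in> words d" for w
    using that
  proof (induction w)
    case Nil
    then show ?case using generate.one[of "tree_aut d"] by (simp add: grpD_def one_tree_aut)
  next
    case (Cons i w)
    then have "gen_a d i \<in> D" by (auto simp: grpD_def intro: generate.incl)
    then show ?case using Cons by (auto simp: grpD_def intro: generate.eng)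
  qed
  then show "ev ` words d \<subseteq> D" by blast
qed

lemma ev_in_D: "w \<in> words d \<Longrightarrow> ev w \<in> D"
  by (simp add: D_eq)

lemma D_carrier: "g \<in> D \<Longrightarrow> g \<in> carrier (tree_aut d)"
  by (auto simp: D_eq ev_in_carrier)

lemma gen_in_D: "i < d \<Longrightarrow> gen_a d i \<in> D"
  by (auto simp: grpD_def intro: generate.incl)

lemma subgroup_D: "subgroup D (tree_aut d)"
  unfolding grpD_def by (rule T.generate_is_subgroup) (auto simp: gen_in_carrier)

lemmas D_mult = subgroup.m_closed[OF subgroup_D]
lemmas D_inv = subgroup.m_inv_closed[OF subgroup_D]

lemma one_in_D: "idp \<in> D"
  using subgroup.one_closed[OF subgroup_D] by (simp add: one_tree_aut)

lemma root_ev: "w \<in> words d \<Longrightarrow> ev w [] \<in> dih"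
proof (induction w)
  case Nil
  then show ?case by (simp only: ev.simps root_idp id_in_dih)
next
  case (Cons i w)
  then show ?case by (simp add: root_mult dih_comp mirror_in_dih del: o_apply)
qed

lemma root_in_dih: "g \<in> D \<Longrightarrow> g [] \<in> dih"
  by (auto simp: D_eq root_ev)

lemma sw_in_words: "w \<in> words d \<Longrightarrow> sw x w \<in> words d"
  by (induction w) auto

lemma sect_ev: "w \<in> words d \<Longrightarrow> sect [x] (ev w) = ev (sw x w)"
proof (induction w)
  case (Cons i w)
  have "idp \<odot> ev (sw x w) = ev (sw x w)"
    using Cons.prems by (simp add: ev_in_carrier sw_in_words flip: one_tree_aut[of d])
  then show ?case using Cons by (simp add: sect_mult sect_gen)
qed simp

lemma D_sect1: "g \<in> D \<Longrightarrow> sect [x] g \<in> D"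
  by (auto simp: D_eq sect_ev sw_in_words)

lemma D_sect: "g \<in> D \<Longrightarrow> sect v g \<in> D"
proof (induction v arbitrary: g)
  case (Cons x v)
  then show ?case using D_sect1[of g x] by (metis append_Cons append_Nil sect_sect)
qed simp

lemma sum_single_preimage:
  assumes "p \<in> dih" "i < d"
  obtains x0 where "x0 < d" "p x0 = i"
    "\<And>f :: nat \<Rightarrow> 'b :: comm_monoid_add. (\<Sum>x<d. if p x = i then f x else 0) = f x0"
proof -
  obtain x0 where x0: "x0 < d" "p x0 = i"
    using permutes_image[OF dih_permutes[OF assms(1)]] assms(2) by (metis imageE lessThan_iff)
  have "(\<Sum>x<d. if p x = i then f x else 0) = f x0" for f :: "nat \<Rightarrow> 'b :: comm_monoid_add"
  proof -
    have "p x = i \<longleftrightarrow> x0 = x" for x using x0(2) dih_inj[OF assms(1)] by metis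
    then show ?thesis using x0(1) by simp
  qed
  then show ?thesis using that x0 by blast
qed

lemma sum_cnt_sw: "w \<in> words d \<Longrightarrow> (\<Sum>x<d. cnt (sw x w) j) = cnt w j"
proof (induction w)
  case (Cons i w)
  then have i: "i < d" and w: "w \<in> words d" by auto
  obtain x0 where "\<And>f :: nat \<Rightarrow> bit. (\<Sum>x<d. if ev w [] x = i then f x else 0) = f x0"
    using sum_single_preimage[OF root_ev[OF w] i] by metis
  from this[of "\<lambda>_. of_bool (j = i)"]
  have "(\<Sum>x<d. if ev w [] x = i then of_bool (j = i) else 0 :: bit) = of_bool (j = i)" .
  moreover have "cnt (sw x (i # w)) j = (if ev w [] x = i then of_bool (j = i) else 0) + cnt (sw x w) j" for x
    by simp
  ultimately show ?case using Cons.IH[OF w] by (simp add: sum.distrib del: sw.simps)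
qed simp

lemma length_sw_le: "length (sw x w) \<le> length w"
  by (induction w) auto

lemma sw_full_length:
  assumes "w \<in> words d" "x < d" "length (sw x w) = length w"
  shows "w = replicate (length w) x \<and> ev w [] x = x"
  using assms
proof (induction w)
  case Nil
  then show ?case by (simp add: idp_def)
next
  case (Cons i w)
  have i: "i < d" "w \<in> words d" using Cons.prems by auto
  have "ev w [] x = i" "length (sw x w) = length w"
    using Cons.prems(3) length_sw_le[of x w] by (auto split: if_splits)
  then have "w = replicate (length w) x" "i = x" using Cons.IH Cons.prems i by auto
  moreover have "ev (i # w) [] x = x"
    using calculation \<open>ev w [] x = i\<close> i mirror_fixes_iff[of x x] by (simp add: root_mult)
  ultimately show ?case by simp
qed

lemma ev_replicate: "x < d \<Longrightarrow> ev (replicate n x) = (if even n then idp else gen_a d x)"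
proof (induction n)
  case (Suc n)
  then show ?case using gen_involution[of x] gen_in_carrier[of x]
    by (simp flip: one_tree_aut[of d])
qed simp

lemma cnt_replicate: "cnt (replicate n x) i = of_bool (i = x \<and> odd n)"
  by (induction n) auto

lemma mirror_ne_id: "i < d \<Longrightarrow> mirror d i \<noteq> id"
  using mir_mirror mir_id by (metis zero_neq_one)

text \<open>Induction on the length: the first-level sections represent the identity again, and they are shorter than
  the word unless it is a power of one generator. The letters of the word are distributed over the sections.\<close>

lemma cnt_trivial_word:
  assumes "w \<in> words d" "ev w = idp"
  shows "cnt w i = 0"
  using assms
proof (induction "length w" arbitrary: w rule: less_induct)
  case less
  show ?case
  proof (cases "\<exists>x<d. length (sw x w) = length w")
    case True
    then obtain x where x: "x < d" "w = replicate (length w) x"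
      using sw_full_length less.prems by blast
    have "even (length w)"
    proof (rule ccontr)
      assume "odd (length w)"
      then have "gen_a d x = idp" using ev_replicate[OF x(1), of "length w"] x(2) less.prems(2) by simp
      then have "gen_a d x [] = id" by (simp add: idp_def)
      then show False using mirror_ne_id[OF x(1)] by simp
    qed
    then show ?thesis using cnt_replicate[of "length w" x i] x(2) by simp
  next
    case False
    have "cnt (sw x w) i = 0" if "x < d" for x
    proof (rule less.hyps)
      show "length (sw x w) < length w" using False that length_sw_le[of x w] by force
      show "sw x w \<in> words d" using less.prems sw_in_words by blast
      show "ev (sw x w) = idp" using less.prems sect_ev[of w x] by simp
    qed
    then show ?thesis using sum_cnt_sw[OF less.prems(1), of i] by simp
  qed
qed

lemma cnt_append: "cnt (v @ w) i = cnt v i + cnt w i"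
  by (induction v) (auto simp: add.assoc)

lemma cnt_rev: "cnt (rev w) i = cnt w i"
  by (induction w) (auto simp: cnt_append add.commute)

lemma cnt_cong:
  assumes "v \<in> words d" "w \<in> words d" "ev v = ev w"
  shows "cnt v = cnt w"
proof
  fix i
  have "ev (rev v @ w) = idp" using assms ev_rev[of w] by (simp add: ev_append inv_ev[symmetric])
  then have "cnt (rev v @ w) i = 0" using cnt_trivial_word assms by simp
  then show "cnt v i = cnt w i" by (simp add: cnt_append cnt_rev bit_add_eq_0_iff)
qed

text \<open>The choice of the word is immaterial by \<open>cnt_cong\<close>.\<close>

definition par :: "portrait \<Rightarrow> nat \<Rightarrow> bit" where
  "par g = cnt (SOME w. w \<in> words d \<and> ev w = g)"

lemma par_ev: "w \<in> words d \<Longrightarrow> par (ev w) = cnt w"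
  unfolding par_def by (rule cnt_cong) (metis (mono_tags, lifting) someI)+

lemma par_mult: "g \<in> D \<Longrightarrow> h \<in> D \<Longrightarrow> par (g \<odot> h) = (\<lambda>i. par g i + par h i)"
  by (auto simp: D_eq par_ev cnt_append simp flip: ev_append)

lemma par_one: "par idp = (\<lambda>i. 0)"
  using par_ev[of "[]"] by (auto simp: fun_eq_iff)

lemma par_gen: "i < d \<Longrightarrow> par (gen_a d i) = (\<lambda>j. of_bool (j = i))"
  using par_ev[of "[i]"] by (simp add: ev_single fun_eq_iff del: ev.simps)

lemma par_inv: "g \<in> D \<Longrightarrow> par (tree_inv g) = par g"
  by (auto simp: D_eq inv_ev par_ev cnt_rev)

lemma cnt_outside: "w \<in> words d \<Longrightarrow> i \<ge> d \<Longrightarrow> cnt w i = 0"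
  by (induction w) auto

lemma par_outside: "g \<in> D \<Longrightarrow> i \<ge> d \<Longrightarrow> par g i = 0"
  by (auto simp: D_eq par_ev cnt_outside)

lemma par_sum_sections: "g \<in> D \<Longrightarrow> par g j = (\<Sum>x<d. par (sect [x] g) j)"
  by (auto simp: D_eq par_ev sect_ev sw_in_words sum_cnt_sw)

lemma mir_root: "g \<in> D \<Longrightarrow> mir (g []) = (\<Sum>i<d. par g i)"
proof -
  have "w \<in> words d \<Longrightarrow> mir (ev w []) = (\<Sum>i<d. cnt w i)" for w
  proof (induction w)
    case Nil
    show ?case unfolding ev.simps root_idp by (simp del: id_apply)
  next
    case (Cons i w)
    then show ?case
      by (simp add: root_mult mir_comp mirror_in_dih root_ev mir_mirror sum.distrib del: o_apply)
  qed
  then show "g \<in> D \<Longrightarrow> ?thesis" by (auto simp: D_eq par_ev)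
qed

text \<open>A word is a walk in the Cayley graph of the dihedral group for the mirrors, which is the complete
  bipartite graph on rotations and mirrors. The edge that leaves \<open>p\<close> with label \<open>i\<close> contributes the
  letter \<open>i\<close> to the section at \<open>x = p\<inverse>(i)\<close>, and every pair \<open>(x, i)\<close> arises from exactly one edge. So
  the parities of the letters of the sections record which edges are traversed an odd number of
  times, and the only constraint is that the boundary of this chain is formed by the endpoints.\<close>

lemma boundary_word:
  assumes "w \<in> words d" "p \<in> dih"
  shows "(\<Sum>x<d. cnt (sw x w) (p x)) = of_bool (p = id) + of_bool (p = ev w [])"
  using assms(1)
proof (induction w)
  case Nil
  then show ?case by (simp add: idp_def)
next
  case (Cons i w)
  then have i: "i < d" and w: "w \<in> words d" by auto
  let ?q = "ev w []"
  obtain x0 where x0: "x0 < d" "?q x0 = i"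
    "\<And>f :: nat \<Rightarrow> bit. (\<Sum>x<d. if ?q x = i then f x else 0) = f x0"
    using sum_single_preimage[OF root_ev[OF w] i] by metis
  have ne: "mirror d i \<circ> ?q \<noteq> ?q"
  proof
    assume "mirror d i \<circ> ?q = ?q"
    then have "mir (mirror d i) + mir ?q = mir ?q"
      using mir_comp[OF mirror_in_dih[OF i] root_ev[OF w]] by simp
    then show False using mir_mirror[OF i] by (cases "mir ?q") auto
  qed
  have "cnt (sw x (i # w)) (p x) = (if ?q x = i then of_bool (p x = i) else 0) + cnt (sw x w) (p x)"
    for x by simp
  then have "(\<Sum>x<d. cnt (sw x (i # w)) (p x)) = of_bool (p x0 = i) + (\<Sum>x<d. cnt (sw x w) (p x))"
    by (simp add: sum.distrib x0(3) del: sw.simps)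
  \<comment> \<open>the new edge joins \<open>?q\<close> and \<open>mirror d i \<circ> ?q\<close>\<close>
  also have "of_bool (p x0 = i) = of_bool (p = ?q) + (of_bool (p = mirror d i \<circ> ?q) :: bit)"
    using dih_agree_iff[OF assms(2) root_ev[OF w] x0(1)] x0(2) ne by auto
  finally show ?case using Cons.IH[OF w] by (simp add: root_mult add_ac del: sw.simps o_apply id_apply)
qed

lemma boundary: "g \<in> D \<Longrightarrow> p \<in> dih \<Longrightarrow>
    (\<Sum>x<d. par (sect [x] g) (p x)) = of_bool (p = id) + of_bool (p = g [])"
  unfolding D_eq using boundary_word by (force simp: sect_ev par_ev sw_in_words)

section \<open>The commutator subgroup\<close>

text \<open>The kernel of the parities; it turns out to be the commutator subgroup (\<open>derived_eq\<close>).\<close>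

definition D' :: "portrait set" where
  "D' = {g \<in> D. \<forall>i. par g i = 0}"

lemma subgroup_D': "subgroup D' (tree_aut d)"
  by (rule T.subgroupI)
    (auto simp: D'_def D_carrier D_mult D_inv par_mult par_inv par_one intro!: exI[of _ idp] one_in_D)

text \<open>Modulo a subgroup that contains these commutators, equal letters of a word can be brought
  together and cancelled.\<close>

lemma D'_subset_subgroup:
  assumes sub: "subgroup K (tree_aut d)"
    and comm: "\<And>i u. i < d \<Longrightarrow> u \<in> words d \<Longrightarrow>
      gen_a d i \<odot> ev u \<odot> gen_a d i \<odot> tree_inv (ev u) \<in> K"
  shows "D' \<subseteq> K"
proof -
  have "ev w \<in> K" if "w \<in> words d" "\<And>i. cnt w i = 0" for w
    using that
  proof (induction "length w" arbitrary: w rule: less_induct)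
    case less
    show ?case
    proof (cases w)
      case Nil
      then show ?thesis using subgroup.one_closed[OF sub] by (simp add: one_tree_aut)
    next
      case (Cons i w')
      have "cnt w' i = 1" using less.prems(2)[of i] Cons by (simp add: bit_add_eq_0_iff)
      moreover have "i \<notin> set w' \<Longrightarrow> cnt w' i = 0" by (induction w') auto
      ultimately have "i \<in> set w'" by auto
      then obtain u v where uv: "w' = u @ i # v" by (meson split_list)
      have i: "i < d" "u \<in> words d" "v \<in> words d" using less.prems(1) Cons uv by auto
      let ?a = "gen_a d i" and ?u = "ev u" and ?v = "ev v"
      have c: "?a \<in> carrier (tree_aut d)" "?u \<in> carrier (tree_aut d)" "?v \<in> carrier (tree_aut d)"
        using i by (auto simp: gen_in_carrier ev_in_carrier)
      have "ev (u @ v) \<in> K"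
      proof (rule less.hyps)
        show "cnt (u @ v) j = 0" for j
          using less.prems(2)[of j] Cons uv by (cases "j = i") (auto simp: cnt_append algebra_simps)
      qed (use Cons uv i in auto)
      moreover have "ev w = (?a \<odot> ?u \<odot> ?a \<odot> tree_inv ?u) \<odot> ev (u @ v)"
      proof -
        have "tree_inv ?u \<odot> (?u \<odot> ?v) = ?v"
          using c by (simp flip: T.m_assoc)
        then show ?thesis using c i Cons uv by (simp add: ev_append T.m_assoc)
      qed
      ultimately show ?thesis using subgroup.m_closed[OF sub] comm i by simp
    qed
  qed
  then show ?thesis by (auto simp: D'_def D_eq par_ev)
qed

lemma inv_gen: "i < d \<Longrightarrow> tree_inv (gen_a d i) = gen_a d i"
  by (rule T.inv_equality) (auto simp: gen_involution gen_in_carrier one_tree_aut)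

lemma derived_eq: "grpD' d = D'"
proof
  have "derived_set (tree_aut d) D \<subseteq> D'"
    by (auto simp: D'_def D_mult D_inv par_mult par_inv add_ac)
  then show "grpD' d \<subseteq> D'"
    unfolding grpD'_def derived_def by (rule T.generate_subgroup_incl[OF _ subgroup_D'])
  show "D' \<subseteq> grpD' d"
  proof (rule D'_subset_subgroup)
    show "subgroup (grpD' d) (tree_aut d)"
      unfolding grpD'_def by (rule T.derived_is_subgroup) (auto simp: D_carrier)
    fix i u assume i: "i < d" and u: "u \<in> words d"
    have "gen_a d i \<odot> ev u \<odot> tree_inv (gen_a d i) \<odot> tree_inv (ev u) \<in> grpD' d"
      unfolding grpD'_def derived_def
      using i u gen_in_D ev_in_D by (intro generate.incl) blast
    then show "gen_a d i \<odot> ev u \<odot> gen_a d i \<odot> tree_inv (ev u) \<in> grpD' d"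
      using i by (simp add: inv_gen)
  qed
qed

lemma D'_iff: "g \<in> D' \<longleftrightarrow> g \<in> D \<and> par g = (\<lambda>i. 0)"
  by (auto simp: D'_def)


section \<open>Branching over the commutator subgroup\<close>

lemma midpoint:
  assumes "x < d" "y < d"
  obtains l where "l < d" "mirror d l x = y" "mirror d l y = x" "l = x \<longleftrightarrow> x = y" "l = y \<longleftrightarrow> x = y"
proof -
  obtain p where p: "p \<in> dih" "mir p = 1" "p x = y"
    using dih_transitive[OF assms, of 1] by blast
  then have "p \<in> mirrors d" by (auto simp: mir_def)
  then obtain l where l: "l < d" "p = mirror d l" by (auto simp: mirrors_def)
  have yx: "mirror d l y = x" using l p by auto
  show ?thesis
    using that[of l] l p yx mirror_fixes_iff[of l x] mirror_fixes_iff[of l y] assms by auto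
qed

lemma mirror_conj:
  assumes "i < d" "j < d"
  shows "mirror d (mirror d i j) = mirror d i \<circ> mirror d j \<circ> mirror d i"
proof -
  let ?a = "mirror d i j"
  have a: "?a < d" using assms mirror_less by blast
  have c: "mirror d i \<circ> mirror d j \<circ> mirror d i \<in> dih"
    using assms by (simp add: dih_comp mirror_in_dih del: o_apply)
  have "mir (mirror d i \<circ> mirror d j \<circ> mirror d i) = 1"
    using assms by (simp add: mir_comp dih_comp mirror_in_dih mir_mirror del: o_apply)
  moreover have "mirror d ?a ?a = (mirror d i \<circ> mirror d j \<circ> mirror d i) ?a"
    using assms mirror_fixes_iff[OF a a] mirror_fixes_iff[OF assms(2,2)] by simp
  ultimately show ?thesis
    using dih_eq_iff_apply[of "mirror d ?a" _ ?a] c a by (simp add: mirror_in_dih mir_mirror del: o_apply)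
qed

text \<open>The four-cycle in the Cayley graph through the edges labelled \<open>i\<close>, \<open>j\<close>, \<open>i\<close>, \<open>mirror d i j\<close>. Its word has only
  three nontrivial sections, and two of them are involutions.\<close>

definition cyc :: "nat \<Rightarrow> nat \<Rightarrow> nat list" where
  "cyc i j = [mirror d i j, i, j, i]"

lemma cyc_in_words: "i < d \<Longrightarrow> j < d \<Longrightarrow> cyc i j \<in> words d"
  by (simp add: cyc_def mirror_less)

lemma root_gen_word: "ev (i # w) [] x = mirror d i (ev w [] x)"
  by (simp add: root_mult)

lemma root_Nil: "ev [] [] x = x"
  by (simp add: idp_def)

lemma root_cyc:
  assumes "i < d" "j < d"
  shows "ev (cyc i j) [] = id"
proof
  fix x
  show "ev (cyc i j) [] x = id x"
    unfolding cyc_def root_gen_word root_Nil mirror_conj[OF assms] using assms by simp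
qed

lemma cyc_distinct:
  assumes "i < d" "j < d" "i \<noteq> j"
  shows "mirror d i j \<noteq> i" "mirror d i (mirror d j i) \<noteq> i" "mirror d i (mirror d j i) \<noteq> mirror d i j"
proof -
  have ii: "mirror d i i = i" and jj: "mirror d j j = j" using assms mirror_fixes_iff by auto
  have inj: "mirror d i x = mirror d i y \<longleftrightarrow> x = y" "mirror d j x = mirror d j y \<longleftrightarrow> x = y" for x y
    using assms dih_inj mirror_in_dih by auto
  show "mirror d i j \<noteq> i" using inj(1)[of j i] ii assms by simp
  have ji: "mirror d j i \<noteq> i" using mirror_fixes_iff[of j i] assms by simp
  then show "mirror d i (mirror d j i) \<noteq> i" using inj(1)[of "mirror d j i" i] ii by simp
  show "mirror d i (mirror d j i) \<noteq> mirror d i j" using inj jj assms by metis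
qed

lemma sw_cyc:
  assumes "i < d" "j < d" "i \<noteq> j"
  shows "sw x (cyc i j) = (if x = i \<or> x = mirror d i (mirror d j i) then [i]
     else if x = mirror d i j then [mirror d i j, j] else [])"
proof -
  have inj: "mirror d i x = mirror d i y \<longleftrightarrow> x = y" "mirror d j x = mirror d j y \<longleftrightarrow> x = y" for x y
    using assms dih_inj mirror_in_dih by auto
  have m1: "mirror d i x = j \<longleftrightarrow> x = mirror d i j" using assms mirror_mirror_apply by metis
  have m2: "mirror d j (mirror d i x) = i \<longleftrightarrow> x = mirror d i (mirror d j i)"
    using assms mirror_mirror_apply by metis
  have m3: "mirror d i (mirror d j (mirror d i x)) = mirror d i j \<longleftrightarrow> x = mirror d i j"
    using inj m1 assms mirror_fixes_iff[of j j] by metis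
  show ?thesis
    unfolding cyc_def sw.simps root_gen_word root_Nil m1 m2 m3 using cyc_distinct[OF assms] by auto
qed

lemma sw_append: "v \<in> words d \<Longrightarrow> sw x (v @ w) = sw (ev w [] x) v @ sw x w"
  if "w \<in> words d"
proof (induction v)
  case (Cons i v)
  then show ?case using that by (simp add: ev_append root_mult)
qed simp

lemma conj_in_D': "g \<in> D \<Longrightarrow> h \<in> D' \<Longrightarrow> g \<odot> h \<odot> tree_inv g \<in> D'"
  by (auto simp: D'_def D_mult D_inv par_mult par_inv)

lemma delta_conj:
  assumes "g \<in> carrier (tree_aut d)" "h \<in> carrier (tree_aut d)" "x < d"
  shows "g \<odot> delta [x] h \<odot> tree_inv g = delta [g [] x] (sect [x] g \<odot> h \<odot> tree_inv (sect [x] g))"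
proof -
  let ?k = "sect [x] g \<odot> h \<odot> tree_inv (sect [x] g)"
  have gx: "g [] x < d" using assms carrier_less by blast
  have gy: "g [] y = g [] x \<longleftrightarrow> y = x" for y
    using permutes_inj[OF carrier_permutes[OF assms(1), of "[]"]] by (metis injD)
  have sx: "sect [y] g \<in> carrier (tree_aut d)" if "y < d" for y using assms that by (simp add: sect_in_carrier)
  have k: "?k \<in> carrier (tree_aut d)" using assms sx by simp
  have dx: "delta [x] h = glue d id (\<lambda>y. if y = x then h else idp)"
    and dgx: "delta [g [] x] ?k = glue d id (\<lambda>y. if y = g [] x then ?k else idp)"
    using delta_single[OF assms(3)] delta_single[OF gx] by blast+
  have "g \<odot> delta [x] h = delta [g [] x] ?k \<odot> g"
  proof (rule portrait_eqI)
    show "(g \<odot> delta [x] h) [] = (delta [g [] x] ?k \<odot> g) []"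
      by (simp add: root_mult dx dgx)
    fix y assume y: "y < d"
    show "sect [y] (g \<odot> delta [x] h) = sect [y] (delta [g [] x] ?k \<odot> g)"
    proof (cases "y = x")
      case True
      have "?k \<odot> sect [x] g = sect [x] g \<odot> h" using assms sx by (simp add: T.m_assoc)
      then show ?thesis using True assms gx by (simp add: sect_mult dx dgx)
    next
      case False
      then have "g [] y \<noteq> g [] x" "g [] y < d" using gy y assms carrier_less by auto
      then show ?thesis using False y sx[OF y]
        by (simp add: sect_mult dx dgx flip: one_tree_aut[of d])
    qed
  qed (use assms gx k in \<open>auto intro!: delta_in_carrier T.m_closed simp del: delta_Nil\<close>)
  then show ?thesis
    using assms k gx by (simp add: T.m_assoc delta_in_carrier)
qed

text \<open>In the square of a four-cycle the two sections that are involutions disappear, and the third one becomes the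
  square of \<open>gen_a d m \<odot> gen_a d j\<close>, which is a commutator of generators.\<close>

lemma commutator_delta_same:
  assumes "m < d" "j < d" "m \<noteq> j"
  shows "delta [m] (gen_a d m \<odot> gen_a d j \<odot> gen_a d m \<odot> gen_a d j) \<in> D'"
proof -
  obtain i where i: "i < d" "mirror d i j = m" "i \<noteq> j"
    using midpoint[OF assms(2,1)] assms(3) by metis
  define c where "c = cyc i j @ cyc i j"
  have cw: "c \<in> words d" using assms i by (simp add: c_def cyc_in_words)
  have "cnt c k = 0" for k by (simp add: c_def cnt_append)
  then have c: "ev c \<in> D'" using cw by (simp add: D'_def ev_in_D par_ev)
  have sw: "sw x c = sw x (cyc i j) @ sw x (cyc i j)" for x
    using assms i by (simp add: c_def sw_append cyc_in_words root_cyc)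
  have comm: "ev [m, j, m, j] = gen_a d m \<odot> gen_a d j \<odot> gen_a d m \<odot> gen_a d j"
    using assms by (simp add: T.m_assoc gen_in_carrier flip: one_tree_aut[of d])
  have "ev c = glue d id (\<lambda>y. if y = m then ev [m, j, m, j] else idp)"
  proof (rule portrait_eqI)
    show "ev c \<in> carrier (tree_aut d)" using cw ev_in_carrier by blast
    show "glue d id (\<lambda>y. if y = m then ev [m, j, m, j] else idp) \<in> carrier (tree_aut d)"
      using assms by (intro glue_in_carrier) (auto simp: permutes_id one_in_carrier ev_in_carrier simp del: ev.simps)
    show "ev c [] = glue d id (\<lambda>y. if y = m then ev [m, j, m, j] else idp) []"
      using assms i root_cyc by (simp add: c_def ev_append cyc_in_words root_mult)
    fix x assume x: "x < d"
    have "ev (sw x c) = (if x = m then ev [m, j, m, j] else idp)"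
      using cyc_distinct[OF i(1) assms(2) i(3)] i
      by (auto simp: sw sw_cyc[OF i(1) assms(2) i(3)] gen_involution gen_in_carrier simp flip: one_tree_aut[of d])
    then show "sect [x] (ev c) = sect [x] (glue d id (\<lambda>y. if y = m then ev [m, j, m, j] else idp))"
      using x cw by (simp add: sect_ev del: ev.simps)
  qed
  then show ?thesis using c delta_single[OF assms(1), of "ev [m, j, m, j]"] by (simp add: comm del: ev.simps)
qed

text \<open>A generator with trivial section at \<open>x\<close> carries a copy of \<open>h\<close> at \<open>x\<close> to another letter unchanged.\<close>

lemma delta_D'_move:
  assumes "delta [x] h \<in> D'" "x < d" "y < d" "h \<in> carrier (tree_aut d)"
  shows "delta [y] h \<in> D'"
proof (cases "x = y")
  case False
  obtain l where l: "l < d" "mirror d l x = y" "l \<noteq> x" using midpoint[OF assms(2,3)] False by metis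
  have "gen_a d l \<odot> delta [x] h \<odot> tree_inv (gen_a d l) = delta [y] h"
    using l assms delta_conj[OF gen_in_carrier[OF l(1)] assms(4,2)]
    by (simp add: sect_gen flip: one_tree_aut[of d])
  then show ?thesis using conj_in_D'[OF gen_in_D[OF l(1)] assms(1)] by simp
qed (use assms in simp)

text \<open>Conjugate at the letter \<open>j\<close>, where \<open>gen_a d j\<close> is its own section, and move the result to \<open>x\<close>.\<close>

lemma delta_D'_conj_gen:
  assumes "\<And>y. y < d \<Longrightarrow> delta [y] h \<in> D'" "x < d" "j < d" "h \<in> carrier (tree_aut d)"
  shows "delta [x] (gen_a d j \<odot> h \<odot> gen_a d j) \<in> D'"
proof -
  have "gen_a d j \<odot> delta [j] h \<odot> tree_inv (gen_a d j) = delta [j] (gen_a d j \<odot> h \<odot> gen_a d j)"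
    using delta_conj[OF gen_in_carrier[OF assms(3)] assms(4,3)] assms mirror_fixes_iff[of j j]
    by (simp add: sect_gen inv_gen)
  then have "delta [j] (gen_a d j \<odot> h \<odot> gen_a d j) \<in> D'"
    using conj_in_D'[OF gen_in_D[OF assms(3)] assms(1)[OF assms(3)]] by simp
  then show ?thesis by (rule delta_D'_move) (use assms gen_in_carrier in auto)
qed

lemma delta_mult:
  assumes "x < d" "g \<in> carrier (tree_aut d)" "h \<in> carrier (tree_aut d)"
  shows "delta [x] (g \<odot> h) = delta [x] g \<odot> delta [x] h"
proof (rule portrait_eqI)
  have dl: "delta [x] k = glue d id (\<lambda>y. if y = x then k else idp)" for k
    by (rule delta_single[OF assms(1)])
  show "delta [x] (g \<odot> h) [] = (delta [x] g \<odot> delta [x] h) []"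
    by (simp add: dl root_mult)
  fix y assume "y < d"
  then show "sect [y] (delta [x] (g \<odot> h)) = sect [y] (delta [x] g \<odot> delta [x] h)"
    by (simp add: dl sect_mult one_in_carrier flip: one_tree_aut[of d])
qed (use assms in \<open>auto intro!: delta_in_carrier\<close>)

lemma delta_idp: "x < d \<Longrightarrow> delta [x] idp = idp"
  by (rule ext) (simp add: delta_def idp_def)

lemma delta_inv: "x < d \<Longrightarrow> g \<in> carrier (tree_aut d) \<Longrightarrow> delta [x] (tree_inv g) = tree_inv (delta [x] g)"
  by (rule T.inv_equality[symmetric])
    (auto simp: delta_in_carrier delta_idp one_tree_aut simp flip: delta_mult)

text \<open>The elements all of whose copies at the first level lie in \<open>D'\<close> form a subgroup that contains the commutators
  of generators and is invariant under conjugation by generators. Hence it contains the commutators of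
  generators with arbitrary words, and these suffice by \<open>D'_subset_subgroup\<close>.\<close>

lemma delta_D':
  assumes "h \<in> D'" "x < d"
  shows "delta [x] h \<in> D'"
proof -
  define K where "K = {h \<in> D. \<forall>x<d. delta [x] h \<in> D'}"
  have K: "subgroup K (tree_aut d)"
  proof (rule T.subgroupI)
    show "K \<noteq> {}"
      using one_in_D subgroup.one_closed[OF subgroup_D'] by (auto simp: K_def delta_idp one_tree_aut)
  qed (auto simp: K_def D_carrier D_inv D_mult delta_inv delta_mult
        intro: subgroup.m_inv_closed[OF subgroup_D'] subgroup.m_closed[OF subgroup_D'])
  have conj: "gen_a d j \<odot> k \<odot> gen_a d j \<in> K" if "k \<in> K" "j < d" for k j
    using that delta_D'_conj_gen[of k] by (auto simp: K_def D_mult gen_in_D D_carrier)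
  have base: "gen_a d i \<odot> gen_a d j \<odot> gen_a d i \<odot> gen_a d j \<in> K" if ij: "i < d" "j < d" for i j
  proof (cases "i = j")
    case True
    have "gen_a d i \<odot> gen_a d j \<odot> gen_a d i \<odot> gen_a d j = idp"
      using ij True by (simp add: gen_involution T.m_assoc gen_in_carrier flip: one_tree_aut[of d])
    then show ?thesis using subgroup.one_closed[OF K] by (simp add: one_tree_aut)
  next
    case False
    then show ?thesis
      using ij delta_D'_move[OF commutator_delta_same[of i j], of _]
      by (auto simp: K_def D_mult gen_in_D gen_in_carrier)
  qed
  have "gen_a d i \<odot> ev u \<odot> gen_a d i \<odot> tree_inv (ev u) \<in> K" if "i < d" "u \<in> words d" for i u
    using that(2)
  proof (induction u)
    case Nil
    then show ?case
      using that(1) subgroup.one_closed[OF K] by (simp add: gen_involution gen_in_carrier flip: one_tree_aut[of d])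
  next
    case (Cons j u)
    let ?a = "gen_a d i" and ?b = "gen_a d j" and ?u = "ev u"
    have j: "j < d" "u \<in> words d" using Cons.prems by auto
    have c: "?a \<in> carrier (tree_aut d)" "?b \<in> carrier (tree_aut d)" "?u \<in> carrier (tree_aut d)"
      using that j by (auto simp: gen_in_carrier ev_in_carrier)
    have bb: "?b \<odot> (?b \<odot> g) = g" if "g \<in> carrier (tree_aut d)" for g
      using c that gen_involution[OF j(1)] by (simp flip: T.m_assoc one_tree_aut[of d])
    have "?a \<odot> ev (j # u) \<odot> ?a \<odot> tree_inv (ev (j # u)) =
        (?a \<odot> ?b \<odot> ?a \<odot> ?b) \<odot> (?b \<odot> (?a \<odot> ?u \<odot> ?a \<odot> tree_inv ?u) \<odot> ?b)"
      using c that(1) j gen_involution[OF that(1)]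
      by (simp add: T.inv_mult_group inv_gen T.m_assoc bb)
        (simp flip: T.m_assoc one_tree_aut[of d])
    then show ?case using subgroup.m_closed[OF K base[OF that(1) j(1)] conj[OF Cons.IH[OF j(2)] j(1)]] by simp
  qed
  then have "D' \<subseteq> K" by (rule D'_subset_subgroup[OF K])
  then show ?thesis using assms by (auto simp: K_def)
qed

lemma delta_append: "delta (u @ v) g = delta u (delta v g)"
proof
  fix w
  have "take (length u + length v) w = u @ v \<longleftrightarrow> take (length u) w = u \<and> take (length v) (drop (length u) w) = v"
    by (auto simp: take_add append_eq_append_conv_if min_def split: if_splits)
  then show "delta (u @ v) g w = delta u (delta v g) w"
    by (auto simp: delta_def add.commute)
qed

lemma delta_words_D': "h \<in> D' \<Longrightarrow> v \<in> words d \<Longrightarrow> delta v h \<in> D'"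
proof (induction v)
  case (Cons x v)
  then show ?case using delta_append[of "[x]" v h] delta_D' by simp
qed simp

lemma St_sect_mult:
  assumes "g \<in> St d n" "v \<in> level d n"
  shows "sect v (f \<odot> g) = sect v f \<odot> sect v g"
  using assms St_act[of g d n v] by (simp add: sect_mult level_iff)

lemma St_eqI:
  assumes "g \<in> St d n" "h \<in> St d n" "\<And>v. v \<in> level d n \<Longrightarrow> sect v g = sect v h"
  shows "g = h"
proof
  fix u
  consider "u \<notin> words d" | "u \<in> words d" "length u < n" | "u \<in> words d" "n \<le> length u" by linarith
  then show "g u = h u"
  proof cases
    case 1
    then show ?thesis using assms(1,2) by (auto simp: St_iff carrier_outside)
  next
    case 2
    then show ?thesis using assms(1,2) by (auto simp: St_iff)
  next
    case 3
    have "take n u \<in> words d" using 3 by (metis append_take_drop_id words_append)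
    then have "take n u \<in> level d n" using 3 by (simp add: level_iff)
    then have "sect (take n u) g (drop n u) = sect (take n u) h (drop n u)" using assms(3) by simp
    then show ?thesis by (simp add: sect_apply)
  qed
qed

text \<open>An element of the right-hand side is a product of its sections, placed at the vertices of the level one after
  the other.\<close>

lemma star_eq:
  assumes H: "subgroup H (tree_aut d)"
  shows "star d n H = {g \<in> St d n. \<forall>v\<in>level d n. sect v g \<in> H}" (is "_ = ?R")
proof
  have Hc: "h \<in> H \<Longrightarrow> h \<in> carrier (tree_aut d)" for h using subgroup.mem_carrier[OF H] .
  have St_m: "g \<in> St d n \<Longrightarrow> h \<in> St d n \<Longrightarrow> g \<odot> h \<in> St d n"
    "g \<in> St d n \<Longrightarrow> tree_inv g \<in> St d n" for g h
    using subgroup.m_closed[OF subgroup_St] subgroup.m_inv_closed[OF subgroup_St] by auto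
  have one: "idp \<in> H" using subgroup.one_closed[OF H] by (simp add: one_tree_aut)
  have oneSt: "idp \<in> St d n" using subgroup.one_closed[OF subgroup_St] by (simp add: one_tree_aut)
  have "subgroup ?R (tree_aut d)"
  proof (rule T.subgroupI)
    fix g assume g: "g \<in> ?R"
    have "sect v (tree_inv g) \<in> H" if v: "v \<in> level d n" for v
    proof -
      have "sect v (tree_inv g) = tree_inv (sect v g)"
        using sect_inv[of g d v] St_act[of g d n v] St_carrier[of g d n] g v by (simp add: level_iff)
      then show ?thesis using g v subgroup.m_inv_closed[OF H] by simp
    qed
    then show "tree_inv g \<in> ?R" using g St_m by simp
  next
    show "?R \<noteq> {}" using one oneSt by (auto intro!: exI[of _ idp])
  next
    fix g h assume "g \<in> ?R" "h \<in> ?R"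
    then show "g \<odot> h \<in> ?R" using St_m subgroup.m_closed[OF H] by (simp add: St_sect_mult[of _ n])
  qed (auto simp: St_carrier)
  moreover have "(\<Union>v\<in>level d n. delta v ` H) \<subseteq> ?R"
  proof clarify
    fix v h assume v: "v \<in> level d n" and h: "h \<in> H"
    have "sect w (delta v h) \<in> H" if w: "w \<in> level d n" for w
      using h one v w sect_delta[of v h] sect_delta_other[of w v h] by (cases "w = v") (auto simp: level_iff)
    then show "delta v h \<in> St d n \<and> (\<forall>w\<in>level d n. sect w (delta v h) \<in> H)"
      using delta_in_St[OF v Hc[OF h]] by simp
  qed
  ultimately show "star d n H \<subseteq> ?R"
    unfolding star_def by (intro T.generate_subgroup_incl)
  show "?R \<subseteq> star d n H"
  proof
    fix g assume g: "g \<in> ?R"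
    have "\<exists>r\<in>star d n H. r \<in> St d n \<and> (\<forall>v\<in>level d n. sect v r = (if v \<in> S then sect v g else idp))"
      if "finite S" "S \<subseteq> level d n" for S
      using that
    proof (induction S)
      case empty
      have "idp \<in> star d n H" unfolding star_def using generate.one[of "tree_aut d"] by (simp add: one_tree_aut)
      then show ?case using oneSt by (intro bexI[of _ idp]) auto
    next
      case (insert w S)
      then obtain r where r: "r \<in> star d n H" "r \<in> St d n"
        "\<And>v. v \<in> level d n \<Longrightarrow> sect v r = (if v \<in> S then sect v g else idp)" by auto
      let ?r = "delta w (sect w g) \<odot> r"
      have w: "w \<in> level d n" using insert by simp
      have gw: "sect w g \<in> H" using g w by blast
      have sc: "sect v g \<in> carrier (tree_aut d)" if "v \<in> level d n" for v using g that Hc by blast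
      have "delta w (sect w g) \<in> star d n H" unfolding star_def using w gw by (intro generate.incl) blast
      then have "?r \<in> star d n H" using r(1) unfolding star_def by (rule generate.eng)
      moreover have "?r \<in> St d n" using St_m(1)[OF delta_in_St[OF w Hc[OF gw]] r(2)] .
      moreover have "sect v ?r = (if v \<in> insert w S then sect v g else idp)" if v: "v \<in> level d n" for v
      proof -
        have "sect v (delta w (sect w g)) = (if v = w then sect w g else idp)"
          using v w sect_delta[of w] sect_delta_other[of v w] by (auto simp: level_iff)
        then show ?thesis using v insert.hyps(2) sc[OF v] r(3)[OF v] St_sect_mult[OF r(2) v]
          by (auto simp flip: one_tree_aut[of d])
      qed
      ultimately show ?case by blast
    qed
    from this[OF finite_level subset_refl] obtain r where r: "r \<in> star d n H" "r \<in> St d n"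
        "\<And>v. v \<in> level d n \<Longrightarrow> sect v r = sect v g" by auto
    have "r = g" using St_eqI r g by blast
    then show "g \<in> star d n H" using r by simp
  qed
qed

lemma star_D'_subset: "star d n D' \<subseteq> D'"
  unfolding star_def
  by (rule T.generate_subgroup_incl[OF _ subgroup_D']) (auto simp: level_iff delta_words_D')

lemma sections_D'_imp_D':
  "g \<in> St d n \<Longrightarrow> (\<And>v. v \<in> level d n \<Longrightarrow> sect v g \<in> D') \<Longrightarrow> g \<in> D'"
  using star_D'_subset star_eq[OF subgroup_D'] by blast


lemma sect_Cons: "sect (x # u) g = sect u (sect [x] g)"
  by (simp add: sect_sect)

section \<open>Self-similarity, self-replication and contraction\<close>

lemma self_similar_D: "self_similar d D"
  by (simp add: self_similar_def subgroup_D D_sect)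

text \<open>An element that fixes \<open>x\<close> and acts there as \<open>gen_a d i\<close>: move \<open>x\<close> to \<open>i\<close> and back by a generator that has
  trivial sections at both letters.\<close>

lemma generator_as_section:
  assumes "x < d" "i < d"
  obtains t where "t \<in> D" "t [] x = x" "sect [x] t = gen_a d i"
proof -
  obtain l where l: "l < d" "mirror d l x = i" "mirror d l i = x" "l = x \<longleftrightarrow> x = i" "l = i \<longleftrightarrow> x = i"
    using midpoint[OF assms] by metis
  have ii: "mirror d i i = i" using assms mirror_fixes_iff by simp
  show ?thesis
  proof (cases "x = i")
    case True
    then show ?thesis using that[of "gen_a d i"] assms gen_in_D ii by (simp add: sect_gen)
  next
    case False
    let ?t = "gen_a d l \<odot> (gen_a d i \<odot> gen_a d l)"
    have "?t \<in> D" using l assms by (simp add: D_mult gen_in_D)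
    moreover have "?t [] x = x" using l ii by (simp add: root_mult)
    moreover have "sect [x] ?t = gen_a d i"
      using l ii False assms by (simp add: sect_mult sect_gen root_mult gen_in_carrier flip: one_tree_aut[of d])
    ultimately show ?thesis using that by blast
  qed
qed

lemma section_onto:
  assumes "x < d" "w \<in> words d"
  shows "\<exists>g\<in>D. g [] x = x \<and> sect [x] g = ev w"
  using assms(2)
proof (induction w)
  case Nil
  have "idp [] x = x" by (simp add: idp_def)
  then show ?case using one_in_D by (intro bexI[of _ idp]) simp_all
next
  case (Cons i w)
  then obtain g where g: "g \<in> D" "g [] x = x" "sect [x] g = ev w" by auto
  obtain t where t: "t \<in> D" "t [] x = x" "sect [x] t = gen_a d i"
    using generator_as_section[of x i] assms(1) Cons.prems by auto
  have "t \<odot> g \<in> D" "(t \<odot> g) [] x = x" "sect [x] (t \<odot> g) = ev (i # w)"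
    using g t by (auto simp: D_mult root_mult sect_mult)
  then show ?case by blast
qed

lemma self_replicating_D: "self_replicating d D"
proof -
  have "sect [x] ` D = D" if x: "x < d" for x
  proof
    show "sect [x] ` D \<subseteq> D" using D_sect by blast
    show "D \<subseteq> sect [x] ` D"
    proof
      fix h assume "h \<in> D"
      then obtain w where "w \<in> words d" "h = ev w" by (auto simp: D_eq)
      then show "h \<in> sect [x] ` D" using section_onto[OF x, of w] by force
    qed
  qed
  then show ?thesis by (simp add: self_replicating_def self_similar_D)
qed

definition nucleus :: "portrait set" where
  "nucleus = insert idp (gen_a d ` {..<d})"

lemma sect_nucleus: "g \<in> nucleus \<Longrightarrow> sect v g \<in> nucleus"
proof (induction v arbitrary: g)
  case (Cons x v)
  have "sect [x] g \<in> nucleus" using Cons.prems by (auto simp: nucleus_def sect_gen)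
  then show ?case using Cons.IH[of "sect [x] g"] by (simp add: sect_sect)
qed simp

text \<open>Unless the word is a power of a generator and represents an element of the nucleus, all its first-level
  sections are shorter.\<close>

lemma contracting_word:
  assumes "w \<in> words d"
  shows "\<exists>k. \<forall>v\<in>words d. k \<le> length v \<longrightarrow> sect v (ev w) \<in> nucleus"
  using assms
proof (induction "length w" arbitrary: w rule: less_induct)
  case less
  show ?case
  proof (cases "\<exists>x<d. length (sw x w) = length w")
    case True
    then obtain x where "x < d" "w = replicate (length w) x"
      using sw_full_length less.prems by blast
    then have "ev w \<in> nucleus" using ev_replicate[of x "length w"] by (auto simp: nucleus_def split: if_splits)
    then show ?thesis using sect_nucleus by blast
  next
    case False
    have "\<exists>k. \<forall>v\<in>words d. k \<le> length v \<longrightarrow> sect v (ev (sw x w)) \<in> nucleus" if "x < d" for x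
    proof (rule less.hyps)
      show "length (sw x w) < length w" using False that length_sw_le[of x w] by force
      show "sw x w \<in> words d" using less.prems sw_in_words by blast
    qed
    then obtain k where k: "\<And>x v. x < d \<Longrightarrow> v \<in> words d \<Longrightarrow> k x \<le> length v \<Longrightarrow>
        sect v (ev (sw x w)) \<in> nucleus" by metis
    have "sect v (ev w) \<in> nucleus" if v: "v \<in> words d" "Suc (\<Sum>x<d. k x) \<le> length v" for v
    proof -
      obtain x u where xu: "v = x # u" using v by (cases v) auto
      then have "x < d" using v by simp
      then have "k x \<le> (\<Sum>x<d. k x)" by (intro member_le_sum) auto
      then have "sect u (ev (sw x w)) \<in> nucleus" using k[of x u] v xu by simp
      then show ?thesis using sect_ev[OF less.prems, of x] by (simp only: xu sect_Cons[of x u])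
    qed
    then show ?thesis by blast
  qed
qed

lemma contracting_D: "contracting d D"
proof -
  have "nucleus \<subseteq> D" by (auto simp: nucleus_def one_in_D gen_in_D)
  moreover have "finite nucleus" by (simp add: nucleus_def)
  moreover have "\<forall>g\<in>D. \<exists>k. \<forall>v\<in>words d. k \<le> length v \<longrightarrow> sect v g \<in> nucleus"
    using contracting_word by (auto simp: D_eq)
  ultimately show ?thesis unfolding contracting_def using self_similar_D by blast
qed

section \<open>Which parities of letters are realized\<close>

lemma root_onto:
  assumes "p \<in> dih"
  shows "\<exists>g\<in>D. g [] = p"
proof -
  have mirr: "\<exists>i<d. q = mirror d i" if "q \<in> dih" "mir q = 1" for q
    using that by (auto simp: mir_def mirrors_def)
  show ?thesis
  proof (cases "mir p = 1")
    case True
    then obtain i where "i < d" "p = mirror d i" using mirr assms by blast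
    then show ?thesis using gen_in_D by (intro bexI[of _ "gen_a d i"]) simp_all
  next
    case False
    have m0: "mirror d 0 \<in> dih" "mir (mirror d 0) = 1" using d_pos by (simp_all add: mirror_in_dih mir_mirror)
    have "mir (mirror d 0 \<circ> p) = 1" using False assms m0 by (simp add: mir_comp del: o_apply)
    then obtain i where i: "i < d" "mirror d 0 \<circ> p = mirror d i"
      using mirr[of "mirror d 0 \<circ> p"] assms m0 dih_comp by blast
    have "p = mirror d 0 \<circ> (mirror d 0 \<circ> p)"
      using mirror_mirror[OF d_pos] by (simp add: comp_assoc[symmetric] del: o_apply)
    then have "p = (gen_a d 0 \<odot> gen_a d i) []" using i by (simp add: root_mult del: o_apply)
    then show ?thesis using D_mult gen_in_D d_pos i by blast
  qed
qed

text \<open>The boundary of a chain at the vertex \<open>p\<close> of the Cayley graph: the edges that meet \<open>p\<close> are the pairs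
  \<open>(x, p x)\<close>.\<close>

definition bnd :: "(nat \<Rightarrow> nat \<Rightarrow> bit) \<Rightarrow> (nat \<Rightarrow> nat) \<Rightarrow> bit" where
  "bnd M p = (\<Sum>x<d. M x (p x))"

definition realized :: "(nat \<Rightarrow> nat \<Rightarrow> bit) \<Rightarrow> bool" where
  "realized M \<longleftrightarrow> (\<exists>g\<in>D \<inter> St d 1. \<forall>x<d. \<forall>i. par (sect [x] g) i = M x i)"

text \<open>An arbitrary path in the Cayley graph from the identity to \<open>p\<close>.\<close>

definition path_to :: "(nat \<Rightarrow> nat) \<Rightarrow> portrait" where
  "path_to p = (SOME g. g \<in> D \<and> g [] = p)"

definition path_par :: "(nat \<Rightarrow> nat) \<Rightarrow> nat \<Rightarrow> nat \<Rightarrow> bit" where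
  "path_par p x = par (sect [x] (path_to p))"

lemma path_to: "p \<in> dih \<Longrightarrow> path_to p \<in> D \<and> path_to p [] = p"
proof -
  assume "p \<in> dih"
  then have "\<exists>g. g \<in> D \<and> g [] = p" using root_onto by blast
  then show ?thesis unfolding path_to_def by (rule someI_ex)
qed

lemma St1_iff: "g \<in> St d (Suc 0) \<longleftrightarrow> g \<in> carrier (tree_aut d) \<and> g [] = id"
  by (auto simp: St_Suc St_0 sect_in_carrier)

lemma single_level: "x < d \<Longrightarrow> [x] \<in> level d 1"
  by (simp add: level_iff)

lemma one_in_St: "idp \<in> St d n"
  using subgroup.one_closed[OF subgroup_St] by (simp add: one_tree_aut)

lemmas St_mult = subgroup.m_closed[OF subgroup_St]

text \<open>Following one path and returning along another one closes up, and the parities add.\<close>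

lemma same_root_quotient:
  assumes "g \<in> D" "h \<in> D" "g [] = h []"
  shows "tree_inv g \<odot> h \<in> D \<inter> St d 1"
    "y < d \<Longrightarrow> par (sect [y] (tree_inv g \<odot> h)) i = par (sect [y] g) i + par (sect [y] h) i"
proof -
  have D: "tree_inv g \<odot> h \<in> D" using assms by (simp add: D_mult D_inv)
  have "(tree_inv g \<odot> h) [] = (tree_inv g) [] \<circ> g []" using assms by (simp add: root_mult)
  also have "\<dots> = id" using inv_root D_carrier assms by blast
  finally show "tree_inv g \<odot> h \<in> D \<inter> St d 1" using D by (simp add: St1_iff D_carrier)
  assume y: "y < d"
  have "sect [y] (tree_inv g \<odot> h) = tree_inv (sect [y] g) \<odot> sect [y] h"
    using sect_inv[of g d "[y]"] assms y by (simp add: sect_mult D_carrier)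
  then show "par (sect [y] (tree_inv g \<odot> h)) i = par (sect [y] g) i + par (sect [y] h) i"
    using assms by (simp add: par_mult par_inv D_inv D_sect1)
qed

lemma realized_zero: "realized (\<lambda>x i. 0)"
  unfolding realized_def using one_in_D one_in_St by (intro bexI[of _ idp]) (auto simp: par_one)

lemma realized_add: "realized M \<Longrightarrow> realized N \<Longrightarrow> realized (\<lambda>x i. M x i + N x i)"
proof -
  assume "realized M" "realized N"
  then obtain g h where g: "g \<in> D" "g \<in> St d 1" "\<And>x i. x < d \<Longrightarrow> par (sect [x] g) i = M x i"
    and h: "h \<in> D" "h \<in> St d 1" "\<And>x i. x < d \<Longrightarrow> par (sect [x] h) i = N x i"
    unfolding realized_def by blast
  have "par (sect [x] (g \<odot> h)) i = M x i + N x i" if "x < d" for x i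
    using St_sect_mult[OF h(2) single_level[OF that]] g h that by (simp add: par_mult D_sect1)
  then show ?thesis unfolding realized_def using g h D_mult St_mult by blast
qed

lemma realized_sum:
  "finite S \<Longrightarrow> (\<And>s. s \<in> S \<Longrightarrow> realized (F s)) \<Longrightarrow> realized (\<lambda>x i. \<Sum>s\<in>S. c s * F s x i)"
proof (induction S rule: finite_induct)
  case empty
  then show ?case by (simp add: realized_zero)
next
  case (insert s S)
  have "realized (\<lambda>x i. c s * F s x i)"
    using insert.prems[of s] realized_zero by (cases "c s") auto
  then show ?case using realized_add[OF _ insert.IH] insert by simp
qed

text \<open>The fundamental cycle of an edge: go to its tail, traverse it, and come back from its head.\<close>

lemma realized_edge:
  assumes "p \<in> dih" "i < d"
  shows "realized (\<lambda>y j. of_bool (p y = i \<and> j = i) + path_par p y j + path_par (mirror d i \<circ> p) y j)"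
proof -
  let ?q = "mirror d i \<circ> p"
  have q: "?q \<in> dih" using assms by (simp add: dih_comp mirror_in_dih del: o_apply)
  let ?g = "path_to ?q" and ?h = "gen_a d i \<odot> path_to p"
  have h: "?h \<in> D" "?g \<in> D" using assms path_to q by (simp_all add: D_mult gen_in_D del: o_apply)
  have "?g [] = ?h []" using path_to assms q by (simp add: root_mult del: o_apply)
  note k = same_root_quotient[OF h(2,1) this]
  have "par (sect [y] ?h) j = of_bool (p y = i \<and> j = i) + path_par p y j" for y j
  proof -
    have "sect [y] ?h = sect [p y] (gen_a d i) \<odot> sect [y] (path_to p)"
      using path_to[OF assms(1)] by (simp add: sect_mult)
    moreover have "par (sect [p y] (gen_a d i)) j = of_bool (p y = i \<and> j = i)"
      using assms by (auto simp: sect_gen par_gen par_one)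
    ultimately show ?thesis using assms path_to
      by (simp add: par_mult D_sect1 gen_in_D path_par_def)
  qed
  then show ?thesis unfolding realized_def using k
    by (intro bexI[of _ "tree_inv ?g \<odot> ?h"]) (auto simp: path_par_def add_ac simp del: o_apply)
qed

text \<open>For fixed \<open>x\<close>, the edges \<open>(x, i)\<close> form a perfect matching of rotations and mirrors.\<close>

lemma sum_mirror_class:
  assumes "x < d"
  shows "(\<Sum>p\<in>rotations d. (f :: _ \<Rightarrow> bit) (mirror d (p x) \<circ> p)) = (\<Sum>q\<in>mirrors d. f q)"
proof (rule sum.reindex_bij_witness[where i = "\<lambda>q. mirror d (q x) \<circ> q" and j = "\<lambda>p. mirror d (p x) \<circ> p"])
  have fx: "mirror d y y = y" if "y < d" for y using mirror_fixes_iff that by simp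
  have inv: "mirror d ((mirror d (p x) \<circ> p) x) \<circ> (mirror d (p x) \<circ> p) = p" if "p \<in> dih" for p
    using fx[of "p x"] dih_less[OF that assms] mirror_mirror[of "p x"]
    by (simp add: comp_assoc[symmetric])
  show "mirror d ((mirror d (p x) \<circ> p) x) \<circ> (mirror d (p x) \<circ> p) = p" if "p \<in> rotations d" for p
    by (rule inv) (use that in \<open>simp add: dih_def\<close>)
  show "mirror d ((mirror d (q x) \<circ> q) x) \<circ> (mirror d (q x) \<circ> q) = q" if "q \<in> mirrors d" for q
    by (rule inv) (use that in \<open>simp add: dih_def\<close>)
  have m: "mirror d (p x) \<circ> p \<in> dih" "mir (mirror d (p x) \<circ> p) = 1 + mir p" if "p \<in> dih" for p
    using that dih_less[OF that assms] by (simp_all add: dih_comp mirror_in_dih mir_comp mir_mirror del: o_apply)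
  show "mirror d (p x) \<circ> p \<in> mirrors d" if "p \<in> rotations d" for p
  proof -
    have "mir p = 0" "p \<in> dih" using that mir_eq_0_iff by (auto simp: dih_def)
    then have "mir (mirror d (p x) \<circ> p) = 1" using m by simp
    then show ?thesis by (auto simp: mir_def)
  qed
  show "mirror d (q x) \<circ> q \<in> rotations d" if "q \<in> mirrors d" for q
  proof -
    have "mir q = 1" "q \<in> dih" using that by (auto simp: dih_def mir_def)
    then have "mir (mirror d (q x) \<circ> q) = 0" using m by simp
    then show ?thesis using mir_eq_0_iff m \<open>q \<in> dih\<close> by blast
  qed
qed simp

text \<open>A chain with zero boundary is the sum of the fundamental cycles of its edges, because every path
  \<open>path_to p\<close> enters that sum as often as the chain meets \<open>p\<close>.\<close>

lemma realized_cycle: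
  assumes supp: "\<And>x i. x < d \<Longrightarrow> i \<ge> d \<Longrightarrow> M x i = 0"
    and cyc: "\<And>p. p \<in> dih \<Longrightarrow> bnd M p = 0"
  shows "realized M"
proof -
  let ?Rot = "rotations d"
  have finR: "finite ?Rot" and finM: "finite (mirrors d)" using finite_dih by (auto simp: dih_def)
  have rot: "p \<in> ?Rot \<Longrightarrow> p \<in> dih" for p by (simp add: dih_def)
  let ?E = "\<lambda>x p y j. of_bool (p y = p x \<and> j = p x) + path_par p y j + path_par (mirror d (p x) \<circ> p) y j"
  let ?F = "\<lambda>y j. \<Sum>s\<in>{..<d} \<times> ?Rot. M (fst s) (snd s (fst s)) * ?E (fst s) (snd s) y j"
  have "realized ?F"
  proof (rule realized_sum)
    show "finite ({..<d} \<times> ?Rot)" using finR by simp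
    fix s assume "s \<in> {..<d} \<times> ?Rot"
    then show "realized (?E (fst s) (snd s))"
      using realized_edge[of "snd s" "snd s (fst s)"] rot dih_less by (auto simp del: o_apply)
  qed
  moreover have "?F y j = M y j" if y: "y < d" for y j
  proof -
    have "?F y j = (\<Sum>x<d. \<Sum>p\<in>?Rot. M x (p x) * ?E x p y j)"
      by (simp add: sum.cartesian_product split_def)
    also have "\<dots> = (\<Sum>x<d. \<Sum>p\<in>?Rot. M x (p x) * of_bool (p y = p x \<and> j = p x))
        + (\<Sum>x<d. \<Sum>p\<in>?Rot. M x (p x) * path_par p y j)
        + (\<Sum>x<d. \<Sum>p\<in>?Rot. M x (p x) * path_par (mirror d (p x) \<circ> p) y j)"
      by (simp add: sum.distrib distrib_left)
    also have "(\<Sum>x<d. \<Sum>p\<in>?Rot. M x (p x) * path_par p y j) = (\<Sum>p\<in>?Rot. bnd M p * path_par p y j)"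
      by (subst sum.swap) (simp add: bnd_def sum_distrib_right)
    also have "\<dots> = 0" using cyc rot by simp
    also have "(\<Sum>x<d. \<Sum>p\<in>?Rot. M x (p x) * path_par (mirror d (p x) \<circ> p) y j)
        = (\<Sum>x<d. \<Sum>q\<in>mirrors d. M x (q x) * path_par q y j)"
    proof (rule sum.cong[OF refl])
      fix x assume "x \<in> {..<d}"
      then have x: "x < d" by simp
      have "(\<Sum>p\<in>?Rot. M x (p x) * path_par (mirror d (p x) \<circ> p) y j)
         = (\<Sum>p\<in>?Rot. M x ((mirror d (p x) \<circ> p) x) * path_par (mirror d (p x) \<circ> p) y j)"
      proof (rule sum.cong[OF refl])
        fix p assume "p \<in> ?Rot"
        then have "mirror d (p x) (p x) = p x" using mirror_fixes_iff dih_less[OF rot x] by blast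
        then show "M x (p x) * path_par (mirror d (p x) \<circ> p) y j
            = M x ((mirror d (p x) \<circ> p) x) * path_par (mirror d (p x) \<circ> p) y j"
          by (simp only: o_apply)
      qed
      then show "(\<Sum>p\<in>?Rot. M x (p x) * path_par (mirror d (p x) \<circ> p) y j)
         = (\<Sum>q\<in>mirrors d. M x (q x) * path_par q y j)"
        using sum_mirror_class[OF x, of "\<lambda>q. M x (q x) * path_par q y j"] by (simp only:)
    qed
    also have "\<dots> = (\<Sum>q\<in>mirrors d. bnd M q * path_par q y j)"
      by (subst sum.swap) (simp add: bnd_def sum_distrib_right)
    also have "\<dots> = 0" using cyc by (simp add: dih_def)
    also have "(\<Sum>x<d. \<Sum>p\<in>?Rot. M x (p x) * of_bool (p y = p x \<and> j = p x)) = M y j"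
    proof -
      have "(\<Sum>x<d. \<Sum>p\<in>?Rot. M x (p x) * of_bool (p y = p x \<and> j = p x))
          = (\<Sum>x<d. if x = y then \<Sum>p\<in>?Rot. M y (p y) * of_bool (j = p y) else 0)"
        using dih_inj[OF rot] by (intro sum.cong) (auto intro!: sum.neutral)
      also have "\<dots> = (\<Sum>p\<in>?Rot. M y (p y) * of_bool (j = p y))" using y by simp
      also have "\<dots> = M y j"
      proof (cases "j < d")
        case True
        obtain p where p: "p \<in> dih" "mir p = 0" "p y = j"
          and uniq: "\<And>q. q \<in> dih \<Longrightarrow> mir q = 0 \<Longrightarrow> q y = j \<Longrightarrow> q = p"
          using dih_transitive[OF y True, of 0] by metis
        have "p \<in> ?Rot" using p mir_eq_0_iff by blast
        moreover have "M y (q y) * of_bool (j = q y) = (if q = p then M y j else 0)" if "q \<in> ?Rot" for q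
        proof (cases "q = p")
          case False
          have "mir q = 0" using mir_eq_0_iff[OF rot[OF that]] that by blast
          then have "q y \<noteq> j" using uniq[OF rot[OF that]] False by blast
          then show ?thesis using False by simp
        qed (simp add: p(3))
        ultimately show ?thesis using finR by simp
      next
        case False
        then have "\<And>p. p \<in> ?Rot \<Longrightarrow> j \<noteq> p y" using dih_less[OF rot y] by blast
        then show ?thesis using supp[OF y] False by simp
      qed
      finally show ?thesis .
    qed
    finally show ?thesis by (simp only: add_0_right)
  qed
  ultimately show ?thesis by (simp add: realized_def)
qed

text \<open>Adding a path to \<open>p\<close> turns the chain into a cycle.\<close>

lemma realization:
  assumes "\<And>x i. x < d \<Longrightarrow> i \<ge> d \<Longrightarrow> M x i = 0" "p \<in> dih"
    and "\<And>q. q \<in> dih \<Longrightarrow> bnd M q = of_bool (q = id) + of_bool (q = p)"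
  shows "\<exists>g\<in>D. g [] = p \<and> (\<forall>x<d. \<forall>i. par (sect [x] g) i = M x i)"
proof -
  have t: "path_to p \<in> D" "path_to p [] = p" using path_to assms by auto
  have "realized (\<lambda>x i. path_par p x i + M x i)"
  proof (rule realized_cycle)
    fix x i assume "x < d" "i \<ge> d"
    then show "path_par p x i + M x i = 0"
      using assms(1) par_outside[OF D_sect1[OF t(1)]] by (simp add: path_par_def)
  next
    fix q assume q: "q \<in> dih"
    have "bnd (path_par p) q = of_bool (q = id) + of_bool (q = p)"
      using boundary[OF t(1) q] t(2) by (simp add: bnd_def path_par_def)
    moreover have "bnd (\<lambda>x i. path_par p x i + M x i) q = bnd (path_par p) q + bnd M q"
      by (simp add: bnd_def sum.distrib)
    ultimately show "bnd (\<lambda>x i. path_par p x i + M x i) q = 0"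
      using assms(3)[OF q] by simp
  qed
  then obtain h where h: "h \<in> D" "h \<in> St d 1"
    "\<And>x i. x < d \<Longrightarrow> par (sect [x] h) i = path_par p x i + M x i"
    by (auto simp: realized_def)
  have "par (sect [x] (path_to p \<odot> h)) i = M x i" if "x < d" for x i
  proof -
    have "par (sect [x] (path_to p \<odot> h)) i = path_par p x i + (path_par p x i + M x i)"
      using St_sect_mult[OF h(2) single_level[OF that]] h(1) h(3)[OF that] t(1)
      by (simp add: par_mult D_sect1 path_par_def)
    then show ?thesis by (simp flip: add.assoc)
  qed
  moreover have "(path_to p \<odot> h) [] = p" using h(2) t by (simp add: root_mult St1_iff)
  ultimately show ?thesis using h(1) t(1) D_mult by blast
qed

text \<open>Hence \<open>D\<close> is described one level at a time: an element of \<open>D\<close> with the same root and the same parities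
  differs from the glued automorphism by one whose sections lie in \<open>D'\<close>, and such elements belong to \<open>D\<close>
  by branching.\<close>

lemma glue_in_D_iff:
  assumes h: "\<And>x. x < d \<Longrightarrow> h x \<in> D"
  shows "glue d p h \<in> D \<longleftrightarrow>
    p \<in> dih \<and> (\<forall>q\<in>dih. bnd (\<lambda>x. par (h x)) q = of_bool (q = id) + of_bool (q = p))"
proof
  assume g: "glue d p h \<in> D"
  have "bnd (\<lambda>x. par (h x)) q = of_bool (q = id) + of_bool (q = p)" if "q \<in> dih" for q
    using boundary[OF g that] by (simp add: bnd_def)
  then show "p \<in> dih \<and> (\<forall>q\<in>dih. bnd (\<lambda>x. par (h x)) q = of_bool (q = id) + of_bool (q = p))"
    using root_in_dih[OF g] by simp
next
  assume R: "p \<in> dih \<and> (\<forall>q\<in>dih. bnd (\<lambda>x. par (h x)) q = of_bool (q = id) + of_bool (q = p))"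
  obtain g where g: "g \<in> D" "g [] = p" "\<And>x i. x < d \<Longrightarrow> par (sect [x] g) i = par (h x) i"
    using realization[of "\<lambda>x. par (h x)" p] R par_outside[OF h] by blast
  have gl: "glue d p h \<in> carrier (tree_aut d)"
    using R h by (intro glue_in_carrier) (auto simp: dih_permutes D_carrier)
  let ?k = "tree_inv g \<odot> glue d p h"
  have "?k \<in> D'"
  proof (rule sections_D'_imp_D'[where n = 1])
    have "(tree_inv g) [] \<circ> p = id" using inv_root[OF D_carrier[OF g(1)]] g(2) by simp
    then show "?k \<in> St d 1" using gl g(1) by (simp add: St1_iff D_carrier root_mult del: o_apply)
    fix v assume "v \<in> level d 1"
    then obtain x where x: "v = [x]" "x < d" by (auto simp: level_Suc)
    have "act (glue d p h) [x] = act g [x]" using g(2) by simp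
    then have "sect v ?k = tree_inv (sect [x] g) \<odot> h x"
      using sect_inv[of g d "[x]"] g(1) x by (simp add: sect_mult D_carrier)
    then show "sect v ?k \<in> D'"
      using h[OF x(2)] g x(2) by (simp add: D'_iff D_mult D_inv D_sect1 par_mult par_inv)
  qed
  then have "g \<odot> ?k \<in> D" using g(1) by (simp add: D'_iff D_mult)
  then show "glue d p h \<in> D" using g(1) gl by (simp add: D_carrier flip: T.m_assoc)
qed

end

section \<open>Counting in vector spaces over the field with two elements\<close>

lemma card_fibres:
  assumes "finite A" "\<And>y. y \<in> f ` A \<Longrightarrow> card {a \<in> A. f a = y} = k"
  shows "card A = card (f ` A) * k"
proof -
  have "A = (\<Union>y\<in>f ` A. {a \<in> A. f a = y})" by blast
  then have "card A = card (\<Union>y\<in>f ` A. {a \<in> A. f a = y})" by simp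
  also have "\<dots> = (\<Sum>y\<in>f ` A. card {a \<in> A. f a = y})"
    by (rule card_UN_disjoint) (use assms(1) in auto)
  also have "\<dots> = card (f ` A) * k" using assms(2) by simp
  finally show ?thesis .
qed

lemma translation_involution: "(\<And>a :: 'a :: comm_monoid_add. a + a = 0) \<Longrightarrow> (a :: 'a) + (a + b) = b"
  by (simp flip: add.assoc)

lemma card_translate:
  assumes "\<And>a :: 'a :: comm_monoid_add. a + a = 0"
  shows "card ((\<lambda>a. (c :: 'a) + a) ` K) = card K"
  by (rule card_image, rule inj_onI) (metis translation_involution[OF assms])

lemma card_kernel_image:
  fixes f :: "'a :: comm_monoid_add \<Rightarrow> 'b :: comm_monoid_add"
  assumes fin: "finite U"
    and closed: "\<And>a b. a \<in> U \<Longrightarrow> b \<in> U \<Longrightarrow> a + b \<in> U"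
    and char: "\<And>a :: 'a. a + a = 0" "\<And>b :: 'b. b + b = 0"
    and add: "\<And>a b. a \<in> U \<Longrightarrow> b \<in> U \<Longrightarrow> f (a + b) = f a + f b"
  shows "card U = card (f ` U) * card {a \<in> U. f a = 0}"
proof (rule card_fibres[OF fin])
  fix y assume "y \<in> f ` U"
  then obtain c where c: "c \<in> U" "y = f c" by blast
  have "{a \<in> U. f a = y} = (\<lambda>a. c + a) ` {a \<in> U. f a = 0}"
  proof
    show "{a \<in> U. f a = y} \<subseteq> (\<lambda>a. c + a) ` {a \<in> U. f a = 0}"
    proof
      fix a assume "a \<in> {a \<in> U. f a = y}"
      then have "c + a \<in> {a \<in> U. f a = 0}" using c closed add char by simp
      moreover have "a = c + (c + a)" using translation_involution[OF char(1)] by metis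
      ultimately show "a \<in> (\<lambda>a. c + a) ` {a \<in> U. f a = 0}" by blast
    qed
  qed (use c closed add in auto)
  then show "card {a \<in> U. f a = y} = card {a \<in> U. f a = 0}"
    by (simp add: card_translate[OF char(1)])
qed

lemma sum_fun_apply: "(\<Sum>s\<in>S. F s) x = (\<Sum>s\<in>S. F s x)"
  by (induction S rule: infinite_finite_induct) auto

lemma fun_add_self [simp]: "(f :: 'a \<Rightarrow> bit) + f = 0"
  by (rule ext) (simp only: plus_fun_apply bit_add_self zero_fun_apply)

lemma fun2_add_self [simp]: "(f :: 'a \<Rightarrow> 'b \<Rightarrow> bit) + f = 0"
  by (intro ext) (simp only: plus_fun_apply bit_add_self zero_fun_apply)

definition supported :: "'a set \<Rightarrow> ('a \<Rightarrow> bit) set" where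
  "supported S = {v. \<forall>i. i \<notin> S \<longrightarrow> v i = 0}"

definition even_vecs :: "'a set \<Rightarrow> ('a \<Rightarrow> bit) set" where
  "even_vecs S = {v \<in> supported S. (\<Sum>i\<in>S. v i) = 0}"

lemma supported_eq_image: "supported S = (\<lambda>I i. of_bool (i \<in> I)) ` Pow S"
proof
  show "supported S \<subseteq> (\<lambda>I i. of_bool (i \<in> I)) ` Pow S"
  proof
    fix v :: "'a \<Rightarrow> bit" assume "v \<in> supported S"
    then have "v = (\<lambda>i. of_bool (i \<in> {i. v i = 1}))" "{i. v i = 1} \<subseteq> S"
      by (auto simp: supported_def fun_eq_iff)
    then show "v \<in> (\<lambda>I i. of_bool (i \<in> I)) ` Pow S" by blast
  qed
qed (auto simp: supported_def)

lemma inj_indicator_bit: "inj_on (\<lambda>I i. of_bool (i \<in> I) :: bit) X"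
  by (auto simp: inj_on_def fun_eq_iff)

lemma finite_supported: "finite S \<Longrightarrow> finite (supported S)"
  by (simp add: supported_eq_image)

lemma card_supported: "finite S \<Longrightarrow> card (supported S) = 2 ^ card S"
  unfolding supported_eq_image by (simp add: card_image inj_indicator_bit card_Pow)

lemma supported_add: "v \<in> supported S \<Longrightarrow> w \<in> supported S \<Longrightarrow> v + w \<in> supported S"
  by (auto simp: supported_def)

lemma card_even_vecs:
  assumes "finite S" "S \<noteq> {}"
  shows "card (even_vecs S) = 2 ^ (card S - 1)"
proof -
  obtain s where s: "s \<in> S" using assms by blast
  let ?f = "\<lambda>v. \<Sum>i\<in>S. v i :: bit"
  have "card (supported S) = card (?f ` supported S) * card {v \<in> supported S. ?f v = 0}"
    using finite_supported[OF assms(1)] supported_add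
    by (intro card_kernel_image) (auto simp: sum.distrib)
  moreover have "?f ` supported S = UNIV"
  proof -
    have "b \<in> ?f ` supported S" for b
    proof
      show "(\<lambda>i. if i = s then b else 0) \<in> supported S" using s by (simp add: supported_def)
      show "b = ?f (\<lambda>i. if i = s then b else 0)" using s assms by simp
    qed
    then show ?thesis by blast
  qed
  moreover have "(UNIV :: bit set) = {0, 1}" by (auto intro: bit.exhaust)
  then have "card (UNIV :: bit set) = card {0, 1 :: bit}" by (rule arg_cong)
  then have "card (UNIV :: bit set) = 2" by simp
  moreover have "2 ^ card S = 2 * (2 :: nat) ^ (card S - 1)"
    using assms by (metis card_gt_0_iff power_eq_if not_gr0)
  ultimately show ?thesis using card_supported[OF assms(1)] by (simp add: even_vecs_def)
qed

text \<open>An additive map onto the even vectors has an additive section as soon as it attains a basis.\<close>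

lemma even_section:
  fixes f :: "'a :: comm_monoid_add \<Rightarrow> 'b \<Rightarrow> bit"
  assumes S: "finite S" "base \<in> S"
    and U: "0 \<in> U" "\<And>a b. a \<in> U \<Longrightarrow> b \<in> U \<Longrightarrow> a + b \<in> U"
    and char: "\<And>a :: 'a. a + a = 0"
    and add: "\<And>a b. a \<in> U \<Longrightarrow> b \<in> U \<Longrightarrow> f (a + b) = f a + f b"
    and ex: "\<And>q. q \<in> S \<Longrightarrow> \<exists>u\<in>U. f u = (\<lambda>i. of_bool (i = base) + of_bool (i = q))"
  shows "\<exists>s. (\<forall>v. s v \<in> U) \<and> (\<forall>v w. s (v + w) = s v + s w) \<and> (\<forall>v\<in>even_vecs S. f (s v) = v)"
proof -
  obtain u where u: "\<And>q. q \<in> S \<Longrightarrow> u q \<in> U \<and> f (u q) = (\<lambda>i. of_bool (i = base) + of_bool (i = q))"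
    using ex by metis
  define s where "s = (\<lambda>v :: 'b \<Rightarrow> bit. \<Sum>q\<in>S. if v q = 1 then u q else 0)"
  have f0: "f 0 = 0" using add[OF U(1) U(1)] by (simp add: fun_eq_iff)
  have fin: "(\<Sum>q\<in>R. if v q = 1 then u q else 0) \<in> U \<and>
      f (\<Sum>q\<in>R. if v q = 1 then u q else 0) = (\<Sum>q\<in>R. if v q = 1 then f (u q) else 0)"
    if "finite R" "R \<subseteq> S" for R and v :: "'b \<Rightarrow> bit"
    using that
  proof (induction R rule: finite_induct)
    case empty
    then show ?case using U(1) f0 by simp
  next
    case (insert q R)
    then show ?case using U u add f0 by simp
  qed
  show ?thesis
  proof (intro exI[of _ s] conjI allI ballI)
    show "s v \<in> U" for v using fin[OF S(1) subset_refl] by (simp add: s_def)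
    show "s (v + w) = s v + s w" for v w
      unfolding s_def sum.distrib[symmetric]
    proof (rule sum.cong[OF refl])
      fix q
      show "(if (v + w) q = 1 then u q else 0) = (if v q = 1 then u q else 0) + (if w q = 1 then u q else 0)"
        by (cases "v q"; cases "w q") (simp_all add: char)
    qed
    fix v assume v: "v \<in> even_vecs S"
    have "f (s v) = (\<Sum>q\<in>S. if v q = 1 then f (u q) else 0)"
      unfolding s_def using fin[OF S(1) subset_refl] by simp
    also have "\<dots> = v"
    proof
      fix i
      have "(\<Sum>q\<in>S. if v q = 1 then f (u q) else 0) i = (\<Sum>q\<in>S. v q * (of_bool (i = base) + of_bool (i = q)))"
        unfolding sum_fun_apply
      proof (rule sum.cong[OF refl])
        fix q assume "q \<in> S"
        then show "(if v q = 1 then f (u q) else 0) i = v q * (of_bool (i = base) + of_bool (i = q))"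
          using u by (cases "v q") auto
      qed
      also have "\<dots> = (\<Sum>q\<in>S. v q) * of_bool (i = base) + (\<Sum>q\<in>S. v q * of_bool (i = q))"
        by (simp add: distrib_left sum.distrib sum_distrib_right)
      also have "(\<Sum>q\<in>S. v q * of_bool (i = q)) = (\<Sum>q\<in>S. if i = q then v q else 0)"
        by (rule sum.cong) auto
      also have "\<dots> = v i" using S v by (simp add: even_vecs_def supported_def)
      also have "(\<Sum>q\<in>S. v q) = 0" using v by (simp add: even_vecs_def)
      finally show "(\<Sum>q\<in>S. if v q = 1 then f (u q) else 0) i = v i" by simp
    qed
    finally show "f (s v) = v" .
  qed
qed

text \<open>The resulting dimension count: the image has codimension one in the space of all vectors supported by \<open>S\<close>.\<close>

lemma even_image_kernel:
  fixes f :: "'a :: comm_monoid_add \<Rightarrow> 'b \<Rightarrow> bit"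
  assumes S: "finite S" "base \<in> S"
    and U: "finite U" "0 \<in> U" "\<And>a b. a \<in> U \<Longrightarrow> b \<in> U \<Longrightarrow> a + b \<in> U"
    and char: "\<And>a :: 'a. a + a = 0"
    and add: "\<And>a b. a \<in> U \<Longrightarrow> b \<in> U \<Longrightarrow> f (a + b) = f a + f b"
    and sub: "f ` U \<subseteq> even_vecs S"
    and ex: "\<And>q. q \<in> S \<Longrightarrow> \<exists>u\<in>U. f u = (\<lambda>i. of_bool (i = base) + of_bool (i = q))"
  shows "card U = 2 ^ (card S - 1) * card {a \<in> U. f a = 0}"
proof -
  have "\<exists>s. (\<forall>v. s v \<in> U) \<and> (\<forall>v w. s (v + w) = s v + s w) \<and> (\<forall>v\<in>even_vecs S. f (s v) = v)"
    by (rule even_section[OF S U(2,3) char add ex])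
  then obtain s where s: "\<forall>v. s v \<in> U" "\<forall>v\<in>even_vecs S. f (s v) = v" by blast
  have "even_vecs S \<subseteq> f ` U"
  proof
    fix v assume "v \<in> even_vecs S"
    then have "v = f (s v)" using s(2) by simp
    then show "v \<in> f ` U" using s(1) by blast
  qed
  then have "f ` U = even_vecs S" using sub by blast
  moreover have "card U = card (f ` U) * card {a \<in> U. f a = 0}"
    by (rule card_kernel_image) (use U char add in auto)
  ultimately show ?thesis using card_even_vecs S by (metis empty_iff)
qed

section \<open>Matrices of letter parities\<close>

context odd_gon
begin

definition Mat :: "(nat \<Rightarrow> nat \<Rightarrow> bit) set" where
  "Mat = {M. \<forall>x i. \<not> (x < d \<and> i < d) \<longrightarrow> M x i = 0}"

definition row_sums :: "(nat \<Rightarrow> nat \<Rightarrow> bit) \<Rightarrow> nat \<Rightarrow> bit" where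
  "row_sums M x = (\<Sum>i<d. M x i)"

definition col_sums :: "(nat \<Rightarrow> nat \<Rightarrow> bit) \<Rightarrow> nat \<Rightarrow> bit" where
  "col_sums M i = (\<Sum>x<d. M x i)"

text \<open>The matrices of the elements of the first level stabilizer.\<close>

definition cycles :: "(nat \<Rightarrow> nat \<Rightarrow> bit) set" where
  "cycles = {M \<in> Mat. \<forall>p\<in>dih. bnd M p = 0}"

text \<open>Even row sums say that the sections act on the first level by rotations. Precisely then they can be changed by
  elements of \<open>D'\<close> so that the second level is fixed as well.\<close>

definition spaceA :: "(nat \<Rightarrow> nat \<Rightarrow> bit) set" where
  "spaceA = {M \<in> cycles. row_sums M = 0}"

definition spaceB :: "(nat \<Rightarrow> nat \<Rightarrow> bit) set" where
  "spaceB = {M \<in> spaceA. col_sums M = 0}"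

lemma Mat_add: "M \<in> Mat \<Longrightarrow> N \<in> Mat \<Longrightarrow> M + N \<in> Mat"
  by (auto simp: Mat_def)

lemma bnd_add: "bnd (M + N) p = bnd M p + bnd N p"
  by (simp add: bnd_def sum.distrib)

lemma row_sums_add: "row_sums (M + N) = row_sums M + row_sums N"
  by (rule ext) (simp add: row_sums_def sum.distrib)

lemma col_sums_add: "col_sums (M + N) = col_sums M + col_sums N"
  by (rule ext) (simp add: col_sums_def sum.distrib)

lemma zero_in_Mat: "0 \<in> Mat"
  by (simp add: Mat_def)

lemma zero_in_cycles: "0 \<in> cycles"
  by (simp add: cycles_def zero_in_Mat bnd_def)

lemma zero_in_spaceA: "0 \<in> spaceA"
  by (auto simp: spaceA_def zero_in_cycles row_sums_def)

lemma zero_in_spaceB: "0 \<in> spaceB"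
  by (auto simp: spaceB_def zero_in_spaceA col_sums_def)

lemma cycles_add: "M \<in> cycles \<Longrightarrow> N \<in> cycles \<Longrightarrow> M + N \<in> cycles"
  by (simp add: cycles_def Mat_add bnd_add)

lemma spaceA_add: "M \<in> spaceA \<Longrightarrow> N \<in> spaceA \<Longrightarrow> M + N \<in> spaceA"
  by (simp add: spaceA_def cycles_add row_sums_add)

lemma spaceB_add: "M \<in> spaceB \<Longrightarrow> N \<in> spaceB \<Longrightarrow> M + N \<in> spaceB"
  by (simp add: spaceB_def spaceA_add col_sums_add)

lemma Mat_eq_image: "Mat = curry ` supported ({..<d} \<times> {..<d})"
proof
  show "Mat \<subseteq> curry ` supported ({..<d} \<times> {..<d})"
  proof
    fix M assume "M \<in> Mat"
    then have "case_prod M \<in> supported ({..<d} \<times> {..<d})" by (simp add: Mat_def supported_def)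
    then show "M \<in> curry ` supported ({..<d} \<times> {..<d})"
      by (intro image_eqI[of _ _ "case_prod M"]) simp_all
  qed
qed (auto simp: Mat_def supported_def)

lemma finite_Mat: "finite Mat"
  by (simp add: Mat_eq_image finite_supported)

lemma card_Mat: "card Mat = 2 ^ (d * d)"
proof -
  have "inj_on curry (supported ({..<d} \<times> {..<d}))" by (rule inj_onI) (metis case_prod_curry)
  then show ?thesis by (simp add: Mat_eq_image card_image card_supported card_cartesian_product)
qed

lemma finite_cycles: "finite cycles"
  by (rule finite_subset[OF _ finite_Mat]) (auto simp: cycles_def)

lemma finite_spaceA: "finite spaceA"
  by (rule finite_subset[OF _ finite_cycles]) (auto simp: spaceA_def)

lemma sum_class:
  assumes "x < d"
  shows "(\<Sum>p\<in>rotations d. f (p x)) = (\<Sum>i<d. f i :: bit)" "(\<Sum>p\<in>mirrors d. f (p x)) = (\<Sum>i<d. f i)"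
proof -
  have rot: "p \<in> rotations d \<longleftrightarrow> p \<in> dih \<and> mir p = 0" for p
    using mir_eq_0_iff[of p] by (auto simp: dih_def)
  have "bij_betw (\<lambda>p. p x) (rotations d) {..<d}"
    unfolding bij_betw_def
  proof
    show "inj_on (\<lambda>p. p x) (rotations d)"
      using dih_eq_iff_apply[OF _ _ assms] rot by (auto simp: inj_on_def)
    have "i < d \<Longrightarrow> \<exists>p\<in>rotations d. p x = i" for i
      using dih_transitive[OF assms, of i 0] rot by blast
    then show "(\<lambda>p. p x) ` rotations d = {..<d}"
      using rot dih_less[OF _ assms] by (auto simp: image_iff)
  qed
  then show r: "(\<Sum>p\<in>rotations d. f (p x)) = (\<Sum>i<d. f i)"
    by (rule sum.reindex_bij_betw)
  have "(\<Sum>p\<in>mirrors d. f (p x)) = (\<Sum>p\<in>rotations d. f ((mirror d (p x) \<circ> p) x))"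
    using sum_mirror_class[OF assms, of "\<lambda>q. f (q x)"] by simp
  also have "\<dots> = (\<Sum>p\<in>rotations d. f (p x))"
  proof (rule sum.cong[OF refl])
    fix p assume "p \<in> rotations d"
    then have "mirror d (p x) (p x) = p x"
      using mirror_fixes_iff[of "p x" "p x"] dih_less[OF _ assms] rot by blast
    then show "f ((mirror d (p x) \<circ> p) x) = f (p x)" by simp
  qed
  finally show "(\<Sum>p\<in>mirrors d. f (p x)) = (\<Sum>i<d. f i)" using r by simp
qed

lemma sum_bnd_rotations: "(\<Sum>p\<in>rotations d. bnd M p) = (\<Sum>x<d. row_sums M x)"
  unfolding bnd_def row_sums_def by (subst sum.swap) (simp add: sum_class)

lemma sum_bnd_mirrors: "(\<Sum>p\<in>mirrors d. bnd M p) = (\<Sum>x<d. row_sums M x)"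
  unfolding bnd_def row_sums_def by (subst sum.swap) (simp add: sum_class)

text \<open>Every edge has two ends.\<close>

lemma sum_bnd: "(\<Sum>p\<in>dih. bnd M p) = 0"
proof -
  have "(\<Sum>p\<in>dih. bnd M p) = (\<Sum>p\<in>rotations d. bnd M p) + (\<Sum>p\<in>mirrors d. bnd M p)"
    unfolding dih_def using finite_dih rotations_mirrors_disjoint
    by (intro sum.union_disjoint) (auto simp: dih_def)
  then show ?thesis by (simp add: sum_bnd_rotations sum_bnd_mirrors)
qed

lemma sum_row_sums: "M \<in> cycles \<Longrightarrow> (\<Sum>x<d. row_sums M x) = 0"
  by (simp add: sum_bnd_rotations[symmetric] cycles_def dih_def)

lemma sum_col_sums: "(\<Sum>i<d. col_sums M i) = (\<Sum>x<d. row_sums M x)"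
  unfolding row_sums_def col_sums_def by (rule sum.swap)

definition mat_of :: "portrait \<Rightarrow> nat \<Rightarrow> nat \<Rightarrow> bit" where
  "mat_of g x i = (if x < d then par (sect [x] g) i else 0)"

lemma mat_of_in_Mat: "g \<in> D \<Longrightarrow> mat_of g \<in> Mat"
  by (auto simp: mat_of_def Mat_def par_outside D_sect1)

lemma bnd_mat_of: "g \<in> D \<Longrightarrow> p \<in> dih \<Longrightarrow> bnd (mat_of g) p = of_bool (p = id) + of_bool (p = g [])"
  using boundary by (simp add: bnd_def mat_of_def)

lemma mat_of_in_cycles: "g \<in> D \<Longrightarrow> g \<in> St d 1 \<Longrightarrow> mat_of g \<in> cycles"
  by (auto simp: cycles_def mat_of_in_Mat bnd_mat_of St1_iff)

lemma col_sums_mat_of: "g \<in> D \<Longrightarrow> col_sums (mat_of g) = par g"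
  by (rule ext) (simp add: col_sums_def mat_of_def par_sum_sections[of g])

lemma row_sums_outside: "M \<in> Mat \<Longrightarrow> row_sums M \<in> supported {..<d}"
  by (auto simp: row_sums_def Mat_def supported_def)

lemma col_sums_outside: "M \<in> Mat \<Longrightarrow> col_sums M \<in> supported {..<d}"
  by (auto simp: col_sums_def Mat_def supported_def)

text \<open>The Cayley graph is connected: \<open>path_to q\<close> has boundary \<open>[id] + [q]\<close>.\<close>

lemma card_Mat_cycles: "card Mat = 2 ^ (2 * d - 1) * card cycles"
proof -
  let ?f = "\<lambda>M p. if p \<in> dih then bnd M p else 0"
  have "card Mat = 2 ^ (card dih - 1) * card {M \<in> Mat. ?f M = 0}"
  proof (rule even_image_kernel[OF finite_dih id_in_dih finite_Mat zero_in_Mat Mat_add])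
    show "?f ` Mat \<subseteq> even_vecs dih"
      by (auto simp: even_vecs_def supported_def sum_bnd)
    fix q assume q: "q \<in> dih"
    have "?f (mat_of (path_to q)) = (\<lambda>i. of_bool (i = id) + of_bool (i = q))"
    proof
      fix i
      show "?f (mat_of (path_to q)) i = of_bool (i = id) + of_bool (i = q)"
        using bnd_mat_of[of "path_to q" i] path_to[OF q] q id_in_dih
        by (cases "i \<in> dih") (auto simp del: id_apply)
    qed
    then show "\<exists>M\<in>Mat. ?f M = (\<lambda>i. of_bool (i = id) + of_bool (i = q))"
      using mat_of_in_Mat path_to[OF q] by blast
  qed (auto simp: bnd_add)
  moreover have "{M \<in> Mat. ?f M = 0} = cycles"
    by (auto simp: cycles_def fun_eq_iff)
  ultimately show ?thesis by (simp add: card_dih)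
qed

lemma card_cycles: "card cycles = 2 ^ ((d - 1) ^ 2)"
proof -
  have "(d - 1) ^ 2 + (2 * d - 1) = d * d"
    using d_pos by (cases d) (auto simp: power2_eq_square)
  then have "2 ^ (2 * d - 1) * card cycles = 2 ^ (2 * d - 1) * (2 :: nat) ^ ((d - 1) ^ 2)"
    using card_Mat_cycles card_Mat by (simp flip: power_add add: add.commute)
  then show ?thesis by simp
qed

text \<open>The rows \<open>i\<close> and \<open>b\<close> of a four-cycle have odd weight, and \<open>a\<close> is the midpoint of \<open>i\<close> and \<open>b\<close>.\<close>

lemma mat_of_cyc:
  assumes "i < d" "j < d" "i \<noteq> j" and a: "a = mirror d i j" and b: "b = mirror d a i"
  shows "mat_of (ev (cyc i j)) = (\<lambda>x k. if x = i \<or> x = b then of_bool (k = i)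
      else if x = a then of_bool (k = a) + of_bool (k = j) else 0)"
    and "mat_of (ev (cyc i j)) \<in> cycles" "a < d" "b < d" "a \<noteq> i" "b \<noteq> i" "b \<noteq> a"
proof -
  have ii: "mirror d i i = i" using assms mirror_fixes_iff by simp
  have b': "b = mirror d i (mirror d j i)"
    unfolding b a mirror_conj[OF assms(1,2)] by (simp add: ii)
  note dist = cyc_distinct[OF assms(1-3), folded a b']
  show ab: "a < d" "b < d" "a \<noteq> i" "b \<noteq> i" "b \<noteq> a" using assms b dist mirror_less by auto
  have w: "cyc i j \<in> words d" using assms cyc_in_words by blast
  show "mat_of (ev (cyc i j)) = (\<lambda>x k. if x = i \<or> x = b then of_bool (k = i)
      else if x = a then of_bool (k = a) + of_bool (k = j) else 0)"
    using assms(1-3) ab w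
    by (auto simp: fun_eq_iff mat_of_def sect_ev par_ev sw_in_words sw_cyc[OF assms(1-3), folded a b']
        simp del: ev.simps)
  show "mat_of (ev (cyc i j)) \<in> cycles"
    using w root_cyc[OF assms(1,2)] by (intro mat_of_in_cycles) (auto simp: ev_in_D ev_in_carrier St1_iff)
qed

lemma row_sums_onto_pairs:
  assumes "x < d" "y < d"
  shows "\<exists>M\<in>cycles. row_sums M = (\<lambda>i. of_bool (i = x) + of_bool (i = y))"
proof (cases "x = y")
  case True
  have "row_sums 0 = (\<lambda>i. of_bool (i = x) + of_bool (i = y))" using True by (simp add: row_sums_def fun_eq_iff)
  then show ?thesis using zero_in_cycles by blast
next
  case False
  obtain a where a: "a < d" "mirror d a x = y" "a \<noteq> x" using midpoint[OF assms] False by metis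
  define j where "j = mirror d x a"
  have j: "j < d" "a = mirror d x j" "x \<noteq> j"
    using a assms mirror_less mirror_mirror_apply mirror_fixes_iff[of x x] by (auto simp: j_def) (metis mirror_mirror_apply)
  note m = mat_of_cyc[OF assms(1) j(1) j(3) j(2) a(2)[symmetric]]
  have ja: "j \<noteq> a" using mirror_fixes_iff[of x j] j assms m(5) by auto
  have "row_sums (mat_of (ev (cyc x j))) = (\<lambda>i. of_bool (i = x) + of_bool (i = y))"
  proof
    fix k
    show "row_sums (mat_of (ev (cyc x j))) k = of_bool (k = x) + of_bool (k = y)"
      using assms j(1) m(3-7) ja
      by (cases "k = x"; cases "k = y"; cases "k = a") (auto simp: row_sums_def m(1) sum.distrib)
  qed
  then show ?thesis using m(2) by blast
qed

lemma card_cycles_spaceA: "card cycles = 2 ^ (d - 1) * card spaceA"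
proof -
  have "card cycles = 2 ^ (card {..<d} - 1) * card {M \<in> cycles. row_sums M = 0}"
  proof (rule even_image_kernel[where base = 0])
    show "row_sums ` cycles \<subseteq> even_vecs {..<d}"
      using sum_row_sums row_sums_outside by (auto simp: even_vecs_def cycles_def)
  qed (use row_sums_onto_pairs d_pos in \<open>auto simp: finite_cycles zero_in_cycles cycles_add row_sums_add\<close>)
  then show ?thesis by (simp add: spaceA_def)
qed

text \<open>Two four-cycles with the same rows \<open>i\<close>, \<open>b\<close> of odd weight and the same middle row \<open>a\<close>: in the sum all rows
  become even, and the columns \<open>i\<close>, \<open>b\<close> and \<open>a\<close> cancel.\<close>

lemma col_sums_onto_pairs:
  assumes "j < d" "j' < d"
  shows "\<exists>M\<in>spaceA. col_sums M = (\<lambda>k. of_bool (k = j) + of_bool (k = j'))"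
proof (cases "j = j'")
  case True
  have "col_sums 0 = (\<lambda>i. of_bool (i = j) + of_bool (i = j'))" using True by (simp add: col_sums_def fun_eq_iff)
  then show ?thesis using zero_in_spaceA by blast
next
  case False
  obtain a where a: "a < d" "mirror d a j = j'" "mirror d a j' = j" "a \<noteq> j" "a \<noteq> j'"
    using midpoint[OF assms] False by metis
  obtain i where i: "i < d" "mirror d i j = a" "mirror d i a = j" "i \<noteq> j" "i \<noteq> a"
    using midpoint[OF assms(1) a(1)] a(4) by metis
  define b where "b = mirror d a i"
  have b: "b < d" using a i mirror_less by (simp add: b_def)
  have ba: "mirror d a b = i" using a by (simp add: b_def)
  have bj': "b \<noteq> j'" using ba a i by metis
  have mb: "mirror d b j' = a"
    using mirror_conj[OF a(1) i(1)] a i mirror_fixes_iff[of a a] by (simp add: b_def)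
  note m = mat_of_cyc[OF i(1) assms(1) i(4) i(2)[symmetric] b_def]
  note m' = mat_of_cyc[OF b assms(2) bj' mb[symmetric] ba[symmetric]]
  let ?M = "mat_of (ev (cyc i j)) + mat_of (ev (cyc b j'))"
  have eqM: "?M = (\<lambda>x k. if x = i \<or> x = b then of_bool (k = i) + of_bool (k = b)
      else if x = a then of_bool (k = j) + of_bool (k = j') else 0)"
    using m(3-7) m'(3-7) False a
    by (intro ext) (auto simp: m(1) m'(1))
  have "?M \<in> cycles" using m(2) m'(2) by (rule cycles_add)
  moreover have "row_sums ?M = 0"
  proof
    fix x
    show "row_sums ?M x = 0 x"
      unfolding eqM using i(1) b assms
      by (cases "x = i \<or> x = b"; cases "x = a") (auto simp: row_sums_def sum.distrib)
  qed
  ultimately have "?M \<in> spaceA" by (simp add: spaceA_def)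
  moreover have "col_sums ?M = (\<lambda>k. of_bool (k = j) + of_bool (k = j'))"
  proof
    fix k
    have "col_sums ?M k = (\<Sum>x<d. (if x = i then of_bool (k = i) + of_bool (k = b) else 0)
      + (if x = b then of_bool (k = i) + of_bool (k = b) else 0)
      + (if x = a then of_bool (k = j) + of_bool (k = j') else 0))"
      unfolding eqM col_sums_def using m(5-7) by (intro sum.cong) auto
    also have "\<dots> = of_bool (k = j) + of_bool (k = j')"
      using i(1) b a(1) by (simp add: sum.distrib)
    finally show "col_sums ?M k = of_bool (k = j) + of_bool (k = j')" .
  qed
  ultimately show ?thesis by blast
qed

lemma col_sums_even: "M \<in> cycles \<Longrightarrow> col_sums M \<in> even_vecs {..<d}"
  using sum_row_sums col_sums_outside by (auto simp: even_vecs_def cycles_def sum_col_sums)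

lemma spaceA_cycles: "M \<in> spaceA \<Longrightarrow> M \<in> cycles"
  by (simp add: spaceA_def)

lemma card_spaceA_spaceB: "card spaceA = 2 ^ (d - 1) * card spaceB"
proof -
  have "card spaceA = 2 ^ (card {..<d} - 1) * card {M \<in> spaceA. col_sums M = 0}"
    by (rule even_image_kernel[where base = 0])
      (use col_sums_onto_pairs d_pos col_sums_even spaceA_cycles in
        \<open>auto simp: finite_spaceA zero_in_spaceA spaceA_add col_sums_add\<close>)
  then show ?thesis by (simp add: spaceB_def)
qed

lemma card_cycles_col_sums: "card cycles = 2 ^ (d - 1) * card {M \<in> cycles. col_sums M = 0}"
proof -
  have "card cycles = 2 ^ (card {..<d} - 1) * card {M \<in> cycles. col_sums M = 0}"
  proof (rule even_image_kernel[where base = 0])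
    fix q assume "q \<in> {..<d}"
    then show "\<exists>M\<in>cycles. col_sums M = (\<lambda>i. of_bool (i = 0) + of_bool (i = q))"
      using col_sums_onto_pairs[of 0 q] d_pos spaceA_cycles by blast
  qed (use d_pos col_sums_even in \<open>auto simp: finite_cycles zero_in_cycles cycles_add col_sums_add\<close>)
  then show ?thesis by simp
qed

lemma exponent_split: "(d - 1) ^ 2 = (d - 1) + (d - 1) * (d - 2)" "(d - 1) * (d - 2) = (d - 1) + (d - 1) * (d - 3)"
proof -
  obtain m where "d = m + 3" using d_ge_3 by (metis le_add_diff_inverse2)
  then show "(d - 1) ^ 2 = (d - 1) + (d - 1) * (d - 2)" "(d - 1) * (d - 2) = (d - 1) + (d - 1) * (d - 3)"
    by (auto simp: power2_eq_square algebra_simps)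
qed

lemma card_spaceA: "card spaceA = 2 ^ ((d - 1) * (d - 2))"
proof -
  have "2 ^ (d - 1) * card spaceA = 2 ^ (d - 1) * (2 :: nat) ^ ((d - 1) * (d - 2))"
    using card_cycles_spaceA card_cycles by (simp only: exponent_split(1) power_add)
  then show ?thesis by simp
qed

lemma card_col_kernel: "card {M \<in> cycles. col_sums M = 0} = 2 ^ ((d - 1) * (d - 2))"
proof -
  have "2 ^ (d - 1) * card {M \<in> cycles. col_sums M = 0} = 2 ^ (d - 1) * (2 :: nat) ^ ((d - 1) * (d - 2))"
    using card_cycles_col_sums card_cycles by (simp only: exponent_split(1) power_add)
  then show ?thesis by simp
qed

lemma card_spaceB: "card spaceB = 2 ^ ((d - 1) * (d - 3))"
proof -
  have "2 ^ (d - 1) * card spaceB = 2 ^ (d - 1) * (2 :: nat) ^ ((d - 1) * (d - 3))"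
    using card_spaceA_spaceB card_spaceA by (simp only: exponent_split(2) power_add)
  then show ?thesis by simp
qed

lemma column_section:
  "\<exists>s. (\<forall>v. s v \<in> spaceA) \<and> (\<forall>v w. s (v + w) = s v + s w) \<and>
    (\<forall>v\<in>even_vecs {..<d}. col_sums (s v) = v)"
proof (rule even_section[where base = 0])
  fix q assume "q \<in> {..<d}"
  then show "\<exists>M\<in>spaceA. col_sums M = (\<lambda>i. of_bool (i = 0) + of_bool (i = q))"
    using col_sums_onto_pairs[of 0 q] d_pos by blast
qed (use d_pos in \<open>auto simp: zero_in_spaceA spaceA_add col_sums_add simp del: plus_fun_apply\<close>)

end

section \<open>Counting cosets level by level\<close>

lemma card_image_same_kernel:
  assumes "\<And>a b. a \<in> A \<Longrightarrow> b \<in> A \<Longrightarrow> f a = f b \<longleftrightarrow> g a = g b"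
  shows "card (f ` A) = card (g ` A)" "finite (f ` A) \<longleftrightarrow> finite (g ` A)"
proof -
  have "bij_betw (\<lambda>y. g (inv_into A f y)) (f ` A) (g ` A)"
  proof (rule bij_betwI')
    fix y z assume "y \<in> f ` A" "z \<in> f ` A"
    then show "g (inv_into A f y) = g (inv_into A f z) \<longleftrightarrow> y = z"
      by (metis assms f_inv_into_f inv_into_into)
  next
    fix y assume "y \<in> f ` A"
    then show "g (inv_into A f y) \<in> g ` A" by (simp add: inv_into_into)
  next
    fix z assume "z \<in> g ` A"
    then obtain a where a: "a \<in> A" "z = g a" by blast
    then have "z = g (inv_into A f (f a))"
      by (metis assms f_inv_into_f imageI inv_into_into)
    then show "\<exists>y\<in>f ` A. z = g (inv_into A f y)" using a by blast
  qed
  then show "card (f ` A) = card (g ` A)" "finite (f ` A) \<longleftrightarrow> finite (g ` A)"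
    by (rule bij_betw_same_card, rule bij_betw_finite)
qed

context odd_gon
begin

lemma rcosets_subgrp: "rcosets\<^bsub>subgrp d G\<^esub> H = (\<lambda>g. H #>\<^bsub>tree_aut d\<^esub> g) ` G"
  by (auto simp: RCOSETS_def r_coset_def)

lemma rcos_eq_iff:
  assumes "subgroup H (tree_aut d)" "a \<in> carrier (tree_aut d)" "b \<in> carrier (tree_aut d)"
  shows "H #>\<^bsub>tree_aut d\<^esub> a = H #>\<^bsub>tree_aut d\<^esub> b \<longleftrightarrow> a \<odot> tree_inv b \<in> H"
proof
  assume "H #>\<^bsub>tree_aut d\<^esub> a = H #>\<^bsub>tree_aut d\<^esub> b"
  then have "a \<in> H #>\<^bsub>tree_aut d\<^esub> b" using T.rcos_self[OF assms(2,1)] by simp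
  then obtain h where h: "h \<in> H" "a = h \<odot> b" by (auto simp: r_coset_def)
  then have "a \<odot> tree_inv b = h"
    using assms subgroup.mem_carrier[OF assms(1)] by (simp add: T.m_assoc)
  then show "a \<odot> tree_inv b \<in> H" using h by simp
next
  assume h: "a \<odot> tree_inv b \<in> H"
  have "a = (a \<odot> tree_inv b) \<odot> b" using assms by (simp add: T.m_assoc)
  then have "a \<in> H #>\<^bsub>tree_aut d\<^esub> b" using h by (auto simp: r_coset_def)
  then show "H #>\<^bsub>tree_aut d\<^esub> a = H #>\<^bsub>tree_aut d\<^esub> b"
    using T.repr_independence[OF _ assms(3,1)] by simp
qed

lemma index_eq_card_image:
  assumes "subgroup H (tree_aut d)" "G \<subseteq> carrier (tree_aut d)"
    and "\<And>g h. g \<in> G \<Longrightarrow> h \<in> G \<Longrightarrow> q g = q h \<longleftrightarrow> g \<odot> tree_inv h \<in> H"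
  shows "index d G H = card (q ` G)" "finite (rcosets\<^bsub>subgrp d G\<^esub> H) \<longleftrightarrow> finite (q ` G)"
proof -
  have eq: "H #>\<^bsub>tree_aut d\<^esub> a = H #>\<^bsub>tree_aut d\<^esub> b \<longleftrightarrow> q a = q b" if "a \<in> G" "b \<in> G" for a b
    using rcos_eq_iff[OF assms(1)] assms(2,3) that by (simp add: subset_iff)
  show "index d G H = card (q ` G)" "finite (rcosets\<^bsub>subgrp d G\<^esub> H) \<longleftrightarrow> finite (q ` G)"
    unfolding index_def rcosets_subgrp by (rule card_image_same_kernel[OF eq]; assumption)+
qed

definition trunc :: "nat \<Rightarrow> portrait \<Rightarrow> portrait" where
  "trunc n g u = (if u \<in> words d \<and> length u < n then g u else id)"

lemma trunc_eq_iff: "trunc n g = trunc n h \<longleftrightarrow> (\<forall>u\<in>words d. length u < n \<longrightarrow> g u = h u)"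
proof
  assume "trunc n g = trunc n h"
  then have "trunc n g u = trunc n h u" for u by simp
  then show "\<forall>u\<in>words d. length u < n \<longrightarrow> g u = h u" by (metis trunc_def)
next
  assume a: "\<forall>u\<in>words d. length u < n \<longrightarrow> g u = h u"
  show "trunc n g = trunc n h" by (rule ext) (use a in \<open>simp add: trunc_def\<close>)
qed

lemma act_cong: "(\<And>u. u \<in> words d \<Longrightarrow> length u < length w \<Longrightarrow> g u = h u) \<Longrightarrow> w \<in> words d \<Longrightarrow> act g w = act h w"
proof (induction w arbitrary: g h)
  case (Cons x w)
  have "act (sect [x] g) w = act (sect [x] h) w"
    by (rule Cons.IH) (use Cons.prems in \<open>auto simp: sect_apply\<close>)
  then show ?case using Cons.prems(1)[of "[]"] by simp
qed simp

lemma trunc_eq_iff_quotient: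
  assumes g: "g \<in> carrier (tree_aut d)" and h: "h \<in> carrier (tree_aut d)"
  shows "trunc n g = trunc n h \<longleftrightarrow> g \<odot> tree_inv h \<in> St d n"
proof -
  let ?k = "g \<odot> tree_inv h"
  have k: "?k \<in> carrier (tree_aut d)" and gk: "g = ?k \<odot> h" using g h by (auto simp: T.m_assoc)
  show ?thesis
  proof
    assume eq: "trunc n g = trunc n h"
    have "act ?k w = w" if w: "w \<in> level d n" for w
    proof -
      define v where "v = act (tree_inv h) w"
      have v: "v \<in> level d n" using w h by (simp add: v_def level_iff act_in_words)
      have "act h v = act (h \<odot> tree_inv h) w" by (simp only: act_mult v_def)
      then have hv: "act h v = w" using h by (simp add: one_tree_aut)
      have "act g v = act h v" using eq v by (intro act_cong) (auto simp: trunc_eq_iff level_iff)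
      then show "act ?k w = w" using hv by (simp add: act_mult v_def)
    qed
    then show "?k \<in> St d n" using k by (simp add: St_def)
  next
    assume kSt: "?k \<in> St d n"
    have "g u = h u" if "u \<in> words d" "length u < n" for u
    proof -
      have "g u = ?k (act h u) \<circ> h u" by (subst gk) (simp only: mult_tree_aut)
      moreover have "act h u \<in> words d" using that h by (simp add: act_in_words)
      ultimately show ?thesis using kSt that by (simp add: St_iff)
    qed
    then show "trunc n g = trunc n h" by (simp add: trunc_eq_iff)
  qed
qed

lemma trunc_Suc_eq_iff:
  "trunc (Suc n) g = trunc (Suc n) h \<longleftrightarrow>
    g [] = h [] \<and> (\<forall>x<d. trunc n (sect [x] g) = trunc n (sect [x] h))"
  unfolding trunc_eq_iff
proof safe
  fix x u assume a: "g [] = h []" "\<forall>x<d. \<forall>u\<in>words d. length u < n \<longrightarrow> sect [x] g u = sect [x] h u"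
    and u: "u \<in> words d" "length u < Suc n"
  show "g u = h u" using a u by (cases u) (auto simp: sect_apply)
qed (auto simp: sect_apply)

text \<open>The number of vertices above level \<open>n\<close>, in a form suited to induction.\<close>

definition geom :: "nat \<Rightarrow> nat" where
  "geom n = (\<Sum>i<n. d ^ i)"

lemma geom_0 [simp]: "geom 0 = 0"
  by (simp add: geom_def)

lemma geom_Suc: "geom (Suc n) = geom n + d ^ n"
  by (simp add: geom_def)

lemma geom_mult: "(d - 1) * geom n + 1 = d ^ n"
proof (induction n)
  case (Suc n)
  have "(d - 1) * geom (Suc n) + 1 = ((d - 1) * geom n + 1) + (d - 1) * d ^ n"
    by (simp add: geom_Suc algebra_simps)
  also have "\<dots> = d ^ n + (d - 1) * d ^ n" by (simp only: Suc.IH)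
  also have "\<dots> = (1 + (d - 1)) * d ^ n" by (simp only: add_mult_distrib mult_1)
  also have "1 + (d - 1) = d" using d_pos by simp
  finally show ?case by simp
qed simp

lemma geom_Suc': "geom (Suc n) = Suc (d * geom n)"
proof -
  have "d * geom n = geom n + (d - 1) * geom n" using d_pos by (cases d) auto
  then show ?thesis using geom_mult[of n] by (simp add: geom_Suc)
qed

lemma geom_eq: "geom n = (d ^ n - 1) div (d - 1)"
proof -
  have "d ^ n - 1 = (d - 1) * geom n" using geom_mult[of n] by simp
  then show ?thesis using d_ge_3 by simp
qed

text \<open>If membership in \<open>G\<close> depends only on the root label and on an invariant \<open>\<epsilon>\<close> of the sections, and if every
  value of \<open>\<epsilon>\<close> arises from the same number \<open>k\<close> of local configurations in \<open>C\<close>, then a class at level \<open>n + 1\<close>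
  is a local configuration together with \<open>d\<close> independent classes at level \<open>n\<close>. This is applied to \<open>D\<close> with the
  parities of the letters and to its closure with the sign of the root label.\<close>

lemma count_levels:
  fixes q :: "nat \<Rightarrow> portrait \<Rightarrow> 'q" and \<epsilon> :: "portrait \<Rightarrow> 'e"
  assumes Gc: "G \<subseteq> carrier (tree_aut d)"
    and Gs: "\<And>g x. g \<in> G \<Longrightarrow> x < d \<Longrightarrow> sect [x] g \<in> G"
    and glue: "\<And>p h. (\<And>x. x < d \<Longrightarrow> h x \<in> G) \<Longrightarrow>
      glue d p h \<in> G \<longleftrightarrow> (p, \<lambda>x\<in>{..<d}. \<epsilon> (h x)) \<in> C"
    and C: "\<And>p s. (p, s) \<in> C \<Longrightarrow> s \<in> {..<d} \<rightarrow>\<^sub>E W" "finite C"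
    and eps: "\<And>g. g \<in> G \<Longrightarrow> \<epsilon> g = F (g [], \<lambda>x\<in>{..<d}. \<epsilon> (sect [x] g))"
    and k: "\<And>w. w \<in> W \<Longrightarrow> card {c \<in> C. F c = w} = k"
    and q0: "\<And>w. w \<in> W \<Longrightarrow> card (q 0 ` {g \<in> G. \<epsilon> g = w}) = base \<and> finite (q 0 ` {g \<in> G. \<epsilon> g = w})"
    and q0_eps: "\<And>g h. g \<in> G \<Longrightarrow> h \<in> G \<Longrightarrow> q 0 g = q 0 h \<Longrightarrow> \<epsilon> g = \<epsilon> h"
    and qS: "\<And>n g h. g \<in> G \<Longrightarrow> h \<in> G \<Longrightarrow> q (Suc n) g = q (Suc n) h \<longleftrightarrow>
      g [] = h [] \<and> (\<forall>x<d. q n (sect [x] g) = q n (sect [x] h))"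
  shows count_levels_fibre: "w \<in> W \<Longrightarrow> card (q n ` {g \<in> G. \<epsilon> g = w}) = base ^ (d ^ n) * k ^ geom n \<and>
      finite (q n ` {g \<in> G. \<epsilon> g = w})"
    and count_levels_total: "finite W \<Longrightarrow> \<epsilon> ` G \<subseteq> W \<Longrightarrow>
      card (q n ` G) = card W * (base ^ (d ^ n) * k ^ geom n) \<and> finite (q n ` G)"
proof -
  let ?X = "{..<d}"
  have q_eps: "q n g = q n h \<Longrightarrow> \<epsilon> g = \<epsilon> h" if "g \<in> G" "h \<in> G" for n g h
    using that
  proof (induction n arbitrary: g h)
    case 0
    then show ?case using q0_eps by blast
  next
    case (Suc n)
    have "\<epsilon> (sect [x] g) = \<epsilon> (sect [x] h)" if "x < d" for x
      using Suc that Gs qS[OF Suc.prems(2,3)] by blast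
    then have "(\<lambda>x\<in>?X. \<epsilon> (sect [x] g)) = (\<lambda>x\<in>?X. \<epsilon> (sect [x] h))" by (intro restrict_ext) simp
    moreover have "g [] = h []" using Suc.prems qS by blast
    ultimately show ?case using eps[OF Suc.prems(2)] eps[OF Suc.prems(3)] by simp
  qed
  have fib: "card (q n ` {g \<in> G. \<epsilon> g = w}) = base ^ (d ^ n) * k ^ geom n \<and>
      finite (q n ` {g \<in> G. \<epsilon> g = w})" if "w \<in> W" for n w
    using that
  proof (induction n arbitrary: w)
    case 0
    then show ?case using q0 by simp
  next
    case (Suc n)
    define N where "N = base ^ (d ^ n) * k ^ geom n"
    define Q where "Q = (\<lambda>w. q n ` {g \<in> G. \<epsilon> g = w})"
    have Q: "w \<in> W \<Longrightarrow> card (Q w) = N \<and> finite (Q w)" for w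
      using Suc.IH by (simp add: Q_def N_def)
    have Q_disj: "Q v \<inter> Q w = {}" if "v \<noteq> w" for v w
    proof (rule equals0I)
      fix y assume "y \<in> Q v \<inter> Q w"
      then have "y \<in> Q v" "y \<in> Q w" by blast+
      then obtain g h where gh: "g \<in> G" "\<epsilon> g = v" "y = q n g" "h \<in> G" "\<epsilon> h = w" "y = q n h"
        unfolding Q_def by blast
      then have "\<epsilon> g = \<epsilon> h" using q_eps[of g h n] by simp
      then show False using gh that by simp
    qed
    define J where "J = (\<lambda>g. (g [], \<lambda>x\<in>?X. q n (sect [x] g)))"
    define E where "E = (\<lambda>c :: (nat \<Rightarrow> nat) \<times> (nat \<Rightarrow> 'e). {fst c} \<times> (\<Pi>\<^sub>E x\<in>?X. Q (snd c x)))"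
    let ?Gw = "{g \<in> G. \<epsilon> g = w}" and ?Cw = "{c \<in> C. F c = w}"
    have J: "J g = J h \<longleftrightarrow> q (Suc n) g = q (Suc n) h" if "g \<in> ?Gw" "h \<in> ?Gw" for g h
    proof -
      have "(\<lambda>x\<in>?X. q n (sect [x] g)) = (\<lambda>x\<in>?X. q n (sect [x] h)) \<longleftrightarrow>
          (\<forall>x<d. q n (sect [x] g) = q n (sect [x] h))"
        by (auto simp: fun_eq_iff restrict_def)
      then show ?thesis using that qS by (simp add: J_def)
    qed
    have "J ` ?Gw = (\<Union>c\<in>?Cw. E c)"
    proof
      show "J ` ?Gw \<subseteq> (\<Union>c\<in>?Cw. E c)"
      proof
        fix y assume "y \<in> J ` ?Gw"
        then obtain g where g: "g \<in> G" "\<epsilon> g = w" "y = J g" by blast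
        let ?c = "(g [], \<lambda>x\<in>?X. \<epsilon> (sect [x] g))"
        have "glue d (g []) (\<lambda>x. sect [x] g) = g"
          by (rule glue_sections) (use g Gc in auto)
        then have "?c \<in> C" using glue[of "\<lambda>x. sect [x] g" "g []"] Gs[OF g(1)] g(1) by simp
        moreover have "F ?c = w" using eps g by simp
        moreover have "y \<in> E ?c" using g Gs by (auto simp: E_def J_def Q_def)
        ultimately show "y \<in> (\<Union>c\<in>?Cw. E c)" by blast
      qed
      show "(\<Union>c\<in>?Cw. E c) \<subseteq> J ` ?Gw"
      proof
        fix y assume "y \<in> (\<Union>c\<in>?Cw. E c)"
        then obtain p s f where c: "(p, s) \<in> C" "F (p, s) = w" and y: "y = (p, f)"
          and f: "f \<in> (\<Pi>\<^sub>E x\<in>?X. Q (s x))" by (auto simp: E_def)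
        have "\<exists>h\<in>G. \<epsilon> h = s x \<and> q n h = f x" if "x < d" for x
        proof -
          have "f x \<in> Q (s x)" using f that by (auto simp: PiE_iff)
          then show ?thesis by (auto simp: Q_def)
        qed
        then obtain h where h: "\<And>x. x < d \<Longrightarrow> h x \<in> G" "\<And>x. x < d \<Longrightarrow> \<epsilon> (h x) = s x"
          "\<And>x. x < d \<Longrightarrow> q n (h x) = f x" by metis
        have s: "(\<lambda>x\<in>?X. \<epsilon> (h x)) = s"
          using C(1)[OF c(1)] h(2) by (auto simp: PiE_iff extensional_def fun_eq_iff)
        have fr: "(\<lambda>x\<in>?X. q n (h x)) = f"
          using f h(3) by (auto simp: PiE_iff extensional_def fun_eq_iff)
        have gG: "glue d p h \<in> G" using glue[OF h(1)] c s by simp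
        have sec: "(\<lambda>x\<in>?X. \<epsilon> (sect [x] (glue d p h))) = s" "(\<lambda>x\<in>?X. q n (sect [x] (glue d p h))) = f"
          using s fr by (auto intro!: restrict_ext simp flip: s fr)
        have "\<epsilon> (glue d p h) = w" using eps[OF gG] c sec by simp
        moreover have "J (glue d p h) = y" using sec y by (simp add: J_def)
        ultimately show "y \<in> J ` ?Gw" using gG by blast
      qed
    qed
    moreover have "card (\<Union>c\<in>?Cw. E c) = (\<Sum>c\<in>?Cw. card (E c))"
    proof (rule card_UN_disjoint)
      show "finite ?Cw" using C(2) by simp
      show "\<forall>c\<in>?Cw. finite (E c)"
      proof
        fix c assume c: "c \<in> ?Cw"
        then have "snd c \<in> ?X \<rightarrow>\<^sub>E W" using C(1)[of "fst c" "snd c"] by simp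
        then have "finite (Q (snd c x))" if "x \<in> ?X" for x using Q that by (auto simp: PiE_iff)
        then show "finite (E c)" unfolding E_def by (intro finite_cartesian_product finite_PiE) auto
      qed
      show "\<forall>c\<in>?Cw. \<forall>c'\<in>?Cw. c \<noteq> c' \<longrightarrow> E c \<inter> E c' = {}"
      proof (intro ballI impI)
        fix c c' assume c: "c \<in> ?Cw" "c' \<in> ?Cw" "c \<noteq> c'"
        have sc: "snd c \<in> ?X \<rightarrow>\<^sub>E W" "snd c' \<in> ?X \<rightarrow>\<^sub>E W"
          using C(1)[of "fst c" "snd c"] C(1)[of "fst c'" "snd c'"] c by auto
        show "E c \<inter> E c' = {}"
        proof (cases "fst c = fst c'")
          case False
          then show ?thesis by (auto simp: E_def)
        next
          case True
          then have "snd c \<noteq> snd c'" using c(3) by (simp add: prod_eq_iff)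
          then obtain x where x: "x \<in> ?X" "snd c x \<noteq> snd c' x"
            using PiE_ext[OF sc] by blast
          then show ?thesis using Q_disj[OF x(2)] by (auto simp: E_def PiE_iff)
        qed
      qed
    qed
    moreover have "(\<Sum>c\<in>?Cw. card (E c)) = k * N ^ d"
    proof -
      have "card (E c) = N ^ d" if "c \<in> ?Cw" for c
      proof -
        have "snd c \<in> ?X \<rightarrow>\<^sub>E W" using C(1)[of "fst c" "snd c"] that by simp
        then have "card (Q (snd c x)) = N" if "x \<in> ?X" for x using Q that by (auto simp: PiE_iff)
        then show ?thesis by (simp add: E_def card_cartesian_product card_PiE)
      qed
      then show ?thesis using k[OF Suc.prems] by simp
    qed
    moreover have "finite (\<Union>c\<in>?Cw. E c)"
    proof (rule finite_UN_I)
      show "finite ?Cw" using C(2) by simp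
      fix c assume c: "c \<in> ?Cw"
      then have "snd c \<in> ?X \<rightarrow>\<^sub>E W" using C(1)[of "fst c" "snd c"] by simp
      then have "finite (Q (snd c x))" if "x \<in> ?X" for x using Q that by (auto simp: PiE_iff)
      then show "finite (E c)" unfolding E_def by (intro finite_cartesian_product finite_PiE) auto
    qed
    moreover have "base ^ (d ^ Suc n) * k ^ geom (Suc n) = k * N ^ d"
      by (simp add: N_def geom_Suc' power_mult_distrib mult.commute power_mult[symmetric])
    ultimately show ?case
      using card_image_same_kernel[of ?Gw J "q (Suc n)", OF J] by simp
  qed
  then show "w \<in> W \<Longrightarrow> card (q n ` {g \<in> G. \<epsilon> g = w}) = base ^ (d ^ n) * k ^ geom n \<and>
      finite (q n ` {g \<in> G. \<epsilon> g = w})" by blast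
  assume W: "finite W" "\<epsilon> ` G \<subseteq> W"
  have "q n ` G = (\<Union>w\<in>W. q n ` {g \<in> G. \<epsilon> g = w})" using W by blast
  moreover have "card (\<Union>w\<in>W. q n ` {g \<in> G. \<epsilon> g = w}) = (\<Sum>w\<in>W. card (q n ` {g \<in> G. \<epsilon> g = w}))"
  proof (rule card_UN_disjoint[OF W(1)])
    show "\<forall>w\<in>W. finite (q n ` {g \<in> G. \<epsilon> g = w})" using fib by blast
    show "\<forall>v\<in>W. \<forall>w\<in>W. v \<noteq> w \<longrightarrow> q n ` {g \<in> G. \<epsilon> g = v} \<inter> q n ` {g \<in> G. \<epsilon> g = w} = {}"
    proof (intro ballI impI equals0I)
      fix v w y assume "v \<noteq> w" and y: "y \<in> q n ` {g \<in> G. \<epsilon> g = v} \<inter> q n ` {g \<in> G. \<epsilon> g = w}"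
      have "y \<in> q n ` {g \<in> G. \<epsilon> g = v}" "y \<in> q n ` {g \<in> G. \<epsilon> g = w}" using y by blast+
      then obtain g h where gh: "g \<in> G" "\<epsilon> g = v" "y = q n g" "h \<in> G" "\<epsilon> h = w" "y = q n h" by blast
      then have "\<epsilon> g = \<epsilon> h" using q_eps[of g h n] by simp
      then show False using gh \<open>v \<noteq> w\<close> by simp
    qed
  qed
  moreover have "finite (\<Union>w\<in>W. q n ` {g \<in> G. \<epsilon> g = w})"
    using W(1) fib by blast
  ultimately show "card (q n ` G) = card W * (base ^ (d ^ n) * k ^ geom n) \<and> finite (q n ` G)"
    using fib by simp
qed

section \<open>The rigid level stabilizers and their indices\<close>

lemma par_supported: "g \<in> D \<Longrightarrow> par g \<in> supported {..<d}"
  by (simp add: supported_def par_outside)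

lemma par_onto:
  assumes "v \<in> supported {..<d}"
  shows "\<exists>g\<in>D. par g = v"
proof -
  have "\<exists>g\<in>D. par g = (\<lambda>i. if i < n then v i else 0)" for n
  proof (induction n)
    case 0
    show ?case using one_in_D by (intro bexI[of _ idp]) (simp_all add: par_one)
  next
    case (Suc n)
    then obtain g where g: "g \<in> D" "par g = (\<lambda>i. if i < n then v i else 0)" by blast
    show ?case
    proof (cases "v n = 1 \<and> n < d")
      case True
      have "par (g \<odot> gen_a d n) = (\<lambda>i. if i < Suc n then v i else 0)"
        using g True by (auto simp: par_mult gen_in_D par_gen fun_eq_iff less_Suc_eq)
      then show ?thesis using g True D_mult gen_in_D by blast
    next
      case False
      then have "v n = 0" using assms by (auto simp: supported_def)
      then have "par g = (\<lambda>i. if i < Suc n then v i else 0)"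
        using g(2) by (auto simp: fun_eq_iff less_Suc_eq)
      then show ?thesis using g by blast
    qed
  qed
  from this[of d] show ?thesis
    using assms by (auto simp: supported_def fun_eq_iff) (metis linorder_not_less)
qed

text \<open>As \<open>d\<close> is odd, every rotation is the square of a rotation, hence the root of a square in \<open>D\<close>.\<close>

lemma rotation_in_D':
  assumes "r \<in> rotations d"
  obtains t where "t \<in> D'" "t [] = r"
proof -
  obtain z where z: "r = aff 1 z" using assms by (auto simp: rotations_eq)
  obtain m where m: "d = 2 * m + 1" using odd_d by (auto elim: oddE)
  let ?p = "aff 1 (z * (int m + 1))"
  have p: "?p \<in> dih" by (simp add: aff_in_dih)
  have "?p \<circ> ?p = aff 1 (z * (int m + 1) + z * (int m + 1))" by (simp add: aff_comp)
  also have "\<dots> = r" unfolding z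
  proof (rule aff_cong_shift)
    have "z * (int m + 1) + z * (int m + 1) - z = int d * z" by (simp add: m algebra_simps)
    then show "int d dvd z * (int m + 1) + z * (int m + 1) - z" by simp
  qed
  finally have pp: "?p \<circ> ?p = r" .
  let ?t = "path_to ?p \<odot> path_to ?p"
  have "?t \<in> D'" using path_to[OF p] by (simp add: D'_def D_mult par_mult)
  moreover have "?t [] = r" using path_to[OF p] pp by (simp add: root_mult del: o_apply)
  ultimately show ?thesis using that by blast
qed

lemma root_and_par_onto:
  assumes "p \<in> dih" "v \<in> supported {..<d}" "mir p = (\<Sum>i<d. v i)"
  shows "\<exists>g\<in>D. g [] = p \<and> par g = v"
proof -
  obtain g where g: "g \<in> D" "par g = v" using par_onto assms by blast
  have gd: "g [] \<in> dih" using g root_in_dih by blast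
  then obtain q where q: "q \<in> dih" "q \<circ> g [] = id" using dih_left_inverse by blast
  have "mir q + mir (g []) = 0" using mir_comp[OF q(1) gd] q(2) by simp
  moreover have "mir (g []) = mir p" using mir_root[OF g(1)] g assms by simp
  ultimately have "mir (p \<circ> q) = 0" using mir_comp[OF assms(1) q(1)] by (simp add: add.commute)
  then obtain t where t: "t \<in> D'" "t [] = p \<circ> q"
    using rotation_in_D' mir_eq_0_iff dih_comp assms(1) q(1) by metis
  have "(t \<odot> g) [] = p" using t q by (simp add: root_mult comp_assoc del: o_apply)
  moreover have "par (t \<odot> g) = v" using t g by (simp add: D'_iff par_mult)
  ultimately show ?thesis using t g D_mult D'_iff by blast
qed

text \<open>The root labels and section parities of the elements of \<open>D\<close>.\<close>

definition local_conf :: "((nat \<Rightarrow> nat) \<times> (nat \<Rightarrow> nat \<Rightarrow> bit)) set" where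
  "local_conf = {(p, s). p \<in> dih \<and> s \<in> {..<d} \<rightarrow>\<^sub>E supported {..<d} \<and>
     (\<forall>q\<in>dih. bnd s q = of_bool (q = id) + of_bool (q = p))}"

lemma finite_local_conf: "finite local_conf"
proof (rule finite_subset)
  show "local_conf \<subseteq> dih \<times> ({..<d} \<rightarrow>\<^sub>E supported {..<d})" by (auto simp: local_conf_def)
  show "finite (dih \<times> ({..<d} \<rightarrow>\<^sub>E supported {..<d} :: (nat \<Rightarrow> nat \<Rightarrow> bit) set))"
    by (intro finite_cartesian_product finite_dih finite_PiE finite_supported) auto
qed

lemma bnd_cong: "(\<And>x. x < d \<Longrightarrow> M x = N x) \<Longrightarrow> bnd M p = bnd N p"
  by (auto simp: bnd_def intro: sum.cong)

lemma col_sums_cong: "(\<And>x. x < d \<Longrightarrow> M x = N x) \<Longrightarrow> col_sums M = col_sums N"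
  by (rule ext) (auto simp: col_sums_def intro: sum.cong)

text \<open>The sign of the root label is the sum of the parities \<open>w\<close>, which leaves \<open>d\<close> root labels. For each of them the
  matrices form a coset of the cycles with vanishing column sums.\<close>

lemma card_local_conf:
  assumes w: "w \<in> supported {..<d}"
  shows "card {c \<in> local_conf. col_sums (snd c) = w} = d * 2 ^ ((d - 1) * (d - 2))"
proof -
  let ?P = "{p \<in> dih. mir p = (\<Sum>i<d. w i)}" and ?K = "{M \<in> cycles. col_sums M = 0}"
  obtain \<gamma> where \<gamma>: "\<And>p. p \<in> ?P \<Longrightarrow> \<gamma> p \<in> D \<and> \<gamma> p [] = p \<and> par (\<gamma> p) = w"
    using root_and_par_onto[OF _ w] by (metis (mono_tags, lifting) mem_Collect_eq)
  define f where "f = (\<lambda>(p, M). (p, \<lambda>x\<in>{..<d}. (M + mat_of (\<gamma> p)) x))"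
  have "{c \<in> local_conf. col_sums (snd c) = w} = f ` (?P \<times> ?K)"
  proof
    show "{c \<in> local_conf. col_sums (snd c) = w} \<subseteq> f ` (?P \<times> ?K)"
    proof
      fix c assume c: "c \<in> {c \<in> local_conf. col_sums (snd c) = w}"
      obtain p s where cps: "c = (p, s)" by (cases c)
      have ps: "(p, s) \<in> local_conf" and cw: "col_sums s = w" using c cps by auto
      have p: "p \<in> dih" and s: "s \<in> {..<d} \<rightarrow>\<^sub>E supported {..<d}"
        and bs: "\<And>q. q \<in> dih \<Longrightarrow> bnd s q = of_bool (q = id) + of_bool (q = p)"
        using ps by (auto simp: local_conf_def)
      have s0: "s x i = 0" if "x < d" "i \<ge> d" for x i
        using s that by (auto simp: PiE_iff supported_def)
      obtain g where g: "g \<in> D" "g [] = p" "\<And>x i. x < d \<Longrightarrow> par (sect [x] g) i = s x i"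
        using realization[of s p] s0 p bs by blast
      have "mat_of g x = s x" if "x < d" for x using g(3)[OF that] that by (simp add: mat_of_def fun_eq_iff)
      then have "par g = w" using cw col_sums_mat_of[OF g(1)] col_sums_cong[of "mat_of g" s] by simp
      then have pP: "p \<in> ?P" using p mir_root[OF g(1)] g(2) by simp
      note gp = \<gamma>[OF pP]
      let ?M = "\<lambda>x. if x < d then s x + mat_of (\<gamma> p) x else 0"
      have "?M \<in> Mat"
        using s0 mat_of_in_Mat[of "\<gamma> p"] gp by (auto simp: Mat_def)
      moreover have "bnd ?M q = 0" if "q \<in> dih" for q
      proof -
        have "bnd ?M q = bnd (s + mat_of (\<gamma> p)) q" by (rule bnd_cong) simp
        then show ?thesis using bs that bnd_mat_of gp by (simp add: bnd_add)
      qed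
      moreover have "col_sums ?M = 0"
      proof -
        have "col_sums ?M = col_sums (s + mat_of (\<gamma> p))" by (rule col_sums_cong) simp
        then show ?thesis using cw gp col_sums_mat_of by (simp add: col_sums_add del: plus_fun_apply)
      qed
      ultimately have MK: "?M \<in> ?K" by (simp add: cycles_def)
      have "f (p, ?M) = (p, s)"
      proof -
        have "(\<lambda>x\<in>{..<d}. (?M + mat_of (\<gamma> p)) x) = s"
          using s by (auto simp: fun_eq_iff PiE_iff extensional_def add.assoc)
        then show ?thesis by (simp add: f_def)
      qed
      then show "c \<in> f ` (?P \<times> ?K)" using pP MK cps by (intro image_eqI[of _ _ "(p, ?M)"]) auto
    qed
    show "f ` (?P \<times> ?K) \<subseteq> {c \<in> local_conf. col_sums (snd c) = w}"
    proof
      fix c assume "c \<in> f ` (?P \<times> ?K)"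
      then obtain p M where c: "c = f (p, M)" and p: "p \<in> dih" "mir p = (\<Sum>i<d. w i)"
        and M: "M \<in> cycles" "col_sums M = 0" by auto
      note gp = \<gamma>[of p]
      let ?s = "\<lambda>x\<in>{..<d}. (M + mat_of (\<gamma> p)) x"
      have MN: "M + mat_of (\<gamma> p) \<in> Mat" using M gp p mat_of_in_Mat by (intro Mat_add) (auto simp: cycles_def)
      then have "?s \<in> {..<d} \<rightarrow>\<^sub>E supported {..<d}"
        by (auto simp: supported_def Mat_def simp del: plus_fun_apply)
      moreover have "bnd ?s q = of_bool (q = id) + of_bool (q = p)" if "q \<in> dih" for q
      proof -
        have "bnd ?s q = bnd (M + mat_of (\<gamma> p)) q" by (rule bnd_cong) simp
        then show ?thesis using that M bnd_mat_of gp p by (simp add: bnd_add cycles_def)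
      qed
      moreover have "col_sums ?s = w"
      proof -
        have "col_sums ?s = col_sums (M + mat_of (\<gamma> p))" by (rule col_sums_cong) simp
        then show ?thesis using M gp p col_sums_mat_of by (simp add: col_sums_add del: plus_fun_apply)
      qed
      ultimately show "c \<in> {c \<in> local_conf. col_sums (snd c) = w}"
        using p by (simp add: c f_def local_conf_def del: plus_fun_apply)
    qed
  qed
  moreover have "inj_on f (?P \<times> ?K)"
  proof (rule inj_onI, clarify)
    fix p M p' M'
    assume M: "M \<in> cycles" "M' \<in> cycles" and eq: "f (p, M) = f (p', M')"
    have pp: "p = p'" using eq by (simp add: f_def)
    have "M x i = M' x i" for x i
    proof (cases "x < d")
      case True
      have "(\<lambda>x\<in>{..<d}. (M + mat_of (\<gamma> p)) x) x i = (\<lambda>x\<in>{..<d}. (M' + mat_of (\<gamma> p)) x) x i"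
        using eq pp by (simp add: f_def)
      then show ?thesis using True by simp
    next
      case False
      then show ?thesis using M by (simp add: cycles_def Mat_def)
    qed
    then show "p = p' \<and> M = M'" using pp by (simp add: fun_eq_iff)
  qed
  ultimately show ?thesis
    by (simp add: card_image card_cartesian_product card_dih_mir card_col_kernel del: One_nat_def)
qed

definition level_par :: "nat \<Rightarrow> portrait \<Rightarrow> nat list \<Rightarrow> nat \<Rightarrow> bit" where
  "level_par n g v = (if v \<in> level d n then par (sect v g) else 0)"

lemma level_par_eq_iff: "level_par n g = level_par n h \<longleftrightarrow> (\<forall>v\<in>level d n. par (sect v g) = par (sect v h))"
proof
  assume "level_par n g = level_par n h"
  then have "level_par n g v = level_par n h v" for v by simp
  then show "\<forall>v\<in>level d n. par (sect v g) = par (sect v h)" by (metis level_par_def)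
next
  assume a: "\<forall>v\<in>level d n. par (sect v g) = par (sect v h)"
  show "level_par n g = level_par n h" by (rule ext) (use a in \<open>simp add: level_par_def\<close>)
qed

lemma star_D'_iff: "g \<in> star d n D' \<longleftrightarrow> g \<in> D \<and> g \<in> St d n \<and> (\<forall>v\<in>level d n. par (sect v g) = (\<lambda>i. 0))"
proof
  assume g: "g \<in> star d n D'"
  then have "g \<in> D'" using star_D'_subset by blast
  then show "g \<in> D \<and> g \<in> St d n \<and> (\<forall>v\<in>level d n. par (sect v g) = (\<lambda>i. 0))"
    using g by (auto simp: star_eq[OF subgroup_D'] D'_iff)
next
  assume "g \<in> D \<and> g \<in> St d n \<and> (\<forall>v\<in>level d n. par (sect v g) = (\<lambda>i. 0))"
  then show "g \<in> star d n D'" by (auto simp: star_eq[OF subgroup_D'] D'_iff D_sect)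
qed

lemma subgroup_star: "subgroup (star d n D') (tree_aut d)"
proof -
  have "h \<in> D' \<Longrightarrow> h \<in> carrier (tree_aut d)" for h by (simp add: D'_iff D_carrier)
  then show ?thesis
    unfolding star_def by (intro T.generate_is_subgroup) (auto simp: level_iff delta_in_carrier)
qed

text \<open>The portrait above level \<open>n\<close> and the parities at level \<open>n\<close> are complete invariants of the cosets of
  \<open>star d n D'\<close>.\<close>

lemma level_data_eq_iff:
  assumes g: "g \<in> D" and h: "h \<in> D"
  shows "(trunc n g, level_par n g) = (trunc n h, level_par n h) \<longleftrightarrow> g \<odot> tree_inv h \<in> star d n D'"
proof -
  define k where "k = g \<odot> tree_inv h"
  have k: "k \<in> D" unfolding k_def using g h by (simp add: D_mult D_inv)
  have gk: "g = k \<odot> h" unfolding k_def using g h by (simp add: D_carrier T.m_assoc)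
  have "level_par n g = level_par n h \<longleftrightarrow> (\<forall>w\<in>level d n. par (sect w k) = (\<lambda>i. 0))"
  proof -
    have "par (sect v g) = (\<lambda>i. par (sect (act h v) k) i + par (sect v h) i)" for v
    proof -
      have "sect v g = sect (act h v) k \<odot> sect v h" by (subst gk) (rule sect_mult)
      then show ?thesis using par_mult[OF D_sect[OF k] D_sect[OF h]] by simp
    qed
    then have "par (sect v g) = par (sect v h) \<longleftrightarrow> par (sect (act h v) k) = (\<lambda>i. 0)" for v
      by (auto simp: fun_eq_iff)
    moreover have "w \<in> level d n \<Longrightarrow> \<exists>v\<in>level d n. w = act h v" for w
    proof -
      assume w: "w \<in> level d n"
      have "act (h \<odot> tree_inv h) w = w" using h by (simp add: D_carrier one_tree_aut)
      then have "act h (act (tree_inv h) w) = w" by (simp only: act_mult)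
      moreover have "act (tree_inv h) w \<in> level d n"
        using w h by (simp add: level_iff act_in_words D_carrier)
      ultimately show ?thesis by metis
    qed
    moreover have "v \<in> level d n \<Longrightarrow> act h v \<in> level d n" for v
      using h by (simp add: level_iff act_in_words D_carrier)
    ultimately show ?thesis unfolding level_par_eq_iff by metis
  qed
  then show ?thesis
    using k trunc_eq_iff_quotient[of g h n] g h by (auto simp: star_D'_iff D_carrier simp flip: k_def)
qed

lemma level_par_Suc_eq_iff:
  "level_par (Suc n) g = level_par (Suc n) h \<longleftrightarrow> (\<forall>x<d. level_par n (sect [x] g) = level_par n (sect [x] h))"
  unfolding level_par_eq_iff by (auto simp: level_Suc sect_sect)

lemma count_D:
  fixes w :: "nat \<Rightarrow> bit" and n :: nat
  shows "w \<in> supported {..<d} \<Longrightarrow> card ((\<lambda>g. (trunc n g, level_par n g)) ` {g \<in> D. par g = w})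
      = (d * 2 ^ ((d - 1) * (d - 2))) ^ geom n"
    and "card ((\<lambda>g. (trunc n g, level_par n g)) ` D) = 2 ^ d * (d * 2 ^ ((d - 1) * (d - 2))) ^ geom n"
    and "finite ((\<lambda>g. (trunc n g, level_par n g)) ` D)"
proof -
  let ?q = "\<lambda>n g. (trunc n g, level_par n g)"
  have G: "D \<subseteq> carrier (tree_aut d)" using D_carrier by blast
  have S: "\<And>g x. g \<in> D \<Longrightarrow> x < d \<Longrightarrow> sect [x] g \<in> D" by (rule D_sect1)
  have glue: "glue d p h \<in> D \<longleftrightarrow> (p, \<lambda>x\<in>{..<d}. par (h x)) \<in> local_conf"
    if h: "\<And>x. x < d \<Longrightarrow> h x \<in> D" for p h
  proof -
    have "bnd (\<lambda>x\<in>{..<d}. par (h x)) q = bnd (\<lambda>x. par (h x)) q" for q by (rule bnd_cong) simp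
    moreover have "(\<lambda>x\<in>{..<d}. par (h x)) \<in> {..<d} \<rightarrow>\<^sub>E supported {..<d}"
      using h par_supported by auto
    ultimately show ?thesis using glue_in_D_iff[of h p] h by (simp add: local_conf_def)
  qed
  have C: "\<And>p s. (p, s) \<in> local_conf \<Longrightarrow> s \<in> {..<d} \<rightarrow>\<^sub>E supported {..<d}" by (simp add: local_conf_def)
  have eps: "par g = (\<lambda>c. col_sums (snd c)) (g [], \<lambda>x\<in>{..<d}. par (sect [x] g))" if "g \<in> D" for g
    using that by (simp add: fun_eq_iff col_sums_def) (use par_sum_sections in blast)
  have q0: "card (?q 0 ` {g \<in> D. par g = w}) = 1 \<and> finite (?q 0 ` {g \<in> D. par g = w})"
    if w: "w \<in> supported {..<d}" for w
  proof -
    obtain g where g: "g \<in> D" "par g = w" using par_onto[OF w] by blast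
    have "?q 0 h = ?q 0 g" if "par h = w" for h
      using g that by (simp add: trunc_eq_iff level_par_eq_iff)
    then have "?q 0 ` {g \<in> D. par g = w} = {?q 0 g}" using g by blast
    then show ?thesis by simp
  qed
  have q0e: "par g = par h" if "?q 0 g = ?q 0 h" for g h
    using that by (simp add: level_par_eq_iff)
  have qS: "?q (Suc n) g = ?q (Suc n) h \<longleftrightarrow> g [] = h [] \<and> (\<forall>x<d. ?q n (sect [x] g) = ?q n (sect [x] h))" for n g h
    by (auto simp: trunc_Suc_eq_iff level_par_Suc_eq_iff)
  note inst = count_levels_fibre[where G = D and C = local_conf and W = "supported {..<d}" and q = ?q
      and \<epsilon> = par and F = "\<lambda>c. col_sums (snd c)" and base = 1 and k = "d * 2 ^ ((d - 1) * (d - 2))"]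
    count_levels_total[where G = D and C = local_conf and W = "supported {..<d}" and q = ?q
      and \<epsilon> = par and F = "\<lambda>c. col_sums (snd c)" and base = 1 and k = "d * 2 ^ ((d - 1) * (d - 2))"]
  note count = inst[OF G S glue C finite_local_conf eps card_local_conf q0 q0e qS]
  show "w \<in> supported {..<d} \<Longrightarrow> card (?q n ` {g \<in> D. par g = w}) = (d * 2 ^ ((d - 1) * (d - 2))) ^ geom n"
    using count(1)[where w = w and n = n] by simp
  have "card (supported {..<d}) = 2 ^ d" by (simp add: card_supported)
  then show "card (?q n ` D) = 2 ^ d * (d * 2 ^ ((d - 1) * (d - 2))) ^ geom n" "finite (?q n ` D)"
    using count(2)[where n = n] par_supported by (auto simp: finite_supported image_subset_iff)
qed

lemma index_D_star:
  "index d D (star d n D') = 2 ^ ((d - 2) * d ^ n + 2) * d ^ ((d ^ n - 1) div (d - 1))"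
proof -
  obtain m where m: "d = m + 2" using d_ge_3 by (metis add_leD2 le_add_diff_inverse2 numeral_3_eq_3 numeral_2_eq_2 le_Suc_eq nat_le_linear)
  have "index d D (star d n D') = 2 ^ d * (d * 2 ^ ((d - 1) * (d - 2))) ^ geom n"
    using index_eq_card_image(1)[OF subgroup_star _ level_data_eq_iff, of D n] count_D(2)[of n] D_carrier
    by (simp add: subset_iff)
  also have "\<dots> = 2 ^ (d + (d - 2) * ((d - 1) * geom n)) * d ^ geom n"
    by (simp add: power_mult_distrib power_mult[symmetric] power_add mult_ac)
  also have "d + (d - 2) * ((d - 1) * geom n) = (d - 2) * ((d - 1) * geom n + 1) + 2"
    by (simp add: m)
  also have "(d - 1) * geom n + 1 = d ^ n" by (rule geom_mult)
  finally show ?thesis by (simp only: geom_eq)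
qed

lemma index_D'_star: "index d D' (star d 1 D') = d * 2 ^ ((d - 1) * (d - 2))"
proof -
  have D': "D' = {g \<in> D. par g = 0}" by (auto simp: D'_iff fun_eq_iff)
  have "index d D' (star d 1 D') = card ((\<lambda>g. (trunc 1 g, level_par 1 g)) ` D')"
    by (rule index_eq_card_image(1)[OF subgroup_star]) (auto simp: D'_iff D_carrier level_data_eq_iff simp del: prod.inject)
  also have "\<dots> = d * 2 ^ ((d - 1) * (d - 2))"
    using count_D(1)[of 0 1] unfolding D' by (simp add: supported_def geom_Suc)
  finally show ?thesis .
qed

text \<open>If only the row \<open>x\<close> of the matrix is nonzero, each entry of it is the boundary at some vertex, and the boundary
  is zero because the root label is trivial.\<close>

lemma delta_in_D_imp_D':
  assumes "delta [x] h \<in> D" "x < d"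
  shows "h \<in> D'"
proof -
  have h: "h \<in> D" using D_sect[OF assms(1), of "[x]"] sect_delta[of "[x]" h] by simp
  have "par h i = 0" if i: "i < d" for i
  proof -
    obtain p where p: "p \<in> dih" "p x = i" using dih_transitive[OF assms(2) i, of 0] by blast
    have "(\<Sum>y<d. par (sect [y] (delta [x] h)) (p y)) = (\<Sum>y<d. if x = y then par h (p x) else 0)"
      using sect_delta[of "[x]" h] sect_delta_other[of _ "[x]" h]
      by (intro sum.cong) (auto simp: par_one)
    moreover have "delta [x] h [] = id" using delta_single[OF assms(2), of h] by simp
    ultimately show ?thesis using boundary[OF assms(1) p(1)] assms(2) p by simp
  qed
  then have "par h i = 0" for i using par_outside[OF h] by (cases "i < d") auto
  then show ?thesis using h by (simp add: D'_def)
qed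

lemma delta_words_in_D_imp_D':
  assumes "delta v h \<in> D" "v \<in> words d" "v \<noteq> []"
  shows "h \<in> D'"
  using assms
proof (induction v)
  case (Cons x v)
  have "delta v h \<in> D'"
    using delta_append[of "[x]" v h] Cons.prems by (intro delta_in_D_imp_D'[of x]) auto
  then show ?case using Cons by (cases "v = []") (auto simp: D'_iff)
qed simp

text \<open>An element that fixes all vertices outside the subtree at \<open>v\<close> is of the form \<open>delta v h\<close>. On the path to \<open>v\<close>
  its labels fix all letters but possibly one, hence all.\<close>

lemma Rst_vertex_eq:
  assumes v: "v \<in> words d" "v \<noteq> []"
  shows "Rst_vertex d D v = delta v ` D'"
proof
  show "delta v ` D' \<subseteq> Rst_vertex d D v"
  proof clarify
    fix h assume h: "h \<in> D'"
    have "act (delta v h) w = w" if w: "w \<in> words d" "take (length v) w \<noteq> v" for w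
    proof -
        have "act (delta v h) w = act idp w"
          unfolding act_def
        proof (rule map_cong[OF refl])
          fix i assume i: "i \<in> set [0..<length w]"
          have "take (length v) (take i w) \<noteq> v"
          proof
            assume a: "take (length v) (take i w) = v"
            then have "length v \<le> i" using i by (metis length_take min.bounded_iff min.cobounded1 take_take)
            then show False using a w(2) by (simp add: min_absorb1)
          qed
          then show "delta v h (take i w) (w ! i) = idp (take i w) (w ! i)"
            by (simp add: delta_def idp_def)
        qed
        then show ?thesis by simp
    qed
    then show "delta v h \<in> Rst_vertex d D v"
      using delta_words_D'[OF h v(1)] by (simp add: Rst_vertex_def D'_iff)
  qed
  show "Rst_vertex d D v \<subseteq> delta v ` D'"
  proof
    fix g assume g: "g \<in> Rst_vertex d D v"
    then have gD: "g \<in> D" and fixes_out: "\<And>w. w \<in> words d \<Longrightarrow> take (length v) w \<noteq> v \<Longrightarrow> act g w = w"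
      by (auto simp: Rst_vertex_def)
    have "g u = id" if u: "u \<in> words d" "take (length v) u \<noteq> v" for u
    proof
      fix y
      show "g u y = id y"
      proof (cases "y < d")
        case False
        then show ?thesis using permutes_not_in[OF carrier_permutes[OF D_carrier[OF gD]]] by simp
      next
        case y: True
        show ?thesis
        proof (cases "take (length v) (u @ [y]) = v")
          case False
          then have "act g (u @ [y]) = u @ [y]" using fixes_out u y by simp
          then show ?thesis by (simp add: act_append sect_apply)
        next
          case True
          have others: "g u z = z" if "z < d" "z \<noteq> y" for z
          proof -
            have "take (length v) (u @ [z]) \<noteq> v"
            proof
              assume "take (length v) (u @ [z]) = v"
              then have "take (length v) (u @ [z]) = take (length v) (u @ [y])" using True by simp
              moreover have "length v > length u" using u(2) True by (auto simp: take_append split: if_splits) (metis not_less take_all_iff append_Nil2 diff_is_0_eq take_0 take_append)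
              ultimately show False using that by simp
            qed
            then have "act g (u @ [z]) = u @ [z]" using fixes_out u that by simp
            then show ?thesis by (simp add: act_append sect_apply)
          qed
          have inj: "g u a = g u b \<longleftrightarrow> a = b" for a b
            using permutes_inj[OF carrier_permutes[OF D_carrier[OF gD], of u]] by (metis injD)
          have "g u y < d" using carrier_less[OF D_carrier[OF gD]] y by blast
          then have "g u y = y" using others inj by metis
          then show ?thesis by simp
        qed
      qed
    qed
    then have dg: "delta v (sect v g) = g" using delta_sect[OF D_carrier[OF gD] v(1)] by blast
    then have "sect v g \<in> D'" using delta_words_in_D_imp_D'[OF _ v, of "sect v g"] gD by simp
    then show "g \<in> delta v ` D'" using dg by (metis imageI)
  qed
qed

lemma Rst_eq_star:
  assumes "n \<ge> 1"
  shows "Rst d D n = star d n D'"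
proof -
  have "Rst_vertex d D v = delta v ` D'" if "v \<in> level d n" for v
    using that assms by (intro Rst_vertex_eq) (auto simp: level_iff)
  then show ?thesis by (simp add: Rst_def star_def)
qed


section \<open>The closure\<close>

text \<open>The condition on patterns in terms of the sign character; see \<open>constrained_eq\<close>.\<close>

definition constrained :: "portrait set" where
  "constrained = {g \<in> carrier (tree_aut d). \<forall>u\<in>words d. g u \<in> dih \<and> mir (g u) = (\<Sum>x<d. mir (g (u @ [x])))}"

lemma constrained_carrier: "g \<in> constrained \<Longrightarrow> g \<in> carrier (tree_aut d)"
  by (simp add: constrained_def)

lemma constrained_dih: "g \<in> constrained \<Longrightarrow> u \<in> words d \<Longrightarrow> g u \<in> dih"
  by (simp add: constrained_def)

lemma constrained_mir: "g \<in> constrained \<Longrightarrow> u \<in> words d \<Longrightarrow> mir (g u) = (\<Sum>x<d. mir (g (u @ [x])))"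
  by (simp add: constrained_def)

lemma constrained_sect: "g \<in> constrained \<Longrightarrow> v \<in> words d \<Longrightarrow> sect v g \<in> constrained"
  by (simp add: constrained_def sect_in_carrier) (simp add: sect_apply)

lemma constrained_glue_iff:
  assumes h: "\<And>x. x < d \<Longrightarrow> h x \<in> constrained"
  shows "glue d p h \<in> constrained \<longleftrightarrow> p \<in> dih \<and> mir p = (\<Sum>x<d. mir (h x []))"
proof
  assume g: "glue d p h \<in> constrained"
  show "p \<in> dih \<and> mir p = (\<Sum>x<d. mir (h x []))"
    using constrained_dih[OF g, of "[]"] constrained_mir[OF g, of "[]"] by simp
next
  assume p: "p \<in> dih \<and> mir p = (\<Sum>x<d. mir (h x []))"
  have "glue d p h \<in> carrier (tree_aut d)"
    using p h by (intro glue_in_carrier) (auto simp: dih_permutes constrained_carrier)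
  moreover have "glue d p h u \<in> dih \<and> mir (glue d p h u) = (\<Sum>x<d. mir (glue d p h (u @ [x])))"
    if u: "u \<in> words d" for u
  proof (cases u)
    case Nil
    then show ?thesis using p by simp
  next
    case (Cons y v)
    then have "y < d" "v \<in> words d" using u by auto
    then show ?thesis using Cons constrained_dih[OF h] constrained_mir[OF h] by simp
  qed
  ultimately show "glue d p h \<in> constrained" by (simp add: constrained_def)
qed

lemma sum_act_reindex:
  assumes "p permutes {..<d}"
  shows "(\<Sum>x<d. f (p x)) = (\<Sum>x<d. f x :: bit)"
  using sum.permute[OF assms, of f] by (simp add: comp_def)

text \<open>The signs are multiplicative, and the sum over the children of a vertex is invariant under the permutation of
  the children by the first factor.\<close>

lemma subgroup_constrained: "subgroup constrained (tree_aut d)"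
proof (rule T.subgroupI)
  show "constrained \<subseteq> carrier (tree_aut d)" using constrained_carrier by blast
  have "idp \<in> constrained" by (simp add: constrained_def one_in_carrier idp_def id_in_dih del: id_apply)
  then show "constrained \<noteq> {}" by blast
next
  fix g assume g: "g \<in> constrained"
  have gc: "g \<in> carrier (tree_aut d)" using g constrained_carrier by blast
  have inv_label: "tree_inv g u \<in> dih \<and> mir (tree_inv g u) = mir (g (preimage g u))" if u: "u \<in> words d" for u
  proof -
    let ?v = "preimage g u"
    have av: "act g ?v = u" by (rule act_preimage) (rule carrier_permutes[OF gc])
    then have v: "?v \<in> words d" using u act_in_words[OF gc, of ?v] by simp
    have gv: "g ?v \<in> dih" using constrained_dih[OF g v] .
    have "(tree_inv g \<odot> g) ?v = id" using gc by (simp add: one_tree_aut idp_def)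
    then have inv: "tree_inv g u \<circ> g ?v = id" using av by (simp add: mult_tree_aut)
    obtain q where q: "q \<in> dih" "q \<circ> g ?v = id" "g ?v \<circ> q = id" using dih_left_inverse[OF gv] by blast
    have "tree_inv g u = tree_inv g u \<circ> (g ?v \<circ> q)" using q by simp
    also have "\<dots> = (tree_inv g u \<circ> g ?v) \<circ> q" by (simp only: comp_assoc)
    also have "\<dots> = q" using inv by simp
    finally have tq: "tree_inv g u = q" .
    have "mir q + mir (g ?v) = 0" using mir_comp[OF q(1) gv] q(2) by simp
    then show ?thesis using tq q(1) by (simp add: bit_add_eq_0_iff)
  qed
  have "mir (tree_inv g u) = (\<Sum>x<d. mir (tree_inv g (u @ [x])))" if u: "u \<in> words d" for u
  proof -
    let ?v = "preimage g u"
    have av: "act g ?v = u" by (rule act_preimage) (rule carrier_permutes[OF gc])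
    then have v: "?v \<in> words d" using u act_in_words[OF gc, of ?v] by simp
    have pre: "preimage g (u @ [g ?v x]) = ?v @ [x]" if "x < d" for x
    proof -
      have "act g (?v @ [x]) = u @ [g ?v x]" using av by (simp add: act_append sect_apply)
      then show ?thesis using preimage_act[of g d "?v @ [x]"] carrier_permutes[OF gc] by simp
    qed
    have "(\<Sum>x<d. mir (tree_inv g (u @ [x]))) = (\<Sum>x<d. mir (tree_inv g (u @ [g ?v x])))"
      using sum_act_reindex[OF carrier_permutes[OF gc, of ?v], of "\<lambda>x. mir (tree_inv g (u @ [x]))"] by simp
    also have "\<dots> = (\<Sum>x<d. mir (g (?v @ [x])))"
    proof (rule sum.cong[OF refl])
      fix x assume "x \<in> {..<d}"
      then have x: "x < d" by simp
      then have "g ?v x < d" using carrier_less[OF gc] by blast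
      then show "mir (tree_inv g (u @ [g ?v x])) = mir (g (?v @ [x]))"
        using inv_label[of "u @ [g ?v x]"] u pre[OF x] by simp
    qed
    also have "\<dots> = mir (g ?v)" using constrained_mir[OF g v] by simp
    finally show ?thesis using inv_label[OF u] by simp
  qed
  moreover have "tree_inv g \<in> carrier (tree_aut d)" using gc by simp
  ultimately show "tree_inv g \<in> constrained" using inv_label unfolding constrained_def by blast
next
  fix f g assume f: "f \<in> constrained" and g: "g \<in> constrained"
  have gc: "g \<in> carrier (tree_aut d)" using g constrained_carrier by blast
  have aw: "act g u \<in> words d" if "u \<in> words d" for u using that act_in_words[OF gc] by blast
  have lab: "(f \<odot> g) u = f (act g u) \<circ> g u" for u by (simp add: mult_tree_aut)
  have m: "mir ((f \<odot> g) u) = mir (f (act g u)) + mir (g u)" if "u \<in> words d" for u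
    unfolding lab by (rule mir_comp) (use that f g constrained_dih aw in auto)
  have "mir ((f \<odot> g) u) = (\<Sum>x<d. mir ((f \<odot> g) (u @ [x])))" if u: "u \<in> words d" for u
  proof -
    have "(\<Sum>x<d. mir ((f \<odot> g) (u @ [x]))) = (\<Sum>x<d. mir (f (act g u @ [g u x])) + mir (g (u @ [x])))"
      using u m by (intro sum.cong) (auto simp: act_append sect_apply)
    also have "\<dots> = (\<Sum>x<d. mir (f (act g u @ [x]))) + (\<Sum>x<d. mir (g (u @ [x])))"
      using sum_act_reindex[OF carrier_permutes[OF gc, of u], of "\<lambda>x. mir (f (act g u @ [x]))"]
      by (simp add: sum.distrib)
    also have "\<dots> = mir (f (act g u)) + mir (g u)"
      using constrained_mir[OF f aw[OF u]] constrained_mir[OF g u] by simp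
    finally show ?thesis using m[OF u] by simp
  qed
  moreover have "(f \<odot> g) u \<in> dih" if "u \<in> words d" for u
    unfolding lab by (rule dih_comp) (use that f g constrained_dih aw in auto)
  moreover have "f \<odot> g \<in> carrier (tree_aut d)"
    using f g constrained_carrier by (auto intro: mult_in_carrier)
  ultimately show "f \<odot> g \<in> constrained" unfolding constrained_def by blast
qed

lemma D_subset_constrained: "D \<subseteq> constrained"
proof
  fix g assume g: "g \<in> D"
  have "g u \<in> dih \<and> mir (g u) = (\<Sum>x<d. mir (g (u @ [x])))" for u
  proof -
    have su: "sect u g \<in> D" using D_sect[OF g] .
    have "mir (sect u g []) = (\<Sum>i<d. par (sect u g) i)" using mir_root[OF su] .
    also have "\<dots> = (\<Sum>i<d. \<Sum>x<d. par (sect [x] (sect u g)) i)"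
      using par_sum_sections[OF su] by simp
    also have "\<dots> = (\<Sum>x<d. \<Sum>i<d. par (sect [x] (sect u g)) i)" by (rule sum.swap)
    also have "\<dots> = (\<Sum>x<d. mir (sect [x] (sect u g) []))"
      using mir_root[OF D_sect1[OF su]] by simp
    finally show ?thesis using root_in_dih[OF su] by (simp add: sect_apply)
  qed
  then show "g \<in> constrained" using D_carrier[OF g] unfolding constrained_def by blast
qed

text \<open>By induction: \<open>w\<close> is the vector of column sums of a matrix in \<open>spaceA\<close>, and its rows, being even, are the
  parities of elements of the stabilizer of the preceding level.\<close>

lemma even_par_in_stabilizer:
  assumes "w \<in> even_vecs {..<d}"
  shows "\<exists>k\<in>D \<inter> St d n. par k = w"
  using assms
proof (induction n arbitrary: w)
  case 0
  then show ?case using par_onto[of w] D_carrier by (auto simp: even_vecs_def St_0)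
next
  case (Suc n)
  obtain M where M: "M \<in> spaceA" "col_sums M = w" using column_section Suc.prems by metis
  have "\<exists>k\<in>D \<inter> St d n. par k = M x" if "x < d" for x
  proof (rule Suc.IH)
    have "row_sums M x = 0" using M(1) by (simp add: spaceA_def)
    then show "M x \<in> even_vecs {..<d}"
      using M(1) by (auto simp: even_vecs_def supported_def row_sums_def spaceA_def cycles_def Mat_def)
  qed
  then obtain k where k: "\<And>x. x < d \<Longrightarrow> k x \<in> D \<and> k x \<in> St d n \<and> par (k x) = M x" by (metis IntE)
  have "bnd (\<lambda>x. par (k x)) q = bnd M q" for q by (rule bnd_cong) (simp add: k)
  then have D: "glue d id k \<in> D"
    using glue_in_D_iff[of k id] k M(1) by (simp add: id_in_dih spaceA_def cycles_def del: id_apply)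
  have "par (glue d id k) i = w i" for i
    using par_sum_sections[OF D] k M(2) by (auto simp: col_sums_def intro!: sum.cong)
  moreover have "glue d id k \<in> St d (Suc n)"
    using k D_carrier[OF D] by (simp add: St_Suc)
  ultimately show ?case using D by blast
qed

lemma cycles_row_section:
  assumes "v \<in> even_vecs {..<d}"
  shows "\<exists>N\<in>cycles. row_sums N = v"
proof -
  have "\<exists>s. (\<forall>v. s v \<in> cycles) \<and> (\<forall>v w. s (v + w) = s v + s w) \<and>
      (\<forall>v\<in>even_vecs {..<d}. row_sums (s v) = v)"
  proof (rule even_section[where base = 0])
    fix q assume "q \<in> {..<d}"
    then show "\<exists>M\<in>cycles. row_sums M = (\<lambda>i. of_bool (i = 0) + of_bool (i = q))"
      using row_sums_onto_pairs[of 0 q] d_pos by blast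
  qed (use d_pos in \<open>auto simp: zero_in_cycles cycles_add row_sums_add simp del: plus_fun_apply\<close>)
  then show ?thesis using assms by metis
qed

text \<open>Approximate the sections by elements \<open>h x\<close> of \<open>D\<close>. Their parities need not satisfy the boundary condition, but
  there is a chain with the right boundary whose row sums are the signs of the sections. The rows of this chain
  differ from the parities of the \<open>h x\<close> by even vectors, and these can be corrected without changing the upper
  levels by \<open>even_par_in_stabilizer\<close>.\<close>

lemma constrained_approximation:
  assumes "g \<in> constrained"
  shows "\<exists>h\<in>D. trunc n h = trunc n g"
  using assms
proof (induction n arbitrary: g)
  case 0
  then show ?case using one_in_D by (auto simp: trunc_eq_iff)
next
  case (Suc n)
  have g0: "g [] \<in> dih" using constrained_dih[OF Suc.prems] by simp
  show ?case
  proof (cases "n = 0")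
    case True
    then show ?thesis using root_onto[OF g0] by (auto simp: trunc_Suc_eq_iff trunc_eq_iff)
  next
    case False
    have "\<exists>h\<in>D. trunc n h = trunc n (sect [x] g)" if "x < d" for x
      by (rule Suc.IH, rule constrained_sect[OF Suc.prems]) (simp add: that)
    then obtain h where h: "\<And>x. x < d \<Longrightarrow> h x \<in> D \<and> trunc n (h x) = trunc n (sect [x] g)" by metis
    define s where "s = (\<lambda>x. if x < d then mir (g [x]) else 0)"
    have hroot: "h x [] = g [x]" if "x < d" for x
      using h[OF that] False by (auto simp: trunc_eq_iff sect_apply)
    let ?t = "path_to (g [])"
    have t: "?t \<in> D" "?t [] = g []" using path_to[OF g0] by auto
    have "s + row_sums (mat_of ?t) \<in> even_vecs {..<d}"
    proof -
      have "(\<Sum>x<d. s x) = mir (g [])" using constrained_mir[OF Suc.prems, of "[]"] by (simp add: s_def)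
      moreover have "(\<Sum>x<d. row_sums (mat_of ?t) x) = mir (g [])"
        using mir_root[OF t(1)] t(2) by (simp add: sum_col_sums[symmetric] col_sums_mat_of[OF t(1)])
      moreover have "s + row_sums (mat_of ?t) \<in> supported {..<d}"
        using row_sums_outside[OF mat_of_in_Mat[OF t(1)]] by (auto simp: supported_def s_def)
      ultimately show ?thesis by (simp add: even_vecs_def sum.distrib)
    qed
    then obtain N where N: "N \<in> cycles" "row_sums N = s + row_sums (mat_of ?t)"
      using cycles_row_section by metis
    define M where "M = N + mat_of ?t"
    have M: "M \<in> Mat" using N(1) mat_of_in_Mat[OF t(1)] unfolding M_def by (intro Mat_add) (simp_all add: cycles_def)
    have rowM: "row_sums M = s" unfolding M_def row_sums_add N(2) by (simp add: fun_eq_iff add.assoc)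
    have bM: "bnd M q = of_bool (q = id) + of_bool (q = g [])" if "q \<in> dih" for q
      using N(1) bnd_mat_of[OF t(1) that] t(2) that unfolding M_def bnd_add by (simp add: cycles_def)
    have "\<exists>k\<in>D \<inter> St d n. par k = par (h x) + M x" if x: "x < d" for x
    proof (rule even_par_in_stabilizer)
      have "(\<Sum>i<d. par (h x) i) = s x" using mir_root[of "h x"] h[OF x] hroot[OF x] x by (simp add: s_def)
      moreover have "(\<Sum>i<d. M x i) = s x" using rowM by (simp add: row_sums_def fun_eq_iff)
      moreover have "M x \<in> supported {..<d}" using M by (simp add: Mat_def supported_def)
      ultimately show "par (h x) + M x \<in> even_vecs {..<d}"
        using par_supported[of "h x"] h[OF x] supported_add
        by (simp add: even_vecs_def sum.distrib)
    qed
    then obtain k where k: "\<And>x. x < d \<Longrightarrow> k x \<in> D \<and> k x \<in> St d n \<and> par (k x) = par (h x) + M x"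
      by (metis IntE)
    let ?f = "\<lambda>x. h x \<odot> k x"
    have f: "?f x \<in> D" "par (?f x) = M x" if "x < d" for x
      using h[OF that] k[OF that] by (auto simp: D_mult par_mult fun_eq_iff simp flip: add.assoc)
    have "bnd (\<lambda>x. par (?f x)) q = bnd M q" for q by (rule bnd_cong) (simp add: f)
    then have gD: "glue d (g []) ?f \<in> D" using glue_in_D_iff[of ?f "g []"] f g0 bM by simp
    have "trunc n (?f x) = trunc n (sect [x] g)" if x: "x < d" for x
    proof -
      have kx: "k x \<in> St d n" "k x \<in> carrier (tree_aut d)" using k[OF x] D_carrier by auto
      have "(?f x) u = h x u" if u: "u \<in> words d" "length u < n" for u
        using kx u St_act[OF kx(1) u(1)] by (simp add: mult_tree_aut St_iff)
      then have "trunc n (?f x) = trunc n (h x)" by (simp add: trunc_eq_iff)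
      then show ?thesis using h[OF x] by simp
    qed
    then have "trunc (Suc n) (glue d (g []) ?f) = trunc (Suc n) g"
      by (simp add: trunc_Suc_eq_iff)
    then show ?thesis using gD by blast
  qed
qed

section \<open>Closures in the congruence topology\<close>

lemma in_lcoset_St_iff:
  assumes g: "g \<in> carrier (tree_aut d)"
  shows "f \<in> g <#\<^bsub>tree_aut d\<^esub> St d n \<longleftrightarrow> f \<in> carrier (tree_aut d) \<and> trunc n f = trunc n g"
proof
  assume "f \<in> g <#\<^bsub>tree_aut d\<^esub> St d n"
  then obtain s where s: "s \<in> St d n" "f = g \<odot> s" by (auto simp: l_coset_def)
  have "f u = g u" if "u \<in> words d" "length u < n" for u
    using s that St_act[OF s(1) that(1)] by (simp add: mult_tree_aut St_iff)
  then show "f \<in> carrier (tree_aut d) \<and> trunc n f = trunc n g"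
    using s g St_carrier mult_in_carrier by (auto simp: trunc_eq_iff)
next
  assume f: "f \<in> carrier (tree_aut d) \<and> trunc n f = trunc n g"
  have "act (tree_inv g \<odot> f) w = w" if w: "w \<in> level d n" for w
  proof -
    have "act f w = act g w" using f w by (intro act_cong) (auto simp: trunc_eq_iff level_iff)
    then have "act (tree_inv g \<odot> f) w = act (tree_inv g \<odot> g) w" by (simp only: act_mult)
    then show ?thesis using g by (simp add: one_tree_aut)
  qed
  then have "tree_inv g \<odot> f \<in> St d n" using f g by (simp add: St_def)
  moreover have "f = g \<odot> (tree_inv g \<odot> f)" using f g by (simp flip: T.m_assoc)
  ultimately show "f \<in> g <#\<^bsub>tree_aut d\<^esub> St d n" by (auto simp: l_coset_def)
qed

definition lcosets_St :: "portrait set set" where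
  "lcosets_St = {g <#\<^bsub>tree_aut d\<^esub> St d n | g n. g \<in> carrier (tree_aut d)}"

lemma open_contains_lcoset:
  assumes "generate_topology_on lcosets_St U" "x \<in> U"
  shows "x \<in> carrier (tree_aut d) \<and> (\<exists>n. x <#\<^bsub>tree_aut d\<^esub> St d n \<subseteq> U)"
  using assms
proof (induction)
  case Empty
  then show ?case by simp
next
  case (Int a b)
  then obtain m n where xc: "x \<in> carrier (tree_aut d)" and
    mn: "x <#\<^bsub>tree_aut d\<^esub> St d m \<subseteq> a" "x <#\<^bsub>tree_aut d\<^esub> St d n \<subseteq> b" by auto
  have "x <#\<^bsub>tree_aut d\<^esub> St d (max m n) \<subseteq> (x <#\<^bsub>tree_aut d\<^esub> St d m) \<inter> (x <#\<^bsub>tree_aut d\<^esub> St d n)"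
    by (auto simp: in_lcoset_St_iff[OF xc] trunc_eq_iff)
  then have "x <#\<^bsub>tree_aut d\<^esub> St d (max m n) \<subseteq> a \<inter> b" using mn by blast
  then show ?case using xc by blast
next
  case (UN K)
  then obtain k where "k \<in> K" "x \<in> k" by blast
  then show ?case using UN by blast
next
  case (Basis s)
  then obtain g n where g: "g \<in> carrier (tree_aut d)" "s = g <#\<^bsub>tree_aut d\<^esub> St d n"
    by (auto simp: lcosets_St_def)
  have x: "x \<in> carrier (tree_aut d)" "trunc n x = trunc n g"
    using Basis g in_lcoset_St_iff by blast+
  then have "x <#\<^bsub>tree_aut d\<^esub> St d n \<subseteq> s"
    using g in_lcoset_St_iff[OF x(1), of _ n] in_lcoset_St_iff[OF g(1), of _ n] by auto
  then show ?case using x by blast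
qed

text \<open>The left cosets of the level stabilizers form a basis of the topology, not only a subbasis
  (\<open>open_contains_lcoset\<close>).\<close>

lemma clos_iff:
  "g \<in> clos d S \<longleftrightarrow> g \<in> carrier (tree_aut d) \<and>
     (\<forall>n. \<exists>s\<in>S. s \<in> carrier (tree_aut d) \<and> trunc n s = trunc n g)"
proof -
  have top: "topspace (aut_topology d) = carrier (tree_aut d)"
  proof
    have "g \<in> g <#\<^bsub>tree_aut d\<^esub> St d 0" if "g \<in> carrier (tree_aut d)" for g
      using in_lcoset_St_iff[OF that] that by blast
    then show "carrier (tree_aut d) \<subseteq> topspace (aut_topology d)"
      unfolding aut_topology_def topology_generated_by_topspace by blast
    show "topspace (aut_topology d) \<subseteq> carrier (tree_aut d)"
      unfolding aut_topology_def topology_generated_by_topspace using in_lcoset_St_iff by blast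
  qed
  have op: "openin (aut_topology d) U \<longleftrightarrow> generate_topology_on lcosets_St U" for U
    by (simp add: aut_topology_def lcosets_St_def openin_topology_generated_by_iff)
  show ?thesis
  proof
    assume g: "g \<in> clos d S"
    then have gc: "g \<in> carrier (tree_aut d)" by (simp add: clos_def in_closure_of top)
    have "\<exists>s\<in>S. s \<in> carrier (tree_aut d) \<and> trunc n s = trunc n g" for n
    proof -
      have "openin (aut_topology d) (g <#\<^bsub>tree_aut d\<^esub> St d n)"
        unfolding op by (rule generate_topology_on.Basis) (use gc in \<open>auto simp: lcosets_St_def\<close>)
      moreover have "g \<in> g <#\<^bsub>tree_aut d\<^esub> St d n" using in_lcoset_St_iff[OF gc] gc by blast
      ultimately obtain s where "s \<in> S" "s \<in> g <#\<^bsub>tree_aut d\<^esub> St d n"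
        using g unfolding clos_def in_closure_of by blast
      then show ?thesis using in_lcoset_St_iff[OF gc] by blast
    qed
    then show "g \<in> carrier (tree_aut d) \<and> (\<forall>n. \<exists>s\<in>S. s \<in> carrier (tree_aut d) \<and> trunc n s = trunc n g)"
      using gc by blast
  next
    assume g: "g \<in> carrier (tree_aut d) \<and> (\<forall>n. \<exists>s\<in>S. s \<in> carrier (tree_aut d) \<and> trunc n s = trunc n g)"
    have "\<exists>s. s \<in> S \<and> s \<in> U" if "g \<in> U" "openin (aut_topology d) U" for U
    proof -
      have "generate_topology_on lcosets_St U" using that(2) by (simp only: op)
      from open_contains_lcoset[OF this that(1)]
      obtain n where n: "g <#\<^bsub>tree_aut d\<^esub> St d n \<subseteq> U" by (elim conjE exE)
      obtain s where s: "s \<in> S" "s \<in> carrier (tree_aut d)" "trunc n s = trunc n g" using g by blast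
      then have "s \<in> g <#\<^bsub>tree_aut d\<^esub> St d n" using in_lcoset_St_iff[of g s n] g by simp
      then show ?thesis using n s(1) by blast
    qed
    then show "g \<in> clos d S" unfolding clos_def in_closure_of top using g by blast
  qed
qed

lemma clos_D: "clos d D = constrained"
proof
  show "constrained \<subseteq> clos d D"
  proof
    fix g assume g: "g \<in> constrained"
    then show "g \<in> clos d D"
      using constrained_approximation[OF g] D_carrier constrained_carrier[OF g] unfolding clos_iff by blast
  qed
  show "clos d D \<subseteq> constrained"
  proof
    fix g assume g: "g \<in> clos d D"
    have "g u \<in> dih \<and> mir (g u) = (\<Sum>x<d. mir (g (u @ [x])))" if u: "u \<in> words d" for u
    proof -
      obtain h where h: "h \<in> D" "trunc (length u + 2) h = trunc (length u + 2) g"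
        using g unfolding clos_iff by blast
      have hg: "h v = g v" if "v \<in> words d" "length v < length u + 2" for v
        using h(2) that by (simp add: trunc_eq_iff)
      have hc: "h \<in> constrained" using h(1) D_subset_constrained by blast
      have "(\<Sum>x<d. mir (h (u @ [x]))) = (\<Sum>x<d. mir (g (u @ [x])))"
        using hg u by (intro sum.cong) auto
      then show ?thesis using constrained_dih[OF hc u] constrained_mir[OF hc u] hg[OF u] by simp
    qed
    then show "g \<in> constrained" using g unfolding constrained_def clos_iff by blast
  qed
qed

lemma clos_D_St: "clos d (D \<inter> St d n) = constrained \<inter> St d n"
proof
  show "clos d (D \<inter> St d n) \<subseteq> constrained \<inter> St d n"
  proof
    fix g assume g: "g \<in> clos d (D \<inter> St d n)"
    then have "g \<in> clos d D" unfolding clos_iff by blast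
    moreover obtain h where h: "h \<in> D \<inter> St d n" "trunc n h = trunc n g" using g unfolding clos_iff by blast
    have "g \<in> St d n" using h g by (simp add: St_iff trunc_eq_iff clos_iff)
    ultimately show "g \<in> constrained \<inter> St d n" by (simp add: clos_D)
  qed
  show "constrained \<inter> St d n \<subseteq> clos d (D \<inter> St d n)"
  proof
    fix g assume g: "g \<in> constrained \<inter> St d n"
    have "\<exists>s\<in>D \<inter> St d n. s \<in> carrier (tree_aut d) \<and> trunc m s = trunc m g" for m
    proof -
      obtain h where h: "h \<in> D" "trunc (max m n) h = trunc (max m n) g"
        using constrained_approximation[of g "max m n"] g by blast
      have "h \<in> St d n" "trunc m h = trunc m g"
        using h g D_carrier by (auto simp: St_iff trunc_eq_iff)
      then show ?thesis using h(1) D_carrier by blast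
    qed
    then show "g \<in> clos d (D \<inter> St d n)" using g constrained_carrier unfolding clos_iff by blast
  qed
qed

section \<open>The index and the dimension of the closure\<close>

lemma card_bit_functions:
  "card {s \<in> {..<d} \<rightarrow>\<^sub>E (UNIV :: bit set). (\<Sum>x<d. s x) = b} = 2 ^ (d - 1)"
proof -
  define c where "c = (\<lambda>x :: nat. if x = 0 then b else 0)"
  have c: "c \<in> supported {..<d}" "(\<Sum>x<d. c x) = b" using d_pos by (auto simp: c_def supported_def)
  let ?f = "\<lambda>v. restrict (c + v) {..<d}"
  have "{s \<in> {..<d} \<rightarrow>\<^sub>E (UNIV :: bit set). (\<Sum>x<d. s x) = b} = ?f ` even_vecs {..<d}"
  proof
    show "{s \<in> {..<d} \<rightarrow>\<^sub>E (UNIV :: bit set). (\<Sum>x<d. s x) = b} \<subseteq> ?f ` even_vecs {..<d}"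
    proof
      fix s assume s: "s \<in> {s \<in> {..<d} \<rightarrow>\<^sub>E (UNIV :: bit set). (\<Sum>x<d. s x) = b}"
      let ?v = "\<lambda>x. if x < d then c x + s x else 0"
      have "(\<Sum>x<d. ?v x) = (\<Sum>x<d. c x) + (\<Sum>x<d. s x)" by (simp add: sum.distrib)
      then have "?v \<in> even_vecs {..<d}" using s c by (simp add: even_vecs_def supported_def)
      moreover have "s = ?f ?v" using s by (auto simp: fun_eq_iff PiE_iff extensional_def simp flip: add.assoc)
      ultimately show "s \<in> ?f ` even_vecs {..<d}" by blast
    qed
    show "?f ` even_vecs {..<d} \<subseteq> {s \<in> {..<d} \<rightarrow>\<^sub>E (UNIV :: bit set). (\<Sum>x<d. s x) = b}"
      using c by (auto simp: even_vecs_def sum.distrib split: if_splits)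
  qed
  moreover have "inj_on ?f (even_vecs {..<d})"
  proof (rule inj_onI, rule ext)
    fix v w x assume vw: "v \<in> even_vecs {..<d}" "w \<in> even_vecs {..<d}" "?f v = ?f w"
    show "v x = w x"
    proof (cases "x < d")
      case True
      then show ?thesis using fun_cong[OF vw(3), of x] by simp
    next
      case False
      then show ?thesis using vw by (simp add: even_vecs_def supported_def)
    qed
  qed
  moreover have "{..<d} \<noteq> {}" using d_pos by auto
  ultimately show ?thesis using card_even_vecs[of "{..<d}"] by (simp add: card_image)
qed

definition sign_conf :: "((nat \<Rightarrow> nat) \<times> (nat \<Rightarrow> bit)) set" where
  "sign_conf = {(p, s). p \<in> dih \<and> s \<in> {..<d} \<rightarrow>\<^sub>E UNIV \<and> mir p = (\<Sum>x<d. s x)}"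

lemma finite_bit: "finite (UNIV :: bit set)" "card (UNIV :: bit set) = 2"
proof -
  have U: "(UNIV :: bit set) = {0, 1}" by (auto intro: bit.exhaust)
  show "finite (UNIV :: bit set)" by (rule finite_subset[of _ "{0, 1}"]) (simp_all add: U)
  have "card (UNIV :: bit set) = card {0, 1 :: bit}" by (rule arg_cong[OF U])
  then show "card (UNIV :: bit set) = 2" by simp
qed

lemma finite_sign_conf: "finite sign_conf"
proof (rule finite_subset)
  show "sign_conf \<subseteq> dih \<times> ({..<d} \<rightarrow>\<^sub>E UNIV)" by (auto simp: sign_conf_def)
  show "finite (dih \<times> ({..<d} \<rightarrow>\<^sub>E (UNIV :: bit set)))"
    by (intro finite_cartesian_product finite_dih finite_PiE finite_bit) auto
qed

lemma card_sign_conf: "card {c \<in> sign_conf. mir (fst c) = b} = d * 2 ^ (d - 1)"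
proof -
  have "{c \<in> sign_conf. mir (fst c) = b} =
      {p \<in> dih. mir p = b} \<times> {s \<in> {..<d} \<rightarrow>\<^sub>E UNIV. (\<Sum>x<d. s x) = b}"
  proof (rule Set.set_eqI)
    fix c :: "(nat \<Rightarrow> nat) \<times> (nat \<Rightarrow> bit)"
    show "c \<in> {c \<in> sign_conf. mir (fst c) = b} \<longleftrightarrow>
        c \<in> {p \<in> dih. mir p = b} \<times> {s \<in> {..<d} \<rightarrow>\<^sub>E UNIV. (\<Sum>x<d. s x) = b}"
      unfolding sign_conf_def mem_Times_iff mem_Collect_eq case_prod_beta by metis
  qed
  then show ?thesis by (simp only: card_cartesian_product card_dih_mir card_bit_functions)
qed

lemma constrained_root_onto:
  assumes "p \<in> dih"
  shows "\<exists>g\<in>constrained. g [] = p"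
  using root_onto[OF assms] D_subset_constrained by blast

lemma card_trunc_constrained:
  "card (trunc (Suc n) ` constrained) = 2 ^ (d ^ n) * d ^ geom (Suc n)"
  "finite (trunc (Suc n) ` constrained)"
proof -
  let ?q = "\<lambda>n. trunc (Suc n)"
  have G: "constrained \<subseteq> carrier (tree_aut d)" using constrained_carrier by blast
  have S: "\<And>g x. g \<in> constrained \<Longrightarrow> x < d \<Longrightarrow> sect [x] g \<in> constrained"
    by (rule constrained_sect) auto
  have glue: "glue d p h \<in> constrained \<longleftrightarrow> (p, \<lambda>x\<in>{..<d}. mir (h x [])) \<in> sign_conf"
    if "\<And>x. x < d \<Longrightarrow> h x \<in> constrained" for p h
    using constrained_glue_iff[of h p] that by (simp add: sign_conf_def)
  have C: "\<And>p s. (p, s) \<in> sign_conf \<Longrightarrow> s \<in> {..<d} \<rightarrow>\<^sub>E UNIV" by (simp add: sign_conf_def)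
  have eps: "mir (g []) = (\<lambda>c. mir (fst c)) (g [], \<lambda>x\<in>{..<d}. mir (sect [x] g []))" for g :: portrait
    by simp
  have q0: "card (?q 0 ` {g \<in> constrained. mir (g []) = b}) = d \<and>
      finite (?q 0 ` {g \<in> constrained. mir (g []) = b})" for b
  proof -
    have eq: "?q 0 g = ?q 0 h \<longleftrightarrow> g [] = h []" for g h by (simp add: trunc_eq_iff)
    have im: "(\<lambda>g. g []) ` {g \<in> constrained. mir (g []) = b} = {p \<in> dih. mir p = b}"
      using constrained_root_onto constrained_dih[of _ "[]"] by force
    have fin: "finite {p \<in> dih. mir p = b}" using finite_dih by simp
    show ?thesis
      using card_image_same_kernel[of "{g \<in> constrained. mir (g []) = b}" "?q 0" "\<lambda>g. g []", OF eq]
        fin card_dih_mir[of b] by (simp only: im)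
  qed
  have q0e: "mir (g []) = mir (h [])" if "?q 0 g = ?q 0 h" for g h
    using that by (simp add: trunc_Suc_eq_iff)
  note inst = count_levels_total[where G = constrained and C = sign_conf and W = UNIV and q = ?q
      and \<epsilon> = "\<lambda>g. mir (g [])" and F = "\<lambda>c. mir (fst c)" and base = d and k = "d * 2 ^ (d - 1)"]
  have "card (trunc (Suc n) ` constrained) = card (UNIV :: bit set) * (d ^ (d ^ n) * (d * 2 ^ (d - 1)) ^ geom n) \<and>
      finite (trunc (Suc n) ` constrained)"
  proof (rule inst)
    show "glue d p h \<in> constrained \<longleftrightarrow> (p, \<lambda>x\<in>{..<d}. mir (h x [])) \<in> sign_conf"
      if "\<And>x. x < d \<Longrightarrow> h x \<in> constrained" for p h using that by (rule glue)
    show "mir (g []) = mir (fst (g [], \<lambda>x\<in>{..<d}. mir (sect [x] g [])))" for g :: portrait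
      by simp
    show "trunc (Suc (Suc n)) g = trunc (Suc (Suc n)) h \<longleftrightarrow>
        g [] = h [] \<and> (\<forall>x<d. trunc (Suc n) (sect [x] g) = trunc (Suc n) (sect [x] h))" for n g h
      by (rule trunc_Suc_eq_iff)
    show "constrained \<subseteq> carrier (tree_aut d)" by (rule G)
    show "sect [x] g \<in> constrained" if "g \<in> constrained" "x < d" for g x using that by (rule S)
    show "s \<in> {..<d} \<rightarrow>\<^sub>E UNIV" if "(p, s) \<in> sign_conf" for p s using that by (rule C)
    show "finite sign_conf" by (rule finite_sign_conf)
    show "card {c \<in> sign_conf. mir (fst c) = w} = d * 2 ^ (d - 1)" for w by (rule card_sign_conf)
    show "card (trunc (Suc 0) ` {g \<in> constrained. mir (g []) = w}) = d \<and>
      finite (trunc (Suc 0) ` {g \<in> constrained. mir (g []) = w})" for w by (rule q0)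
    show "mir (g []) = mir (h [])" if "trunc (Suc 0) g = trunc (Suc 0) h" for g h
      using that by (rule q0e)
  qed (simp_all add: finite_bit)
  then have c: "card (trunc (Suc n) ` constrained) = 2 * (d ^ (d ^ n) * (d * 2 ^ (d - 1)) ^ geom n) \<and>
      finite (trunc (Suc n) ` constrained)"
    by (simp only: finite_bit)
  then have "card (trunc (Suc n) ` constrained) = 2 * (d ^ (d ^ n) * (d * 2 ^ (d - 1)) ^ geom n)" by blast
  also have "2 * (d ^ (d ^ n) * (d * 2 ^ (d - 1)) ^ geom n) = 2 ^ ((d - 1) * geom n + 1) * d ^ (geom n + d ^ n)"
    by (simp add: power_mult_distrib power_add power_mult[symmetric] mult_ac)
  finally show "card (trunc (Suc n) ` constrained) = 2 ^ (d ^ n) * d ^ geom (Suc n)"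
    by (simp only: geom_mult geom_Suc)
  show "finite (trunc (Suc n) ` constrained)" using c by blast
qed

lemma trunc_D_eq: "trunc n ` D = trunc n ` constrained"
proof
  show "trunc n ` constrained \<subseteq> trunc n ` D"
    using constrained_approximation by (metis (no_types, lifting) image_iff image_subsetI)
qed (use D_subset_constrained in blast)

lemma subgroup_Int_St: "subgroup G (tree_aut d) \<Longrightarrow> subgroup (G \<inter> St d n) (tree_aut d)"
  by (rule T.subgroups_Inter_pair) (rule subgroup_St | assumption)+

lemma index_St:
  assumes "subgroup G (tree_aut d)"
  shows "index d G (G \<inter> St d n) = card (trunc n ` G)"
    "finite (rcosets\<^bsub>subgrp d G\<^esub> (G \<inter> St d n)) \<longleftrightarrow> finite (trunc n ` G)"
proof -
  have "trunc n g = trunc n h \<longleftrightarrow> g \<odot> tree_inv h \<in> G \<inter> St d n" if "g \<in> G" "h \<in> G" for g h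
    using that trunc_eq_iff_quotient[of g h n] subgroup.mem_carrier[OF assms]
      subgroup.m_closed[OF assms] subgroup.m_inv_closed[OF assms] by simp
  note * = index_eq_card_image[OF subgroup_Int_St[OF assms] subgroup.subset[OF assms] this]
  show "index d G (G \<inter> St d n) = card (trunc n ` G)" by (rule *(1))
  show "finite (rcosets\<^bsub>subgrp d G\<^esub> (G \<inter> St d n)) \<longleftrightarrow> finite (trunc n ` G)" by (rule *(2))
qed

lemma index_constrained_St:
  assumes "n \<ge> 1"
  shows "index d constrained (constrained \<inter> St d n) = 2 ^ (d ^ (n - 1)) * d ^ ((d ^ n - 1) div (d - 1))"
proof -
  obtain m where "n = Suc m" using assms by (cases n) auto
  then show ?thesis
    using index_St(1)[OF subgroup_constrained] card_trunc_constrained(1)[of m] by (simp only: geom_eq diff_Suc_1)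
qed

lemma index_D_St: "index d D (D \<inter> St d n) = index d constrained (constrained \<inter> St d n)"
  using index_St(1)[OF subgroup_D] index_St(1)[OF subgroup_constrained] trunc_D_eq by simp

lemma hdim_constrained: "hdim d constrained = ereal (1 - 1 / real d * (ln 2 / ln (2 * real d)))"
proof -
  let ?L = "ln (2 * real d)"
  let ?a = "\<lambda>n. (real d - 1) * log (2 * real d) (real (index d constrained (constrained \<inter> St d n))) / (real d ^ n - 1)"
  have d1: "real d > 1" using d_ge_3 by simp
  have L: "?L > 0" using d1 by simp
  have a: "?a n = ((real d - 1) / real d * (real d ^ n / (real d ^ n - 1)) * ln 2 + ln (real d)) / ?L"
    if n: "n \<ge> 1" for n
  proof -
    have dn: "real d ^ n > 1" using d1 n by (metis one_less_power not_one_le_zero gr0I le_zero_eq)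
    have g: "(real d - 1) * real (geom n) = real d ^ n - 1"
    proof -
      have "real ((d - 1) * geom n + 1) = real (d ^ n)" by (simp only: geom_mult)
      then show ?thesis using d_pos by (simp add: of_nat_diff)
    qed
    have "ln (real (index d constrained (constrained \<inter> St d n))) = real d ^ (n - 1) * ln 2 + real (geom n) * ln (real d)"
    proof -
      have "index d constrained (constrained \<inter> St d n) = 2 ^ (d ^ (n - 1)) * d ^ geom n"
        by (simp only: index_constrained_St[OF n] geom_eq)
      then show ?thesis using d_pos by (simp add: ln_mult ln_realpow)
    qed
    moreover have "real d ^ (n - 1) = real d ^ n / real d" using n d_pos by (simp add: power_diff)
    ultimately have "?a n = ((real d - 1) * (real d ^ n / real d * ln 2) + ((real d - 1) * real (geom n)) * ln (real d)) / ?L / (real d ^ n - 1)"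
      by (simp add: log_def algebra_simps)
    also have "\<dots> = ((real d - 1) / real d * (real d ^ n / (real d ^ n - 1)) * ln 2 + ln (real d)) / ?L"
      unfolding g using dn L d_pos by (simp add: field_simps)
    finally show ?thesis .
  qed
  have "(\<lambda>n. real d ^ n / (real d ^ n - 1)) \<longlonglongrightarrow> 1"
  proof -
    have inv: "(\<lambda>n. inverse (real d ^ n)) \<longlonglongrightarrow> 0" using LIMSEQ_inverse_realpow_zero[OF d1] .
    have "(\<lambda>n. 1 / (1 - inverse (real d ^ n))) \<longlonglongrightarrow> 1 / (1 - 0)"
      by (intro tendsto_intros inv) simp
    moreover have "1 / (1 - inverse (real d ^ n)) = real d ^ n / (real d ^ n - 1)" for n
      using d_pos by (simp add: field_simps)
    ultimately show ?thesis by simp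
  qed
  then have "(\<lambda>n. ((real d - 1) / real d * (real d ^ n / (real d ^ n - 1)) * ln 2 + ln (real d)) / ?L)
      \<longlonglongrightarrow> ((real d - 1) / real d * 1 * ln 2 + ln (real d)) / ?L"
    using L by (intro tendsto_intros) auto
  moreover have "((real d - 1) / real d * 1 * ln 2 + ln (real d)) / ?L = 1 - 1 / real d * (ln 2 / ?L)"
  proof -
    have "?L = ln 2 + ln (real d)" using d_pos by (simp add: ln_mult)
    then have "(real d - 1) / real d * 1 * ln 2 + ln (real d) = ?L - 1 / real d * ln 2"
      using d_pos by (simp add: field_simps)
    then show ?thesis using L by (simp add: diff_divide_distrib)
  qed
  ultimately have lim: "(\<lambda>n. ((real d - 1) / real d * (real d ^ n / (real d ^ n - 1)) * ln 2 + ln (real d)) / ?L)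
      \<longlonglongrightarrow> 1 - 1 / real d * (ln 2 / ?L)" by simp
  have "?a \<longlonglongrightarrow> 1 - 1 / real d * (ln 2 / ?L)"
    by (rule Lim_transform_eventually[OF lim]) (use a in \<open>auto simp: eventually_sequentially intro!: exI[of _ 1]\<close>)
  then have "(\<lambda>n. ereal (?a n)) \<longlonglongrightarrow> ereal (1 - 1 / real d * (ln 2 / ?L))" by simp
  then show ?thesis unfolding hdim_def by (rule lim_imp_Liminf[OF sequentially_bot])
qed

end

section \<open>Elementary abelian 2-groups\<close>

definition additive :: "'a :: comm_monoid_add set \<Rightarrow> 'a monoid" where
  "additive U = \<lparr>carrier = U, monoid.mult = (+), one = 0\<rparr>"

lemma additive_simps [simp]:
  "carrier (additive U) = U" "x \<otimes>\<^bsub>additive U\<^esub> y = x + y" "\<one>\<^bsub>additive U\<^esub> = 0"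
  by (simp_all add: additive_def)

lemma elem_abelian_2_additive:
  fixes U :: "'a :: comm_monoid_add set"
  assumes "0 \<in> U" "\<And>a b. a \<in> U \<Longrightarrow> b \<in> U \<Longrightarrow> a + b \<in> U" "\<And>a :: 'a. a + a = 0"
  shows "elem_abelian_2 (additive U)"
proof -
  have "comm_group (additive U)"
    by (rule comm_groupI) (use assms in \<open>auto simp: add_ac\<close>)
  then show ?thesis using assms(3) by (simp add: elem_abelian_2_def)
qed

lemma elem_abelian_2_group: "elem_abelian_2 G \<Longrightarrow> group G"
  by (simp add: elem_abelian_2_def comm_group_def)

lemma elem_abelian_2_iso:
  assumes "group G" "G \<cong> H" "elem_abelian_2 H"
  shows "elem_abelian_2 G"
proof -
  obtain f where f: "f \<in> hom G H" "inj_on f (carrier G)"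
    using assms(2) by (auto simp: is_iso_def iso_iff)
  interpret G: group G by fact
  interpret H: comm_group H using assms(3) by (simp add: elem_abelian_2_def)
  have fc: "f x \<in> carrier H" if "x \<in> carrier G" for x using f(1) that by (simp add: hom_in_carrier)
  have f1: "f \<one>\<^bsub>G\<^esub> = \<one>\<^bsub>H\<^esub>" using hom_one[OF f(1) assms(1) H.is_group] .
  have "x \<otimes>\<^bsub>G\<^esub> y = y \<otimes>\<^bsub>G\<^esub> x" if "x \<in> carrier G" "y \<in> carrier G" for x y
    using inj_onD[OF f(2), of "x \<otimes>\<^bsub>G\<^esub> y" "y \<otimes>\<^bsub>G\<^esub> x"] that fc
    by (simp add: hom_mult[OF f(1)] H.m_comm)
  then have "comm_group G" by (rule G.group_comm_groupI)
  moreover have "x \<otimes>\<^bsub>G\<^esub> x = \<one>\<^bsub>G\<^esub>" if "x \<in> carrier G" for x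
    using inj_onD[OF f(2), of "x \<otimes>\<^bsub>G\<^esub> x" "\<one>\<^bsub>G\<^esub>"] that fc assms(3) f1
    by (simp add: hom_mult[OF f(1)] elem_abelian_2_def)
  ultimately show ?thesis by (simp add: elem_abelian_2_def)
qed

lemma elem_abelian_2_supported: "elem_abelian_2 (additive (supported I))"
  by (rule elem_abelian_2_additive) (auto simp: supported_def)

lemma group_supported: "group (additive (supported I))"
  by (rule elem_abelian_2_group[OF elem_abelian_2_supported])

lemma Z2_carrier: "carrier (integer_mod_group 2) = {0, 1}"
  by (auto simp: carrier_integer_mod_group)

lemma elem_abelian_2_product_Z2: "elem_abelian_2 (product_group I (\<lambda>_. integer_mod_group 2))"
proof -
  have "group (product_group I (\<lambda>_. integer_mod_group 2))" by simp
  then have "comm_group (product_group I (\<lambda>_. integer_mod_group 2))"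
    by (rule group.group_comm_groupI) (auto simp: add.commute)
  moreover have "x i + x i = 0 \<or> x i + x i = 2" if "x \<in> (\<Pi>\<^sub>E i\<in>I. {0, 1 :: int})" "i \<in> I" for x i
    using that by (auto simp: PiE_iff)
  then have "\<forall>x\<in>carrier (product_group I (\<lambda>_. integer_mod_group 2)).
      x \<otimes>\<^bsub>product_group I (\<lambda>_. integer_mod_group 2)\<^esub> x = \<one>\<^bsub>product_group I (\<lambda>_. integer_mod_group 2)\<^esub>"
    by (auto simp: Z2_carrier intro!: restrict_ext) 
  ultimately show ?thesis by (simp add: elem_abelian_2_def)
qed

lemma supported_iso_product_Z2: "additive (supported I) \<cong> product_group I (\<lambda>_. integer_mod_group 2)"
proof -
  let ?f = "\<lambda>v :: 'a \<Rightarrow> bit. \<lambda>i\<in>I. of_bool (v i = 1) :: int"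
  have "?f \<in> iso (additive (supported I)) (product_group I (\<lambda>_. integer_mod_group 2))"
    unfolding iso_iff
  proof (intro conjI)
    show "?f \<in> hom (additive (supported I)) (product_group I (\<lambda>_. integer_mod_group 2))"
    proof (rule homI)
      fix v w :: "'a \<Rightarrow> bit"
      have "of_bool ((v + w) i = 1) = (of_bool (v i = 1) + of_bool (w i = 1) :: int) mod 2" for i
        by (cases "v i"; cases "w i") simp_all
      then show "?f (v \<otimes>\<^bsub>additive (supported I)\<^esub> w) =
          ?f v \<otimes>\<^bsub>product_group I (\<lambda>_. integer_mod_group 2)\<^esub> ?f w"
        by (auto intro!: restrict_ext simp del: plus_fun_apply)
    qed (auto simp: Z2_carrier)
    show "?f ` carrier (additive (supported I)) = carrier (product_group I (\<lambda>_. integer_mod_group 2))"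
    proof
      show "carrier (product_group I (\<lambda>_. integer_mod_group 2)) \<subseteq> ?f ` carrier (additive (supported I))"
      proof
        fix y assume "y \<in> carrier (product_group I (\<lambda>_. integer_mod_group 2))"
        then have y: "y \<in> (\<Pi>\<^sub>E i\<in>I. {0, 1 :: int})" by (simp add: Z2_carrier)
        let ?v = "\<lambda>i. if i \<in> I \<and> y i = 1 then 1 else 0 :: bit"
        have "y = ?f ?v" using y by (auto simp: fun_eq_iff PiE_iff extensional_def)
        moreover have "?v \<in> supported I" by (simp add: supported_def)
        ultimately show "y \<in> ?f ` carrier (additive (supported I))" by auto
      qed
    qed (auto simp: Z2_carrier)
    show "inj_on ?f (carrier (additive (supported I)))"
    proof (rule inj_onI, rule ext)
      fix v w i assume vw: "v \<in> carrier (additive (supported I))" "w \<in> carrier (additive (supported I))"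
        and eq: "?f v = ?f w"
      show "v i = w i"
      proof (cases "i \<in> I")
        case True
        then show ?thesis using fun_cong[OF eq, of i] by (cases "v i"; cases "w i") auto
      next
        case False
        then show ?thesis using vw by (simp add: supported_def)
      qed
    qed
  qed
  then show ?thesis by (rule is_isoI)
qed

lemma elem_abelian_2_rank_product_Z2: "elem_abelian_2_rank (product_group {..<r} (\<lambda>_. integer_mod_group 2)) r"
  by (simp add: elem_abelian_2_rank_def elem_abelian_2_product_Z2)

text \<open>A finite elementary abelian 2-group is determined by its order: as long as it has more than \<open>2^r\<close>
  elements, an independent family of length \<open>r\<close> can be extended by any element outside its span.\<close>

lemma additive_iso_supported:
  fixes U :: "'a :: comm_monoid_add set"
  assumes U: "0 \<in> U" "\<And>a b. a \<in> U \<Longrightarrow> b \<in> U \<Longrightarrow> a + b \<in> U"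
    and char: "\<And>a :: 'a. a + a = 0" and fin: "finite U" and card: "card U = 2 ^ r"
  shows "additive (supported {..<r}) \<cong> additive U"
proof -
  define comb where "comb = (\<lambda>(u :: nat \<Rightarrow> 'a) n (v :: nat \<Rightarrow> bit). \<Sum>q<n. if v q = 1 then u q else 0)"
  have comb_add: "comb u n (v + w) = comb u n v + comb u n w" for u n v w
    unfolding comb_def sum.distrib[symmetric]
  proof (rule sum.cong[OF refl])
    fix q
    show "(if (v + w) q = 1 then u q else 0) = (if v q = 1 then u q else 0) + (if w q = 1 then u q else 0)"
      by (cases "v q"; cases "w q") (simp_all add: char)
  qed
  have comb_U: "comb u n v \<in> U" if "\<And>q. q < n \<Longrightarrow> u q \<in> U" for u n v
    using that by (induction n) (auto simp: comb_def intro!: U)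
  have "\<exists>u. (\<forall>q<n. u q \<in> U) \<and> inj_on (comb u n) (supported {..<n})" if "n \<le> r" for n
    using that
  proof (induction n)
    case 0
    have "supported {..<0} = {0 :: nat \<Rightarrow> bit}" by (auto simp: supported_def)
    then show ?case by simp
  next
    case (Suc n)
    then obtain u where u: "\<And>q. q < n \<Longrightarrow> u q \<in> U" "inj_on (comb u n) (supported {..<n})" by auto
    let ?im = "comb u n ` supported {..<n}"
    have "card ?im = 2 ^ n" using u(2) by (simp add: card_image card_supported)
    moreover have "(2 :: nat) ^ n < 2 ^ r" using Suc.prems by (intro power_strict_increasing) auto
    ultimately have "\<not> U \<subseteq> ?im" using card card_mono[of ?im U] by (auto simp: finite_supported)
    then obtain g where g: "g \<in> U" "g \<notin> ?im" by blast
    define u' where "u' = u(n := g)"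
    have cu': "comb u' (Suc n) v = comb u n (\<lambda>i. if i < n then v i else 0) + (if v n = 1 then g else 0)" for v
      by (auto simp: comb_def u'_def intro!: sum.cong arg_cong2[of _ _ _ _ "(+)"])
    have kernel: "z = 0" if z: "z \<in> supported {..<Suc n}" and c0: "comb u' (Suc n) z = 0" for z
    proof -
      let ?z = "\<lambda>i. if i < n then z i else 0"
      have zs: "?z \<in> supported {..<n}" by (simp add: supported_def)
      have "z n = 0"
      proof (rule ccontr)
        assume "z n \<noteq> 0"
        then have "comb u n ?z + g = 0" using c0 cu'[of z] by simp
        then have "g = comb u n ?z" using translation_involution[OF char, of "comb u n ?z" g] by simp
        then show False using g(2) zs by blast
      qed
      then have "comb u n ?z = 0" using c0 cu'[of z] by simp
      moreover have "comb u n 0 = 0" by (simp add: comb_def)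
      moreover have "0 \<in> supported {..<n}" by (simp add: supported_def)
      ultimately have z0: "?z = 0" using inj_onD[OF u(2), of ?z 0] zs by simp
      have "z i = 0" if "i < n" for i using fun_cong[OF z0, of i] that by simp
      then show "z = 0" using \<open>z n = 0\<close> z by (auto simp: fun_eq_iff supported_def less_Suc_eq)
    qed
    have "inj_on (comb u' (Suc n)) (supported {..<Suc n})"
    proof (rule inj_onI)
      fix v w assume vw: "v \<in> supported {..<Suc n}" "w \<in> supported {..<Suc n}"
        "comb u' (Suc n) v = comb u' (Suc n) w"
      have vw0: "v + w = 0"
        by (rule kernel) (use vw in \<open>simp_all add: supported_add comb_add char del: plus_fun_apply\<close>)
      have "v i + w i = 0" for i using fun_cong[OF vw0, of i] by (simp only: plus_fun_apply zero_fun_apply)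
      then show "v = w" by (simp add: fun_eq_iff bit_add_eq_0_iff)
    qed
    moreover have "\<forall>q<Suc n. u' q \<in> U" using u(1) g(1) by (auto simp: u'_def less_Suc_eq)
    ultimately show ?case by blast
  qed
  then obtain u where u: "\<And>q. q < r \<Longrightarrow> u q \<in> U" "inj_on (comb u r) (supported {..<r})" by blast
  have "comb u r ` supported {..<r} = U"
  proof (rule card_subset_eq[OF fin])
    show "comb u r ` supported {..<r} \<subseteq> U" using comb_U u(1) by blast
    show "card (comb u r ` supported {..<r}) = card U" using u(2) card by (simp add: card_image card_supported)
  qed
  then have "comb u r \<in> iso (additive (supported {..<r})) (additive U)"
    using u(2) comb_U u(1) comb_add by (auto simp: iso_iff intro!: homI simp del: plus_fun_apply)
  then show ?thesis by (rule is_isoI)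
qed

lemma supported_reindex:
  assumes "bij_betw f I J"
  shows "additive (supported J) \<cong> additive (supported I)"
proof -
  let ?g = "\<lambda>(v :: 'b \<Rightarrow> bit) i. if i \<in> I then v (f i) else 0"
  have fI: "f i \<in> J" if "i \<in> I" for i using assms that by (auto simp: bij_betw_def)
  have "?g \<in> iso (additive (supported J)) (additive (supported I))"
    unfolding iso_iff
  proof (intro conjI)
    show "?g \<in> hom (additive (supported J)) (additive (supported I))"
      by (rule homI) (auto simp: supported_def fun_eq_iff)
    show "?g ` carrier (additive (supported J)) = carrier (additive (supported I))"
    proof
      show "carrier (additive (supported I)) \<subseteq> ?g ` carrier (additive (supported J))"
      proof
        fix w assume w: "w \<in> carrier (additive (supported I))"
        let ?v = "\<lambda>j. if j \<in> J then w (inv_into I f j) else 0"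
        have "inv_into I f (f i) = i" if "i \<in> I" for i
          using assms that by (simp add: bij_betw_def inv_into_f_f)
        then have "w = ?g ?v" using w fI by (auto simp: fun_eq_iff supported_def)
        moreover have "?v \<in> supported J" by (simp add: supported_def)
        ultimately show "w \<in> ?g ` carrier (additive (supported J))" by auto
      qed
    qed (auto simp: supported_def)
    show "inj_on ?g (carrier (additive (supported J)))"
    proof (rule inj_onI, rule ext)
      fix v w j assume vw: "v \<in> carrier (additive (supported J))" "w \<in> carrier (additive (supported J))"
        and eq: "?g v = ?g w"
      show "v j = w j"
      proof (cases "j \<in> J")
        case True
        then obtain i where "i \<in> I" "j = f i" using assms by (auto simp: bij_betw_def)
        then show ?thesis using fun_cong[OF eq, of i] by simp
      next
        case False
        then show ?thesis using vw by (simp add: supported_def)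
      qed
    qed
  qed
  then show ?thesis by (rule is_isoI)
qed

lemma supported_sum_iso:
  "additive (supported I) \<times>\<times> product_group W (\<lambda>_. additive (supported J)) \<cong>
     additive (supported (I <+> W \<times> J))"
proof -
  let ?G = "additive (supported I) \<times>\<times> product_group W (\<lambda>_. additive (supported J))"
  define f where "f = (\<lambda>(v :: 'a \<Rightarrow> bit, h :: 'b \<Rightarrow> 'c \<Rightarrow> bit) k.
    case k of Inl i \<Rightarrow> v i | Inr (w, j) \<Rightarrow> if w \<in> W then h w j else 0)"
  have f_in: "f x \<in> supported (I <+> W \<times> J)" if xG: "x \<in> carrier ?G" for x
  proof -
    obtain v h where x: "x = (v, h)" "v \<in> supported I" "h \<in> (\<Pi>\<^sub>E w\<in>W. supported J)"
      using xG by (cases x) auto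
    have "f x k = 0" if "k \<notin> I <+> W \<times> J" for k
    proof (cases k)
      case (Inl i)
      then have "i \<notin> I" using that by auto
      then show ?thesis using x Inl by (simp add: f_def supported_def)
    next
      case (Inr p)
      then obtain w j where p: "k = Inr (w, j)" by (cases p) auto
      then have "w \<notin> W \<or> j \<notin> J" using that by auto
      then have "(if w \<in> W then h w j else 0) = 0" using x(3) by (auto simp: supported_def PiE_iff)
      then show ?thesis using x(1) p by (simp add: f_def)
    qed
    then show ?thesis by (simp add: supported_def)
  qed
  have "f \<in> iso ?G (additive (supported (I <+> W \<times> J)))"
    unfolding iso_iff
  proof (intro conjI)
    show "f \<in> hom ?G (additive (supported (I <+> W \<times> J)))"
    proof (rule homI)
      fix x assume "x \<in> carrier ?G"
      then show "f x \<in> carrier (additive (supported (I <+> W \<times> J)))"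
        using f_in by simp
    next
      fix x y assume "x \<in> carrier ?G" "y \<in> carrier ?G"
      show "f (x \<otimes>\<^bsub>?G\<^esub> y) = f x \<otimes>\<^bsub>additive (supported (I <+> W \<times> J))\<^esub> f y"
        by (cases x; cases y) (auto simp: f_def fun_eq_iff split: sum.split)
    qed
    show "f ` carrier ?G = carrier (additive (supported (I <+> W \<times> J)))"
    proof
      show "carrier (additive (supported (I <+> W \<times> J))) \<subseteq> f ` carrier ?G"
      proof
        fix z assume z: "z \<in> carrier (additive (supported (I <+> W \<times> J)))"
        let ?x = "(\<lambda>i. z (Inl i), \<lambda>w\<in>W. \<lambda>j. z (Inr (w, j)))"
        have "?x \<in> carrier ?G" using z by (auto simp: supported_def)
        moreover have "z = f ?x" using z by (auto simp: f_def fun_eq_iff supported_def split: sum.split)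
        ultimately show "z \<in> f ` carrier ?G" by blast
      qed
      show "f ` carrier ?G \<subseteq> carrier (additive (supported (I <+> W \<times> J)))"
        using f_in by (auto simp only: additive_simps)
    qed
    show "inj_on f (carrier ?G)"
    proof (rule inj_onI)
      fix x y assume x: "x \<in> carrier ?G" and y: "y \<in> carrier ?G" and eq: "f x = f y"
      have 1: "fst x i = fst y i" for i
        using fun_cong[OF eq, of "Inl i"] by (simp add: f_def split_def)
      have 2: "snd x w j = snd y w j" if "w \<in> W" for w j
        using fun_cong[OF eq, of "Inr (w, j)"] that by (simp add: f_def split_def)
      have "snd x w = snd y w" for w
        using x y 2 by (cases "w \<in> W") (auto simp: PiE_iff extensional_def fun_eq_iff)
      then show "x = y" using 1 by (simp add: prod_eq_iff fun_eq_iff)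
    qed
  qed
  then show ?thesis by (rule is_isoI)
qed

lemma Z2_product_iso: "additive (supported {..<2 :: nat}) \<cong> integer_mod_group 2 \<times>\<times> integer_mod_group 2"
proof -
  let ?b = "\<lambda>x :: bit. of_bool (x = 1) :: int"
  let ?f = "\<lambda>v :: nat \<Rightarrow> bit. (?b (v 0), ?b (v 1))"
  have badd: "?b (x + y) = (?b x + ?b y) mod 2" for x y by (cases x; cases y) simp_all
  have binj: "?b x = ?b y \<longleftrightarrow> x = y" for x y by (cases x; cases y) simp_all
  have "?f \<in> iso (additive (supported {..<2})) (integer_mod_group 2 \<times>\<times> integer_mod_group 2)"
    unfolding iso_iff
  proof (intro conjI)
    show "?f \<in> hom (additive (supported {..<2})) (integer_mod_group 2 \<times>\<times> integer_mod_group 2)"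
      by (rule homI) (auto simp: Z2_carrier badd)
    show "?f ` carrier (additive (supported {..<2})) = carrier (integer_mod_group 2 \<times>\<times> integer_mod_group 2)"
    proof
      show "carrier (integer_mod_group 2 \<times>\<times> integer_mod_group 2) \<subseteq> ?f ` carrier (additive (supported {..<2}))"
      proof
        fix y assume "y \<in> carrier (integer_mod_group 2 \<times>\<times> integer_mod_group 2)"
        then obtain a b where y: "y = (a, b)" "a \<in> {0, 1}" "b \<in> {0, 1}" by (auto simp: Z2_carrier)
        let ?v = "\<lambda>i :: nat. if i = 0 then (if a = 1 then 1 else 0) else if i = 1 then (if b = 1 then 1 else 0) else 0 :: bit"
        have v: "?v \<in> supported {..<2}" by (auto simp: supported_def)
        have yv: "y = ?f ?v" using y by auto
        show "y \<in> ?f ` carrier (additive (supported {..<2}))"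
          unfolding additive_simps(1) yv by (rule imageI[OF v])
      qed
    qed (auto simp: Z2_carrier)
    show "inj_on ?f (carrier (additive (supported {..<2})))"
    proof (rule inj_onI, rule ext)
      fix v w :: "nat \<Rightarrow> bit" and i assume vw: "v \<in> carrier (additive (supported {..<2}))"
        "w \<in> carrier (additive (supported {..<2}))" and eq: "?f v = ?f w"
      have "v 0 = w 0" "v 1 = w 1" using eq binj by auto
      then show "v i = w i" using vw by (cases "i < 2") (auto simp: supported_def less_2_cases_iff)
    qed
  qed
  then show ?thesis by (rule is_isoI)
qed

section \<open>The rigid kernel\<close>

context odd_gon
begin

definition child_rows :: "(nat list \<Rightarrow> nat \<Rightarrow> bit) \<Rightarrow> nat list \<Rightarrow> nat \<Rightarrow> nat \<Rightarrow> bit" where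
  "child_rows E v x = (if x < d then E (v @ [x]) else 0)"

text \<open>Elements of the rigid kernel in coordinates: \<open>E v\<close> is the class in \<open>D / D'\<close> of the section at \<open>v\<close> of an element
  that represents the coset at the level of \<open>v\<close>. A representative at the next level has a section at \<open>v\<close> that fixes the
  first level, so the classes at the children of \<open>v\<close> form a cycle, and its column sums give back the class at
  \<open>v\<close>. The value at the root is a dummy.\<close>

definition families :: "(nat list \<Rightarrow> nat \<Rightarrow> bit) set" where
  "families = {E. (\<forall>v. v \<notin> words d \<or> v = [] \<longrightarrow> E v = 0) \<and> (\<forall>v\<in>words d. child_rows E v \<in> cycles) \<and>
     (\<forall>v\<in>words d. v \<noteq> [] \<longrightarrow> col_sums (child_rows E v) = E v)}"

lemma child_rows_add: "child_rows (E + F) v = child_rows E v + child_rows F v"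
  by (rule ext) (simp add: child_rows_def)

lemma families_add: "E \<in> families \<Longrightarrow> F \<in> families \<Longrightarrow> E + F \<in> families"
  by (simp add: families_def child_rows_add cycles_add col_sums_add)

lemma child_rows_zero: "child_rows 0 v = 0"
  by (rule ext) (simp add: child_rows_def)

lemma zero_in_families: "0 \<in> families"
proof -
  have "col_sums 0 = 0" by (rule ext) (simp add: col_sums_def)
  then show ?thesis by (simp add: families_def child_rows_zero zero_in_cycles)
qed

lemma elem_abelian_2_families: "elem_abelian_2 (additive families)"
  by (rule elem_abelian_2_additive[OF zero_in_families families_add]) auto

text \<open>The row sums are the total weights of the matrices one level below, which vanish for every cycle.\<close>

lemma families_rows:
  assumes "E \<in> families" "v \<in> words d"
  shows "child_rows E v \<in> spaceA"
proof -
  have c: "child_rows E v \<in> cycles" using assms by (simp add: families_def)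
  have "row_sums (child_rows E v) x = 0" for x
  proof (cases "x < d")
    case True
    then have vx: "v @ [x] \<in> words d" using assms(2) by simp
    then have "col_sums (child_rows E (v @ [x])) = E (v @ [x])" "child_rows E (v @ [x]) \<in> cycles"
      using assms(1) by (auto simp: families_def)
    then have "(\<Sum>i<d. E (v @ [x]) i) = 0" using sum_col_sums sum_row_sums by metis
    then show ?thesis using True by (simp add: row_sums_def child_rows_def)
  next
    case False
    then show ?thesis by (simp add: row_sums_def child_rows_def)
  qed
  then show ?thesis using c by (simp add: spaceA_def fun_eq_iff)
qed

lemma families_even:
  assumes "E \<in> families" "v \<in> words d" "v \<noteq> []"
  shows "E v \<in> even_vecs {..<d}"
proof -
  have "child_rows E v \<in> cycles" "col_sums (child_rows E v) = E v" using assms by (auto simp: families_def)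
  then show ?thesis using col_sums_even by metis
qed

lemma elem_abelian_2_spaceA: "elem_abelian_2 (additive spaceA)"
  by (rule elem_abelian_2_additive[OF zero_in_spaceA spaceA_add]) auto

lemma elem_abelian_2_spaceB: "elem_abelian_2 (additive spaceB)"
  by (rule elem_abelian_2_additive[OF zero_in_spaceB spaceB_add]) auto

abbreviation nonroot :: "nat list set" where
  "nonroot \<equiv> words d - {[]}"

text \<open>The rows below \<open>v\<close> form a matrix in \<open>spaceA\<close> whose column sums are prescribed by the value at \<open>v\<close>. After
  subtracting the chosen solution, only an element of \<open>spaceB\<close> remains to be chosen at each vertex.\<close>

lemma families_iso:
  "additive families \<cong> additive spaceA \<times>\<times> product_group nonroot (\<lambda>_. additive spaceB)"
proof -
  obtain s where s: "\<And>v. s v \<in> spaceA" "\<And>v w. s (v + w) = s v + s w"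
    "\<And>v. v \<in> even_vecs {..<d} \<Longrightarrow> col_sums (s v) = v" using column_section by blast
  let ?H = "additive spaceA \<times>\<times> product_group nonroot (\<lambda>_. additive spaceB)"
  define \<Phi> where "\<Phi> = (\<lambda>E. (child_rows E [], \<lambda>v\<in>nonroot. child_rows E v + s (E v)))"
  have \<Phi>_in: "\<Phi> E \<in> carrier ?H" if E: "E \<in> families" for E
  proof -
    have "child_rows E v + s (E v) \<in> spaceB" if v: "v \<in> nonroot" for v
    proof -
      have "col_sums (child_rows E v + s (E v)) = E v + E v"
        using v E s(3)[OF families_even[OF E]] by (simp add: col_sums_add families_def del: plus_fun_apply fun_add_self)
      then show ?thesis using families_rows[OF E] s(1) v spaceA_add by (simp add: spaceB_def)
    qed
    then show ?thesis using families_rows[OF E] by (simp add: \<Phi>_def)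
  qed
  have "\<Phi> \<in> iso (additive families) ?H"
    unfolding iso_iff
  proof (intro conjI)
    show "\<Phi> \<in> hom (additive families) ?H"
    proof (rule homI)
      fix E F
      show "\<Phi> (E \<otimes>\<^bsub>additive families\<^esub> F) = \<Phi> E \<otimes>\<^bsub>?H\<^esub> \<Phi> F"
        by (simp add: \<Phi>_def child_rows_add) (intro restrict_ext, simp add: s(2)[unfolded plus_fun_def] add_ac plus_fun_def)
    qed (use \<Phi>_in in auto)
    show "inj_on \<Phi> (carrier (additive families))"
    proof (rule inj_onI)
      fix E F assume "E \<in> carrier (additive families)" "F \<in> carrier (additive families)"
        and eq: "\<Phi> E = \<Phi> F"
      then have E: "E \<in> families" and F: "F \<in> families" by auto
      have "E v = F v" if "v \<in> words d" for v
        using that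
      proof (induction v rule: rev_induct)
        case Nil
        then show ?case using E F by (simp add: families_def)
      next
        case (snoc x u)
        then have u: "u \<in> words d" "x < d" by auto
        have "child_rows E u = child_rows F u"
        proof (cases "u = []")
          case True
          then show ?thesis using eq by (simp add: \<Phi>_def)
        next
          case False
          have "child_rows E u + s (E u) = child_rows F u + s (F u)"
            using fun_cong[of _ _ u] eq u False by (auto simp: \<Phi>_def fun_eq_iff restrict_def split: if_splits)
          then have "child_rows E u + s (E u) = child_rows F u + s (E u)" using snoc.IH[OF u(1)] by simp
          then show ?thesis by (simp add: add_right_imp_eq)
        qed
        then have "child_rows E u x = child_rows F u x" by (rule fun_cong)
        moreover have "child_rows E u x = E (u @ [x])" "child_rows F u x = F (u @ [x])"
          using u(2) by (simp_all add: child_rows_def)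
        ultimately show ?case by metis
      qed
      moreover have "E v = F v" if "v \<notin> words d" for v using that E F by (simp add: families_def)
      ultimately show "E = F" by blast
    qed
    show "\<Phi> ` carrier (additive families) = carrier ?H"
    proof
      show "\<Phi> ` carrier (additive families) \<subseteq> carrier ?H"
        by (rule image_subsetI) (rule \<Phi>_in, simp)
      show "carrier ?H \<subseteq> \<Phi> ` carrier (additive families)"
      proof
        fix y assume "y \<in> carrier ?H"
        then obtain M0 F where y: "y = (M0, F)" and M0: "M0 \<in> spaceA" and F: "F \<in> nonroot \<rightarrow>\<^sub>E spaceB"
          by (cases y) auto
        define Er where "Er = rec_list (0 :: nat \<Rightarrow> bit)
          (\<lambda>x r e. (if r = [] then M0 else F (rev r) + s e) x)"
        have Er: "Er [] = 0" "Er (x # r) = (if r = [] then M0 else F (rev r) + s (Er r)) x" for x r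
          by (simp_all add: Er_def)
        define E where "E = (\<lambda>v. if v \<in> words d then Er (rev v) else 0)"
        define mat where "mat = (\<lambda>v. if v = [] then M0 else F v + s (E v))"
        have Esnoc: "E (v @ [x]) = mat v x" if "v \<in> words d" "x < d" for v x
          using that by (simp add: E_def Er mat_def)
        have mA: "mat v \<in> spaceA" if "v \<in> words d" for v
          using that M0 F s(1) spaceA_add by (auto simp: mat_def spaceB_def PiE_iff)
        have rE: "child_rows E v = mat v" if v: "v \<in> words d" for v
        proof
          fix x
          have "mat v x = 0" if "\<not> x < d"
            using mA[OF v] that by (simp add: spaceA_def cycles_def Mat_def fun_eq_iff)
          then show "child_rows E v x = mat v x" using Esnoc[OF v] by (simp add: child_rows_def)
        qed
        have even: "E v \<in> even_vecs {..<d}" if v: "v \<in> words d" "v \<noteq> []" for v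
        proof -
          obtain u x where ux: "v = u @ [x]" using v(2) by (metis rev_exhaust)
          then have u: "u \<in> words d" "x < d" using v(1) by auto
          have "row_sums (mat u) x = 0" using mA[OF u(1)] by (simp add: spaceA_def)
          moreover have "mat u \<in> Mat" using mA[OF u(1)] by (simp add: spaceA_def cycles_def)
          ultimately show ?thesis using Esnoc[OF u] ux
            by (auto simp: even_vecs_def supported_def row_sums_def Mat_def)
        qed
        have cols: "col_sums (child_rows E v) = E v" if v: "v \<in> words d" "v \<noteq> []" for v
        proof -
          have "F v \<in> spaceB" using F v by (auto simp: PiE_iff)
          then have "col_sums (F v) = 0" by (simp add: spaceB_def)
          then show ?thesis using rE[OF v(1)] v s(3)[OF even[OF v]] by (simp add: mat_def col_sums_add del: plus_fun_apply)
        qed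
        have "child_rows E v \<in> cycles" if "v \<in> words d" for v
          using rE[OF that] mA[OF that] spaceA_cycles by simp
        then have Ef: "E \<in> families" using cols by (simp add: families_def) (simp add: E_def Er)
        have "\<Phi> E = y"
        proof -
          have "child_rows E v + s (E v) = F v" if "v \<in> nonroot" for v
            using rE[of v] that by (simp add: mat_def add.assoc del: plus_fun_apply)
          then have "(\<lambda>v\<in>nonroot. child_rows E v + s (E v)) = F"
            using F by (auto simp: fun_eq_iff PiE_iff extensional_def restrict_def)
          moreover have "child_rows E [] = M0" using rE[of "[]"] by (simp add: mat_def)
          ultimately show ?thesis by (simp add: \<Phi>_def y)
        qed
        then show "y \<in> \<Phi> ` carrier (additive families)" using Ef by auto
      qed
    qed
  qed
  then show ?thesis by (rule is_isoI)
qed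


text \<open>The coset of the rigid stabilizer of level \<open>n\<close> that a family describes; at level 0 this is all of \<open>D\<close>.\<close>

definition level_coset :: "(nat list \<Rightarrow> nat \<Rightarrow> bit) \<Rightarrow> nat \<Rightarrow> portrait set" where
  "level_coset E n = {g \<in> D \<inter> St d n. n \<ge> 1 \<longrightarrow> (\<forall>v\<in>level d n. par (sect v g) = E v)}"

lemma St_antimono: "m \<le> n \<Longrightarrow> St d n \<subseteq> St d m"
  by (auto simp: St_iff)

lemma par_col_sums: "g \<in> D \<Longrightarrow> par (sect v g) = col_sums (\<lambda>x. par (sect (v @ [x]) g))"
  using par_sum_sections[OF D_sect, of g v] by (simp add: fun_eq_iff col_sums_def sect_sect)

lemma level_snoc: "v \<in> level d n \<Longrightarrow> x < d \<Longrightarrow> v @ [x] \<in> level d (Suc n)"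
  by (simp add: level_iff)

lemma level_coset_Suc:
  assumes "E \<in> families" "g \<in> level_coset E (Suc n)"
  shows "g \<in> level_coset E n"
proof -
  have "par (sect v g) = E v" if v: "v \<in> level d n" "n \<ge> 1" for v
  proof -
    have gD: "g \<in> D" using assms(2) by (simp add: level_coset_def)
    have "par (sect v g) = col_sums (\<lambda>x. par (sect (v @ [x]) g))" by (rule par_col_sums[OF gD])
    also have "\<dots> = col_sums (child_rows E v)"
      using assms(2) level_snoc[OF v(1)] by (intro col_sums_cong) (simp add: level_coset_def child_rows_def)
    also have "\<dots> = E v" using assms(1) v by (simp add: families_def level_iff) (use list.size(3) in fastforce)
    finally show ?thesis .
  qed
  then show ?thesis using assms(2) St_antimono[of n "Suc n"] by (auto simp: level_coset_def)
qed

lemma level_coset_antimono: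
  assumes "E \<in> families" "m \<le> n"
  shows "level_coset E n \<subseteq> level_coset E m"
  using assms(2)
proof (induction rule: dec_induct)
  case (step n)
  then show ?case using level_coset_Suc[OF assms(1)] by blast
qed simp

lemma level_coset_root_par:
  assumes "E \<in> families" "g \<in> level_coset E n" "n \<ge> 1"
  shows "par g = col_sums (child_rows E [])"
proof -
  have g: "g \<in> level_coset E 1" using level_coset_antimono[OF assms(1,3)] assms(2) by blast
  then have "par g = col_sums (\<lambda>x. par (sect [x] g))"
    using par_col_sums[of g "[]"] by (simp add: level_coset_def)
  also have "\<dots> = col_sums (child_rows E [])"
    using g single_level by (intro col_sums_cong) (simp add: level_coset_def child_rows_def)
  finally show ?thesis .
qed

definition shift :: "nat \<Rightarrow> (nat list \<Rightarrow> nat \<Rightarrow> bit) \<Rightarrow> nat list \<Rightarrow> nat \<Rightarrow> bit" where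
  "shift x E v = (if v = [] then 0 else E (x # v))"

lemma child_rows_shift: "child_rows (shift x E) v = child_rows E (x # v)"
  by (rule ext) (simp add: child_rows_def shift_def)

lemma shift_in_families:
  assumes "E \<in> families" "x < d"
  shows "shift x E \<in> families"
  using assms by (simp add: families_def child_rows_shift) (auto simp: shift_def)

text \<open>Glue representatives for the families below the letters; the boundary condition holds because the values
  at the first level form a cycle.\<close>

lemma level_coset_nonempty: "E \<in> families \<Longrightarrow> level_coset E n \<noteq> {}"
proof (induction n arbitrary: E)
  case 0
  have "idp \<in> level_coset E 0" using one_in_D one_in_St by (simp add: level_coset_def)
  then show ?case by blast
next
  case (Suc n)
  have "\<exists>h\<in>level_coset (shift x E) n. par h = E [x]" if x: "x < d" for x
  proof (cases "n = 0")
    case True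
    have "E [x] \<in> supported {..<d}"
      using families_even[OF Suc.prems, of "[x]"] x by (simp add: even_vecs_def)
    then obtain h where "h \<in> D" "par h = E [x]" using par_onto by blast
    then show ?thesis using True D_carrier by (auto simp: level_coset_def St_0)
  next
    case False
    have sx: "shift x E \<in> families" using shift_in_families[OF Suc.prems x] .
    then obtain h where h: "h \<in> level_coset (shift x E) n" using Suc.IH by blast
    have "par h = col_sums (child_rows E [x])"
      using level_coset_root_par[OF sx h] False by (simp add: child_rows_shift)
    also have "\<dots> = E [x]" using Suc.prems x by (simp add: families_def)
    finally show ?thesis using h by blast
  qed
  then obtain h where h: "\<And>x. x < d \<Longrightarrow> h x \<in> level_coset (shift x E) n" "\<And>x. x < d \<Longrightarrow> par (h x) = E [x]"
    by metis
  have hD: "h x \<in> D" "h x \<in> St d n" if "x < d" for x using h(1)[OF that] by (auto simp: level_coset_def)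
  have "bnd (\<lambda>x. par (h x)) q = bnd (child_rows E []) q" for q
    by (rule bnd_cong) (simp add: h(2) child_rows_def)
  moreover have "child_rows E [] \<in> cycles" using Suc.prems by (simp add: families_def)
  ultimately have gD: "glue d id h \<in> D"
    using glue_in_D_iff[of h id] hD by (simp add: cycles_def id_in_dih del: id_apply)
  have "glue d id h \<in> St d (Suc n)" using D_carrier[OF gD] hD by (simp add: St_Suc)
  moreover have "par (sect v (glue d id h)) = E v" if v: "v \<in> level d (Suc n)" for v
  proof -
    obtain x u where xu: "v = x # u" "x < d" "u \<in> level d n" using v by (auto simp: level_Suc)
    have "sect v (glue d id h) = sect u (h x)" using xu sect_Cons[of x u] by simp
    moreover have "par (sect u (h x)) = E (x # u)"
    proof (cases "n = 0")
      case True
      then show ?thesis using h(2) xu by simp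
    next
      case False
      then have "u \<noteq> []" using xu(3) by (auto simp: level_iff)
      then show ?thesis using h(1)[OF xu(2)] xu(3) False by (simp add: level_coset_def shift_def)
    qed
    ultimately show ?thesis using xu by simp
  qed
  ultimately have "glue d id h \<in> level_coset E (Suc n)" using gD by (simp add: level_coset_def)
  then show ?case by blast
qed

abbreviation R :: "nat \<Rightarrow> portrait set" where
  "R n \<equiv> Rst d D n"

lemma Rst_0: "R 0 = D"
proof -
  have "Rst_vertex d D [] = D" by (auto simp: Rst_vertex_def)
  then show ?thesis
    using T.generate_subgroup_incl[OF subset_refl subgroup_D] generate.incl[of _ D "tree_aut d"]
    by (auto simp: Rst_def)
qed

lemma R_iff: "g \<in> R n \<longleftrightarrow> g \<in> D \<and> g \<in> St d n \<and> (n \<ge> 1 \<longrightarrow> (\<forall>v\<in>level d n. par (sect v g) = 0))"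
proof (cases "n = 0")
  case True
  then show ?thesis using D_carrier by (auto simp: Rst_0 St_0)
next
  case False
  then show ?thesis using Rst_eq_star[of n] by (simp add: star_D'_iff zero_fun_def)
qed

lemma R_eq_realizers: "R n = level_coset 0 n"
  by (auto simp: R_iff level_coset_def)

lemma R_antimono: "m \<le> n \<Longrightarrow> R n \<subseteq> R m"
  unfolding R_eq_realizers by (rule level_coset_antimono[OF zero_in_families])

lemma subgroup_R: "subgroup (R n) (tree_aut d)"
  using subgroup_star[of n] Rst_eq_star[of n] subgroup_D Rst_0 by (cases n) auto

lemma group_D: "group (subgrp d D)"
  by (rule T.subgroup_imp_group[OF subgroup_D])

lemma subgrp_inv: "g \<in> D \<Longrightarrow> inv\<^bsub>subgrp d D\<^esub> g = tree_inv g"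
  by (rule T.m_inv_consistent[OF subgroup_D])

lemma normal_in_D_iff:
  assumes "subgroup N (tree_aut d)" "N \<subseteq> D"
    and "\<And>g h. g \<in> D \<Longrightarrow> h \<in> N \<Longrightarrow> g \<odot> h \<odot> tree_inv g \<in> N"
  shows "N \<lhd> subgrp d D"
proof -
  interpret S: group "subgrp d D" by (rule group_D)
  show ?thesis
    unfolding S.normal_inv_iff
    using T.subgroup_incl[OF assms(1) subgroup_D assms(2)] assms(3) by (simp add: subgrp_inv)
qed

lemma conj_in_St:
  assumes "g \<in> carrier (tree_aut d)" "h \<in> St d n"
  shows "g \<odot> h \<odot> tree_inv g \<in> St d n"
proof -
  have "act (g \<odot> h \<odot> tree_inv g) w = w" if w: "w \<in> level d n" for w
  proof -
    have "act (tree_inv g) w \<in> level d n" using w assms(1) by (simp add: level_iff act_in_words)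
    then have "act h (act (tree_inv g) w) = act (tree_inv g) w" using assms(2) by (simp add: St_def)
    then have "act (g \<odot> h \<odot> tree_inv g) w = act (g \<odot> tree_inv g) w" by (simp only: act_mult)
    then show ?thesis using assms(1) by (simp add: one_tree_aut)
  qed
  then show ?thesis using assms(1) St_carrier[OF assms(2)] by (simp add: St_def)
qed

lemma normal_R: "R n \<lhd> subgrp d D"
proof (rule normal_in_D_iff[OF subgroup_R])
  show "R n \<subseteq> D" by (auto simp: R_iff)
  fix g h assume g: "g \<in> D" and h: "h \<in> R n"
  then have hD: "h \<in> D" "h \<in> St d n" by (auto simp: R_iff)
  let ?k = "g \<odot> h \<odot> tree_inv g"
  have kD: "?k \<in> D" using g hD by (simp add: D_mult D_inv)
  have kSt: "?k \<in> St d n" using conj_in_St[OF D_carrier[OF g] hD(2)] .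
  have "par (sect v ?k) = 0" if v: "v \<in> level d n" and n: "n \<ge> 1" for v
  proof -
    let ?w = "act (tree_inv g) v"
    have w: "?w \<in> level d n" using v g by (simp add: level_iff act_in_words D_carrier)
    have hw: "act h ?w = ?w" using hD(2) w by (simp add: St_def)
    have "act (g \<odot> tree_inv g) v = v" using g by (simp add: D_carrier one_tree_aut)
    then have gw: "act g ?w = v" by (simp only: act_mult)
    have "sect v ?k = sect ?w (g \<odot> h) \<odot> sect v (tree_inv g)" by (rule sect_mult)
    also have "sect ?w (g \<odot> h) = sect ?w g \<odot> sect ?w h" by (simp only: sect_mult hw)
    also have "sect v (tree_inv g) = tree_inv (sect ?w g)"
      using sect_inv[OF D_carrier[OF g], of ?w] w gw by (simp add: level_iff)
    finally have sv: "sect v ?k = sect ?w g \<odot> sect ?w h \<odot> tree_inv (sect ?w g)" .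
    moreover have "par (sect ?w h) = 0" using h w n by (simp add: R_iff)
    ultimately show ?thesis
      unfolding sv using g hD by (simp add: par_mult par_inv D_mult D_inv D_sect fun_eq_iff)
  qed
  then show "?k \<in> R n" using kD kSt by (simp add: R_iff)
qed

lemma normal_D_St: "D \<inter> St d n \<lhd> subgrp d D"
proof (rule normal_in_D_iff[OF subgroup_Int_St[OF subgroup_D]])
  fix g h assume "g \<in> D" "h \<in> D \<inter> St d n"
  then show "g \<odot> h \<odot> tree_inv g \<in> D \<inter> St d n"
    using conj_in_St[OF D_carrier] by (auto simp: D_mult D_inv)
qed simp

lemma normal_D': "D' \<lhd> subgrp d D"
  by (rule normal_in_D_iff[OF subgroup_D']) (auto simp: D'_iff D_mult D_inv par_mult par_inv)

lemma r_coset_subgrp: "N #>\<^bsub>subgrp d G\<^esub> a = N #>\<^bsub>tree_aut d\<^esub> a"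
  by (simp add: r_coset_def)

lemma set_mult_subgrp: "A <#>\<^bsub>subgrp d G\<^esub> B = A <#>\<^bsub>tree_aut d\<^esub> B"
  by (simp add: set_mult_def)

lemma rcos_product:
  assumes "N \<lhd> subgrp d D" "g \<in> D" "h \<in> D"
  shows "(N #>\<^bsub>tree_aut d\<^esub> g) <#>\<^bsub>tree_aut d\<^esub> (N #>\<^bsub>tree_aut d\<^esub> h) = N #>\<^bsub>tree_aut d\<^esub> (g \<odot> h)"
  using normal.rcos_sum[OF assms(1), of g h] assms(2,3) by (simp add: r_coset_subgrp set_mult_subgrp)

lemma coarser_coset:
  assumes M: "subgroup M (tree_aut d)" and N: "subgroup N (tree_aut d)" "N \<subseteq> M"
    and g: "g \<in> carrier (tree_aut d)"
  shows "M <#>\<^bsub>tree_aut d\<^esub> (N #>\<^bsub>tree_aut d\<^esub> g) = M #>\<^bsub>tree_aut d\<^esub> g"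
proof
  have Mc: "m \<in> M \<Longrightarrow> m \<in> carrier (tree_aut d)" for m using subgroup.mem_carrier[OF M] .
  show "M <#>\<^bsub>tree_aut d\<^esub> (N #>\<^bsub>tree_aut d\<^esub> g) \<subseteq> M #>\<^bsub>tree_aut d\<^esub> g"
  proof
    fix y assume "y \<in> M <#>\<^bsub>tree_aut d\<^esub> (N #>\<^bsub>tree_aut d\<^esub> g)"
    then obtain m n where mn: "m \<in> M" "n \<in> N" "y = m \<odot> (n \<odot> g)" by (auto simp: set_mult_def r_coset_def)
    then have "y = (m \<odot> n) \<odot> g" "m \<odot> n \<in> M"
      using g N(2) Mc subgroup.m_closed[OF M] by (auto simp: T.m_assoc subset_iff)
    then show "y \<in> M #>\<^bsub>tree_aut d\<^esub> g" by (auto simp: r_coset_def)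
  qed
  show "M #>\<^bsub>tree_aut d\<^esub> g \<subseteq> M <#>\<^bsub>tree_aut d\<^esub> (N #>\<^bsub>tree_aut d\<^esub> g)"
  proof
    fix y assume "y \<in> M #>\<^bsub>tree_aut d\<^esub> g"
    then obtain m where "m \<in> M" "y = m \<odot> g" by (auto simp: r_coset_def)
    then show "y \<in> M <#>\<^bsub>tree_aut d\<^esub> (N #>\<^bsub>tree_aut d\<^esub> g)"
      using T.rcos_self[OF g N(1)] unfolding set_mult_def by blast
  qed
qed

lemma level_coset_eq_coset:
  assumes "g \<in> level_coset E n"
  shows "level_coset E n = R n #>\<^bsub>tree_aut d\<^esub> g"
proof -
  have gD: "g \<in> D" "g \<in> St d n" using assms by (auto simp: level_coset_def)
  have gc: "g \<in> carrier (tree_aut d)" using D_carrier[OF gD(1)] .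
  have mem: "h \<in> R n #>\<^bsub>tree_aut d\<^esub> g \<longleftrightarrow> h \<odot> tree_inv g \<in> R n" if "h \<in> D" for h
  proof -
    have hc: "h \<in> carrier (tree_aut d)" using D_carrier[OF that] .
    have "h \<in> R n #>\<^bsub>tree_aut d\<^esub> g \<longleftrightarrow> R n #>\<^bsub>tree_aut d\<^esub> h = R n #>\<^bsub>tree_aut d\<^esub> g"
      using T.rcos_self[OF hc subgroup_R] T.repr_independence[OF _ gc subgroup_R] by blast
    then show ?thesis using rcos_eq_iff[OF subgroup_R hc gc] by simp
  qed
  have subD: "R n #>\<^bsub>tree_aut d\<^esub> g \<subseteq> D" using gD by (auto simp: r_coset_def R_iff D_mult)
  have real: "h \<in> level_coset E n \<longleftrightarrow> h \<odot> tree_inv g \<in> R n" if h: "h \<in> D" for h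
  proof (cases "n = 0")
    case True
    then show ?thesis using h gD by (auto simp: level_coset_def Rst_0 D_mult D_inv St_0 D_carrier)
  next
    case False
    have "h \<in> level_coset E n \<longleftrightarrow> (trunc n h, level_par n h) = (trunc n g, level_par n g)"
    proof -
      have "trunc n h = trunc n g \<longleftrightarrow> h \<in> St d n"
        using gD(2) D_carrier[OF h] by (auto simp: trunc_eq_iff St_iff)
      moreover have "level_par n h = level_par n g \<longleftrightarrow> (\<forall>v\<in>level d n. par (sect v h) = E v)"
        using assms False by (auto simp: level_par_eq_iff level_coset_def)
      ultimately show ?thesis using h False by (auto simp: level_coset_def)
    qed
    then show ?thesis using level_data_eq_iff[OF h gD(1), of n] Rst_eq_star[of n] False by simp
  qed
  show ?thesis
  proof
    show "level_coset E n \<subseteq> R n #>\<^bsub>tree_aut d\<^esub> g"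
      using mem real by (auto simp: level_coset_def)
    show "R n #>\<^bsub>tree_aut d\<^esub> g \<subseteq> level_coset E n"
      using mem real subD by blast
  qed
qed

lemma level_coset_mult:
  assumes "g \<in> level_coset E n" "h \<in> level_coset F n"
  shows "g \<odot> h \<in> level_coset (E + F) n"
proof -
  have D: "g \<in> D" "h \<in> D" "g \<in> St d n" "h \<in> St d n" using assms by (auto simp: level_coset_def)
  have "par (sect v (g \<odot> h)) = E v + F v" if v: "v \<in> level d n" "n \<ge> 1" for v
    using St_sect_mult[OF D(4) v(1), of g] assms v D by (simp add: par_mult D_sect level_coset_def plus_fun_def)
  then show ?thesis using D St_mult by (simp add: level_coset_def D_mult)
qed

abbreviation RK :: "(nat \<Rightarrow> portrait set) monoid" where
  "RK \<equiv> rigid_kernel d D"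

lemma rigid_kernel_carrier:
  "x \<in> carrier RK \<longleftrightarrow> (\<forall>n. x n \<in> rcosets\<^bsub>subgrp d D\<^esub> (R n)) \<and>
     (\<forall>m n. m \<le> n \<longrightarrow> R m <#>\<^bsub>tree_aut d\<^esub> x n = x m) \<and>
     (\<forall>n. (D \<inter> St d n) <#>\<^bsub>tree_aut d\<^esub> x n = D \<inter> St d n)"
  by (simp add: rigid_kernel_def kernel_def inverse_limit_def FactGroup_def set_mult_subgrp fun_eq_iff
      PiE_UNIV_domain Pi_iff restrict_def)

lemma rigid_kernel_mult: "x \<otimes>\<^bsub>RK\<^esub> y = (\<lambda>n. x n <#>\<^bsub>tree_aut d\<^esub> y n)"
  by (simp add: rigid_kernel_def inverse_limit_def FactGroup_def set_mult_subgrp restrict_def)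

lemma rigid_kernel_one: "\<one>\<^bsub>RK\<^esub> = R"
  by (simp add: rigid_kernel_def inverse_limit_def FactGroup_def restrict_def)

lemma R_subset_St: "R n \<subseteq> D \<inter> St d n"
  by (auto simp: R_iff)

lemma rcos_const: "subgroup N (tree_aut d) \<Longrightarrow> g \<in> N \<Longrightarrow> N #>\<^bsub>tree_aut d\<^esub> g = N"
  by (rule T.coset_join2) (auto dest: subgroup.mem_carrier)

lemma level_coset_in_kernel:
  assumes "E \<in> families"
  shows "level_coset E \<in> carrier RK"
  unfolding rigid_kernel_carrier
proof (intro conjI allI impI)
  fix n
  obtain g where g: "g \<in> level_coset E n" using level_coset_nonempty[OF assms] by blast
  have gD: "g \<in> D" "g \<in> St d n" using g by (auto simp: level_coset_def)
  note eq = level_coset_eq_coset[OF g]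
  show "level_coset E n \<in> rcosets\<^bsub>subgrp d D\<^esub> (R n)"
    unfolding rcosets_subgrp eq using gD by blast
  show "(D \<inter> St d n) <#>\<^bsub>tree_aut d\<^esub> level_coset E n = D \<inter> St d n"
    unfolding eq coarser_coset[OF subgroup_Int_St[OF subgroup_D] subgroup_R R_subset_St D_carrier[OF gD(1)]]
    by (rule rcos_const[OF subgroup_Int_St[OF subgroup_D]]) (use gD in simp)
  fix m assume m: "m \<le> n"
  have g': "g \<in> level_coset E m" using level_coset_antimono[OF assms m] g by blast
  show "R m <#>\<^bsub>tree_aut d\<^esub> level_coset E n = level_coset E m"
    unfolding eq level_coset_eq_coset[OF g']
    by (rule coarser_coset[OF subgroup_R subgroup_R R_antimono[OF m] D_carrier[OF gD(1)]])
qed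

lemma families_iso_rigid_kernel: "level_coset \<in> iso (additive families) RK"
  unfolding iso_iff
proof (intro conjI)
  show "level_coset \<in> hom (additive families) RK"
  proof (rule homI)
    fix E F assume "E \<in> carrier (additive families)" "F \<in> carrier (additive families)"
    then have E: "E \<in> families" and F: "F \<in> families" by auto
    have "level_coset (E + F) n = level_coset E n <#>\<^bsub>tree_aut d\<^esub> level_coset F n" for n
    proof -
      obtain g h where g: "g \<in> level_coset E n" and h: "h \<in> level_coset F n"
        using level_coset_nonempty E F by blast
      have "g \<in> D" "h \<in> D" using g h by (auto simp: level_coset_def)
      then show ?thesis
        using rcos_product[OF normal_R, of g h n] level_coset_eq_coset[OF g] level_coset_eq_coset[OF h]
          level_coset_eq_coset[OF level_coset_mult[OF g h]] by simp
    qed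
    then show "level_coset (E \<otimes>\<^bsub>additive families\<^esub> F) = level_coset E \<otimes>\<^bsub>RK\<^esub> level_coset F"
      unfolding rigid_kernel_mult additive_simps by (rule ext)
  qed (use level_coset_in_kernel in auto)
  show "inj_on level_coset (carrier (additive families))"
  proof (rule inj_onI, rule ext)
    fix E F v assume "E \<in> carrier (additive families)" "F \<in> carrier (additive families)"
      and eq: "level_coset E = level_coset F"
    then have E: "E \<in> families" and F: "F \<in> families" by auto
    show "E v = F v"
    proof (cases "v \<in> nonroot")
      case True
      then have v: "v \<in> level d (length v)" "length v \<ge> 1" by (auto simp: level_iff Suc_le_eq)
      obtain g where g: "g \<in> level_coset E (length v)" using level_coset_nonempty[OF E] by blast
      have "par (sect v g) = E v" using g v by (simp add: level_coset_def)
      moreover have "par (sect v g) = F v"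
        using g[unfolded eq] v by (simp add: level_coset_def)
      ultimately show ?thesis by simp
    next
      case False
      then show ?thesis using E F by (auto simp: families_def)
    qed
  qed
  show "level_coset ` carrier (additive families) = carrier RK"
  proof
    show "level_coset ` carrier (additive families) \<subseteq> carrier RK" using level_coset_in_kernel by auto
    show "carrier RK \<subseteq> level_coset ` carrier (additive families)"
    proof
      fix x assume "x \<in> carrier RK"
      then have x1: "\<And>n. x n \<in> rcosets\<^bsub>subgrp d D\<^esub> (R n)"
        and x2: "\<And>m n. m \<le> n \<Longrightarrow> R m <#>\<^bsub>tree_aut d\<^esub> x n = x m"
        and x3: "\<And>n. (D \<inter> St d n) <#>\<^bsub>tree_aut d\<^esub> x n = D \<inter> St d n"
        unfolding rigid_kernel_carrier by auto
      have "\<exists>g. g \<in> D \<and> g \<in> St d n \<and> x n = R n #>\<^bsub>tree_aut d\<^esub> g" for n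
      proof -
        obtain g where g: "g \<in> D" "x n = R n #>\<^bsub>tree_aut d\<^esub> g" using x1[of n] unfolding rcosets_subgrp by blast
        have "D \<inter> St d n = (D \<inter> St d n) #>\<^bsub>tree_aut d\<^esub> g"
          using x3[of n] unfolding g(2)
            coarser_coset[OF subgroup_Int_St[OF subgroup_D] subgroup_R R_subset_St D_carrier[OF g(1)]] by simp
        then have "g \<in> D \<inter> St d n"
          using T.rcos_self[OF D_carrier[OF g(1)] subgroup_Int_St[OF subgroup_D]] by blast
        then show ?thesis using g by blast
      qed
      then obtain g where g: "\<And>n. g n \<in> D" "\<And>n. g n \<in> St d n" "\<And>n. x n = R n #>\<^bsub>tree_aut d\<^esub> g n" by metis
      define E where "E = (\<lambda>v. if v \<in> nonroot then par (sect v (g (length v))) else 0)"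
      have compat: "g n \<odot> tree_inv (g m) \<in> R m" if "m \<le> n" for m n
      proof -
        have "R m #>\<^bsub>tree_aut d\<^esub> g n = R m #>\<^bsub>tree_aut d\<^esub> g m"
          using x2[OF that] unfolding g(3)
            coarser_coset[OF subgroup_R subgroup_R R_antimono[OF that] D_carrier[OF g(1)]] .
        then show ?thesis using rcos_eq_iff[OF subgroup_R D_carrier[OF g(1)] D_carrier[OF g(1)]] by blast
      qed
      have Epar: "par (sect v (g n)) = E v" if v: "v \<in> nonroot" "length v \<le> n" for v n
      proof -
        have l: "v \<in> level d (length v)" "length v \<ge> 1" using v by (auto simp: level_iff Suc_le_eq)
        have "g n \<odot> tree_inv (g (length v)) \<in> star d (length v) D'"
          using compat[OF v(2)] Rst_eq_star[OF l(2)] by simp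
        then have "level_par (length v) (g n) = level_par (length v) (g (length v))"
          using level_data_eq_iff[OF g(1) g(1)] by blast
        then show ?thesis using l v by (simp add: level_par_eq_iff E_def)
      qed
      have rowsE: "child_rows E v = mat_of (sect v (g (Suc (length v))))" if v: "v \<in> words d" for v
        using Epar[of "v @ [_]" "Suc (length v)"] v by (auto simp: child_rows_def mat_of_def fun_eq_iff sect_sect)
      have "E \<in> families"
        unfolding families_def
      proof (intro CollectI conjI ballI allI impI)
        fix v assume "v \<notin> words d \<or> v = []"
        then show "E v = 0" by (auto simp: E_def)
      next
        fix v assume v: "v \<in> words d"
        let ?s = "sect v (g (Suc (length v)))"
        have "g (Suc (length v)) v = id" using g(2)[of "Suc (length v)"] v unfolding St_iff by (metis lessI)
        then have "?s [] = id" by (simp only: sect_apply append_Nil2)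
        moreover have s: "?s \<in> D" using D_sect[OF g(1)] .
        ultimately have "?s \<in> St d 1" using D_carrier[OF s] by (simp add: St1_iff)
        then show "child_rows E v \<in> cycles" unfolding rowsE[OF v] using mat_of_in_cycles[OF s] by blast
        assume "v \<noteq> []"
        then show "col_sums (child_rows E v) = E v"
          unfolding rowsE[OF v] col_sums_mat_of[OF s] using Epar[of v "Suc (length v)"] v by simp
      qed
      moreover have "level_coset E = x"
      proof
        fix n
        have "par (sect v (g n)) = E v" if "v \<in> level d n" "n \<ge> 1" for v
        proof (rule Epar)
          have "v \<in> words d" "length v = n" using that by (auto simp: level_iff)
          then show "v \<in> nonroot" "length v \<le> n" using that(2) by auto
        qed
        then have "g n \<in> level_coset E n" using g by (simp add: level_coset_def)
        then show "level_coset E n = x n" using level_coset_eq_coset g(3) by blast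
      qed
      ultimately show "x \<in> level_coset ` carrier (additive families)" by auto
    qed
  qed
qed

lemma elem_abelian_2_rigid_kernel: "elem_abelian_2 RK"
proof -
  interpret F: comm_group "additive families"
    using elem_abelian_2_families by (simp add: elem_abelian_2_def)
  have z: "level_coset 0 = \<one>\<^bsub>RK\<^esub>" by (rule ext) (simp add: rigid_kernel_one R_eq_realizers)
  have "comm_group (RK\<lparr>one := level_coset \<one>\<^bsub>additive families\<^esub>\<rparr>)"
    by (rule F.iso_imp_img_comm_group[OF families_iso_rigid_kernel])
  then have c: "comm_group RK" by (simp add: z)
  have "x \<otimes>\<^bsub>RK\<^esub> x = \<one>\<^bsub>RK\<^esub>" if x: "x \<in> carrier RK" for x
  proof -
    obtain E where E: "E \<in> families" "x = level_coset E"
      using families_iso_rigid_kernel x by (auto simp: iso_iff)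
    have "level_coset (E + E) = x \<otimes>\<^bsub>RK\<^esub> x"
      using families_iso_rigid_kernel E hom_mult[of level_coset "additive families" RK E E] by (simp add: iso_iff)
    then show ?thesis by (simp add: z)
  qed
  then show ?thesis using c by (simp add: elem_abelian_2_def)
qed


lemma rigid_kernel_iso:
  "RK \<cong> additive (supported {..<(d - 1) * (d - 2)}) \<times>\<times>
     product_group nonroot (\<lambda>_. additive (supported {..<(d - 1) * (d - 3)}))"
proof -
  have A: "additive spaceA \<cong> additive (supported {..<(d - 1) * (d - 2)})"
    by (rule group.iso_sym[OF group_supported],
        rule additive_iso_supported[OF zero_in_spaceA spaceA_add _ finite_spaceA card_spaceA]) auto
  have finB: "finite spaceB" by (rule finite_subset[OF _ finite_spaceA]) (auto simp: spaceB_def)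
  have B: "additive spaceB \<cong> additive (supported {..<(d - 1) * (d - 3)})"
    by (rule group.iso_sym[OF group_supported],
        rule additive_iso_supported[OF zero_in_spaceB spaceB_add _ finB card_spaceB]) auto
  have gA: "group (additive spaceA)" and gB: "group (additive spaceB)" and gF: "group (additive families)"
    using elem_abelian_2_spaceA elem_abelian_2_spaceB elem_abelian_2_families elem_abelian_2_group by blast+
  have "RK \<cong> additive families"
    by (rule group.iso_sym[OF gF is_isoI[OF families_iso_rigid_kernel]])
  also have "additive families \<cong> additive spaceA \<times>\<times> product_group nonroot (\<lambda>_. additive spaceB)"
    by (rule families_iso)
  also have "\<dots> \<cong> additive (supported {..<(d - 1) * (d - 2)}) \<times>\<times>
      product_group nonroot (\<lambda>_. additive (supported {..<(d - 1) * (d - 3)}))"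
    by (rule group.DirProd_iso_trans[OF gA A])
      (rule iso_product_groupI, rule B, rule gB, rule group_supported)
  finally show ?thesis .
qed

lemma rigid_kernel_iso_Z2:
  "RK \<cong> product_group {..<(d - 1) * (d - 2)} (\<lambda>_. integer_mod_group 2) \<times>\<times>
     product_group nonroot (\<lambda>_. product_group {..<(d - 1) * (d - 3)} (\<lambda>_. integer_mod_group 2))"
proof -
  note rigid_kernel_iso
  also have "additive (supported {..<(d - 1) * (d - 2)}) \<times>\<times>
      product_group nonroot (\<lambda>_. additive (supported {..<(d - 1) * (d - 3)})) \<cong>
    product_group {..<(d - 1) * (d - 2)} (\<lambda>_. integer_mod_group 2) \<times>\<times>
      product_group nonroot (\<lambda>_. product_group {..<(d - 1) * (d - 3)} (\<lambda>_. integer_mod_group 2))"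
    by (rule group.DirProd_iso_trans[OF group_supported supported_iso_product_Z2])
      (rule iso_product_groupI, rule supported_iso_product_Z2, rule group_supported, simp)
  finally show ?thesis .
qed

lemma rigid_kernel_iso_supported:
  assumes "bij_betw f I ({..<(d - 1) * (d - 2)} <+> nonroot \<times> {..<(d - 1) * (d - 3)})"
  shows "RK \<cong> additive (supported I)"
  by (rule iso_trans[OF iso_trans[OF rigid_kernel_iso supported_sum_iso] supported_reindex[OF assms]])

lemma rigid_kernel_d_3:
  assumes "d = 3"
  shows "RK \<cong> integer_mod_group 2 \<times>\<times> integer_mod_group 2"
proof -
  have "bij_betw Inl {..<2 :: nat} ({..<(d - 1) * (d - 2)} <+> nonroot \<times> {..<(d - 1) * (d - 3)})"
    using assms by (auto simp: bij_betw_def)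
  then show ?thesis using iso_trans[OF rigid_kernel_iso_supported Z2_product_iso] by blast
qed

lemma infinite_nonroot: "infinite nonroot"
proof
  assume "finite nonroot"
  moreover have "(\<lambda>n. replicate (Suc n) 0) ` UNIV \<subseteq> nonroot"
    using d_pos by (auto simp: words_def in_lists_conv_set)
  ultimately have "finite ((\<lambda>n. replicate (Suc n) (0 :: nat)) ` UNIV)" by (rule finite_subset[rotated])
  moreover have "inj (\<lambda>n. replicate (Suc n) (0 :: nat))"
    by (rule injI) (metis length_replicate Suc_inject)
  ultimately show False using finite_imageD[of "\<lambda>n. replicate (Suc n) (0 :: nat)" UNIV] by simp
qed

lemma rigid_kernel_d_gt_3:
  assumes "d > 3"
  shows "RK \<cong> product_group (UNIV :: nat set) (\<lambda>_. integer_mod_group 2)"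
proof -
  let ?S = "{..<(d - 1) * (d - 2)} <+> nonroot \<times> {..<(d - 1) * (d - 3)}"
  have "0 < (d - 1) * (d - 3)" using assms by simp
  then have "Inr ` (\<lambda>v. (v, 0)) ` nonroot \<subseteq> ?S" by auto
  moreover have "infinite (Inr ` (\<lambda>v. (v, 0 :: nat)) ` nonroot :: (nat + nat list \<times> nat) set)"
    using infinite_nonroot by (auto dest!: finite_imageD simp: inj_on_def)
  ultimately have "infinite ?S" using finite_subset by blast
  moreover have "countable ?S" by (rule countableI_type)
  ultimately have "bij_betw (from_nat_into ?S) UNIV ?S" by (intro bij_betw_from_nat_into)
  then show ?thesis by (rule iso_trans[OF rigid_kernel_iso_supported supported_iso_product_Z2])
qed

lemma D'_quotient: "elem_abelian_2_rank (subgrp d D Mod D') d"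
proof -
  interpret S: group "subgrp d D" by (rule group_D)
  interpret par: group_hom "subgrp d D" "additive (supported {..<d})" par
  proof (intro group_hom.intro group_hom_axioms.intro)
    show "par \<in> hom (subgrp d D) (additive (supported {..<d}))"
      by (rule homI) (auto simp: par_supported par_mult fun_eq_iff)
  qed (rule group_D, rule group_supported)
  have "kernel (subgrp d D) (additive (supported {..<d})) par = D'"
    by (auto simp: kernel_def D'_iff fun_eq_iff)
  moreover have "par ` carrier (subgrp d D) = carrier (additive (supported {..<d}))"
    using par_onto par_supported by auto
  ultimately have iso: "subgrp d D Mod D' \<cong> additive (supported {..<d})"
    using par.FactGroup_iso by simp
  have "group (subgrp d D Mod D')" by (rule normal.factorgroup_is_group[OF normal_D'])
  then have "elem_abelian_2 (subgrp d D Mod D')"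
    using elem_abelian_2_iso[OF _ iso elem_abelian_2_supported] by blast
  then show ?thesis
    using iso_trans[OF iso supported_iso_product_Z2] by (simp add: elem_abelian_2_rank_def)
qed

lemma root_quotient:
  "(\<lambda>C. the_elem ((\<lambda>g. g []) ` C)) \<in> iso (subgrp d D Mod (D \<inter> St d 1)) (dihedral d)"
proof -
  interpret X: group "sym_X d" by (rule group_sym_X)
  have mX: "mirrors d \<subseteq> carrier (sym_X d)"
    by (auto simp: sym_X_def dih_def intro!: dih_permutes)
  have dg: "group (dihedral d)"
    unfolding dihedral_def by (rule X.subgroup_imp_group[OF X.generate_is_subgroup[OF mX]])
  interpret root: group_hom "subgrp d D" "dihedral d" "\<lambda>g. g []"
  proof (intro group_hom.intro group_hom_axioms.intro)
    show "(\<lambda>g. g []) \<in> hom (subgrp d D) (dihedral d)"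
    proof (rule homI)
      fix g assume "g \<in> carrier (subgrp d D)"
      then show "g [] \<in> carrier (dihedral d)" by (simp add: carrier_dihedral root_in_dih)
    next
      fix g h
      show "(g \<otimes>\<^bsub>subgrp d D\<^esub> h) [] = g [] \<otimes>\<^bsub>dihedral d\<^esub> h []"
        by (simp add: root_mult dihedral_def sym_X_def)
    qed
  qed (rule group_D, rule dg)
  have "kernel (subgrp d D) (dihedral d) (\<lambda>g. g []) = D \<inter> St d 1"
    using D_carrier by (auto simp: kernel_def St1_iff dihedral_def sym_X_def simp del: id_apply)
  moreover have "(\<lambda>g. g []) ` carrier (subgrp d D) = carrier (dihedral d)"
    using root_onto root_in_dih by (force simp: carrier_dihedral)
  ultimately show ?thesis using root.FactGroup_iso_set by simp
qed

lemma D'_subset_D: "D' \<subseteq> D"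
  by (auto simp: D'_iff)

lemma regular_branch_over_D': "regular_branch_over d D D'"
proof -
  have "subgroup D' (subgrp d D)" by (rule T.subgroup_incl[OF subgroup_D' subgroup_D D'_subset_D])
  moreover have "par g = par h \<longleftrightarrow> g \<odot> tree_inv h \<in> D'" if "g \<in> D" "h \<in> D" for g h
    using that by (auto simp: D'_iff D_mult D_inv par_mult par_inv fun_eq_iff bit_add_eq_0_iff)
  then have "finite (rcosets\<^bsub>subgrp d D\<^esub> D') \<longleftrightarrow> finite (par ` D)"
    using D_carrier by (intro index_eq_card_image(2)[OF subgroup_D']) auto
  moreover have "finite (par ` D)"
    by (rule finite_subset[OF _ finite_supported[of "{..<d}"]]) (auto simp: par_supported)
  ultimately show ?thesis
    using star_D'_subset[of 1] normal_D' self_similar_D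
    by (simp add: regular_branch_over_def branches_over_def)
qed

lemma pattern_dom_eq: "pattern_dom d = insert [] ((\<lambda>x. [x]) ` {..<d})"
  by (auto simp: pattern_dom_def level_Suc)

lemma foldr_comp_dih:
  "(\<And>p. p \<in> set ps \<Longrightarrow> p \<in> dih) \<Longrightarrow>
    foldr (\<circ>) ps id \<in> dih \<and> mir (foldr (\<circ>) ps id) = sum_list (map mir ps)"
proof (induction ps)
  case Nil
  have "id id = (id :: nat \<Rightarrow> nat)" by (rule id_apply)
  then have "foldr (\<circ>) [] id = (id :: nat \<Rightarrow> nat)" by (simp only: foldr.simps)
  then show ?case unfolding list.map by (simp add: id_in_dih del: id_apply)
next
  case (Cons p ps)
  have e: "foldr (\<circ>) (p # ps) id = p \<circ> foldr (\<circ>) ps id" by (simp only: foldr.simps o_apply)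
  show ?case unfolding e using Cons by (simp add: dih_comp mir_comp del: o_apply id_apply)
qed

text \<open>The product of the labels is a rotation if and only if its sign vanishes.\<close>

lemma allowed_iff:
  assumes "p \<in> patterns d"
  shows "allowed d p \<longleftrightarrow> mir (p []) = (\<Sum>x<d. mir (p [x]))"
proof -
  have pd: "p u \<in> dih" if "u \<in> pattern_dom d" for u
    using assms that by (auto simp: patterns_def PiE_iff carrier_dihedral)
  have r: "p [] \<in> dih" "\<And>x. x < d \<Longrightarrow> p [x] \<in> dih" using pd by (auto simp: pattern_dom_eq)
  let ?f = "foldr (\<circ>) (map (\<lambda>x. p [x]) [0..<d]) id"
  have f: "?f \<in> dih" "mir ?f = sum_list (map mir (map (\<lambda>x. p [x]) [0..<d]))"
  proof -
    have "q \<in> dih" if "q \<in> set (map (\<lambda>x. p [x]) [0..<d])" for q using that r(2) by auto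
    then show "?f \<in> dih" "mir ?f = sum_list (map mir (map (\<lambda>x. p [x]) [0..<d]))"
      using foldr_comp_dih by blast+
  qed
  have s: "sum_list (map mir (map (\<lambda>x. p [x]) [0..<d])) = (\<Sum>x<d. mir (p [x]))"
    by (simp add: comp_def interv_sum_list_conv_sum_set_nat atLeast0LessThan)
  have "allowed d p \<longleftrightarrow> mir (p [] \<circ> ?f) = 0"
    unfolding allowed_def using mir_eq_0_iff[OF dih_comp[OF r(1) f(1)]] by simp
  also have "\<dots> \<longleftrightarrow> mir (p []) = mir ?f"
    unfolding mir_comp[OF r(1) f(1)] by (rule bit_add_eq_0_iff)
  finally show ?thesis using f(2) s by simp
qed

lemma of_nat_bit_eq_0_iff: "(of_nat n :: bit) = 0 \<longleftrightarrow> even n"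
  by (induction n) (auto simp: bit_add_eq_0_iff)

lemma allowed_iff_even:
  assumes "p \<in> patterns d"
  shows "allowed d p \<longleftrightarrow> even (card {w \<in> pattern_dom d. p w \<in> mirrors d})"
proof -
  have fin: "finite (pattern_dom d)" by (simp add: pattern_dom_eq)
  have "(of_nat (card {w \<in> pattern_dom d. p w \<in> mirrors d}) :: bit) = (\<Sum>w\<in>pattern_dom d. mir (p w))"
    using fin by (simp add: mir_def sum.If_cases of_bool_def Int_def)
  also have "\<dots> = mir (p []) + (\<Sum>x<d. mir (p [x]))"
    unfolding pattern_dom_eq by (subst sum.insert) (auto simp: sum.reindex inj_on_def)
  finally show ?thesis
    using allowed_iff[OF assms] by (metis bit_add_eq_0_iff of_nat_bit_eq_0_iff)
qed

lemma constrained_eq: "constrained = finitely_constrained d {p \<in> patterns d. allowed d p}"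
proof -
  have w: "f \<in> wreath d \<longleftrightarrow> f \<in> carrier (tree_aut d) \<and> (\<forall>u\<in>words d. f u \<in> dih)" for f
    by (simp add: wreath_def carrier_dihedral)
  have "(\<forall>p\<in>patterns d. appears_at d p f u \<longrightarrow> p \<in> {p \<in> patterns d. allowed d p}) \<longleftrightarrow>
      mir (f u) = (\<Sum>x<d. mir (f (u @ [x])))" if f: "f \<in> wreath d" and u: "u \<in> words d" for f u
  proof -
    let ?p = "restrict (sect u f) (pattern_dom d)"
    have "?p \<in> patterns d"
      using f u by (auto simp: patterns_def pattern_dom_eq carrier_dihedral w sect_apply)
    then have "(\<forall>p\<in>patterns d. appears_at d p f u \<longrightarrow> p \<in> {p \<in> patterns d. allowed d p}) \<longleftrightarrow> allowed d ?p"
      by (auto simp: appears_at_def)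
    also have "\<dots> \<longleftrightarrow> mir (?p []) = (\<Sum>x<d. mir (?p [x]))" by (rule allowed_iff) fact
    also have "(\<Sum>x<d. mir (?p [x])) = (\<Sum>x<d. mir (f (u @ [x])))"
      by (rule sum.cong) (auto simp: pattern_dom_eq sect_apply)
    also have "?p [] = f u" by (simp add: pattern_dom_eq sect_apply)
    finally show ?thesis .
  qed
  then show ?thesis
    unfolding constrained_def finitely_constrained_def using w by blast
qed

lemma regular_branch_over_constrained: "regular_branch_over d constrained (constrained \<inter> St d 1)"
proof -
  let ?K = "constrained \<inter> St d 1"
  have subK: "subgroup ?K (tree_aut d)" by (rule subgroup_Int_St[OF subgroup_constrained])
  interpret S: group "subgrp d constrained" by (rule T.subgroup_imp_group[OF subgroup_constrained])
  have "?K \<lhd> subgrp d constrained"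
    unfolding S.normal_inv_iff
  proof (intro conjI ballI)
    show "subgroup ?K (subgrp d constrained)"
      by (rule T.subgroup_incl[OF subK subgroup_constrained]) blast
    fix g h assume "g \<in> carrier (subgrp d constrained)" "h \<in> ?K"
    then have g: "g \<in> constrained" and h: "h \<in> constrained" "h \<in> St d 1" by auto
    have "g \<odot> h \<odot> tree_inv g \<in> ?K"
      using conj_in_St[OF constrained_carrier[OF g] h(2)] g h(1)
        subgroup.m_closed[OF subgroup_constrained] subgroup.m_inv_closed[OF subgroup_constrained] by blast
    then show "g \<otimes>\<^bsub>subgrp d constrained\<^esub> h \<otimes>\<^bsub>subgrp d constrained\<^esub> inv\<^bsub>subgrp d constrained\<^esub> g \<in> ?K"
      using T.m_inv_consistent[OF subgroup_constrained g] by simp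
  qed
  moreover have "star d 1 ?K \<subseteq> ?K"
    unfolding star_def
  proof (rule T.generate_subgroup_incl[OF _ subK], clarify)
    fix v h assume v: "v \<in> level d 1" and h: "h \<in> constrained" "h \<in> St d 1"
    obtain x where x: "v = [x]" "x < d" using v by (auto simp: level_Suc)
    have one: "idp \<in> constrained" using subgroup.one_closed[OF subgroup_constrained] by (simp add: one_tree_aut)
    have root: "h [] = id" using h(2) by (simp add: St1_iff)
    have "mir ((if y = x then h else idp) []) = 0" for y
      using root root_idp by (simp del: id_apply)
    then have "glue d id (\<lambda>y. if y = x then h else idp) \<in> constrained"
      using constrained_glue_iff[of "\<lambda>y. if y = x then h else idp" id] h(1) one
      by (simp add: id_in_dih del: id_apply)
    then have "delta v h \<in> constrained" using delta_single[OF x(2), of h] x(1) by simp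
    moreover have "delta v h \<in> St d 1" using delta_in_St[OF v] constrained_carrier[OF h(1)] by blast
    ultimately show "delta v h \<in> ?K" by blast
  qed
  moreover have "self_similar d constrained"
    using subgroup_constrained constrained_sect by (simp add: self_similar_def)
  moreover have "subgroup ?K (subgrp d constrained)"
    by (rule T.subgroup_incl[OF subK subgroup_constrained]) blast
  moreover have "finite (rcosets\<^bsub>subgrp d constrained\<^esub> ?K)"
    using index_St(2)[OF subgroup_constrained, of 1] card_trunc_constrained(2)[of 0] by simp
  ultimately show ?thesis by (simp add: regular_branch_over_def branches_over_def)
qed

end

theorem theorem1:
  fixes d :: nat
  assumes "odd d" and "d \<ge> 3"
  shows
    "(self_similar d (grpD d) \<and> self_replicating d (grpD d) \<and> contracting d (grpD d) \<and>
      regular_branch d (grpD d) \<and> regular_branch_over d (grpD d) (grpD' d)) \<and>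

     (grpD d \<inter> St d 1 \<lhd> subgrp d (grpD d) \<and>
      (\<lambda>C. the_elem ((\<lambda>g. g []) ` C)) \<in>
        iso (subgrp d (grpD d) Mod (grpD d \<inter> St d 1)) (dihedral d) \<and>
      order (dihedral d) = 2 * d) \<and>

     (elem_abelian_2_rank (subgrp d (grpD d) Mod grpD' d) d \<and>
      index d (grpD' d) (star d 1 (grpD' d)) = d * 2 ^ ((d - 1) * (d - 2))) \<and>

     (\<forall>n\<ge>1. Rst d (grpD d) n = star d n (grpD' d) \<and>
        index d (grpD d) (Rst d (grpD d) n) =
          2 ^ ((d - 2) * d ^ n + 2) * d ^ ((d ^ n - 1) div (d - 1))) \<and>

     (elem_abelian_2 (rigid_kernel d (grpD d)) \<and>
      (\<exists>(A :: (nat \<Rightarrow> int) monoid) (B :: (nat \<Rightarrow> int) monoid).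
         elem_abelian_2_rank A ((d - 1) * (d - 2)) \<and>
         elem_abelian_2_rank B ((d - 1) * (d - 3)) \<and>
         rigid_kernel d (grpD d) \<cong> A \<times>\<times> product_group (words d - {[]}) (\<lambda>_. B)) \<and>
      (d = 3 \<longrightarrow> rigid_kernel d (grpD d) \<cong> integer_mod_group 2 \<times>\<times> integer_mod_group 2) \<and>
      (d > 3 \<longrightarrow>
         rigid_kernel d (grpD d) \<cong> product_group (UNIV :: nat set) (\<lambda>_. integer_mod_group 2))) \<and>

     (subgroup (clos d (grpD d)) (tree_aut d) \<and>
      clos d (grpD d) = finitely_constrained d {p \<in> patterns d. allowed d p} \<and>
      (\<forall>p\<in>patterns d. allowed d p \<longleftrightarrow> even (card {w \<in> pattern_dom d. p w \<in> mirrors d}))) \<and>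

     (regular_branch d (clos d (grpD d)) \<and>
      regular_branch_over d (clos d (grpD d)) (clos d (grpD d) \<inter> St d 1) \<and>
      (\<forall>n\<ge>1.
         index d (grpD d) (grpD d \<inter> St d n) =
           index d (clos d (grpD d)) (clos d (grpD d \<inter> St d n)) \<and>
         index d (clos d (grpD d)) (clos d (grpD d \<inter> St d n)) =
           2 ^ (d ^ (n - 1)) * d ^ ((d ^ n - 1) div (d - 1))) \<and>
      hdim d (clos d (grpD d)) = ereal (1 - 1 / real d * (ln 2 / ln (2 * real d))))"
proof -
  interpret odd_gon d by unfold_locales (rule assms)+
  have i: "self_similar d (grpD d) \<and> self_replicating d (grpD d) \<and> contracting d (grpD d) \<and>
      regular_branch d (grpD d) \<and> regular_branch_over d (grpD d) (grpD' d)"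
    using self_similar_D self_replicating_D contracting_D regular_branch_over_D'
    unfolding derived_eq regular_branch_def by blast
  have ii: "grpD d \<inter> St d 1 \<lhd> subgrp d (grpD d) \<and>
      (\<lambda>C. the_elem ((\<lambda>g. g []) ` C)) \<in>
        iso (subgrp d (grpD d) Mod (grpD d \<inter> St d 1)) (dihedral d) \<and>
      order (dihedral d) = 2 * d"
    using normal_D_St root_quotient card_dih by (simp add: order_def carrier_dihedral)
  have iii: "elem_abelian_2_rank (subgrp d (grpD d) Mod grpD' d) d \<and>
      index d (grpD' d) (star d 1 (grpD' d)) = d * 2 ^ ((d - 1) * (d - 2))"
    unfolding derived_eq using D'_quotient index_D'_star by blast
  have iv: "\<forall>n\<ge>1. Rst d (grpD d) n = star d n (grpD' d) \<and>
        index d (grpD d) (Rst d (grpD d) n) =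
          2 ^ ((d - 2) * d ^ n + 2) * d ^ ((d ^ n - 1) div (d - 1))"
    unfolding derived_eq using Rst_eq_star index_D_star by metis
  have v: "elem_abelian_2 (rigid_kernel d (grpD d)) \<and>
      (\<exists>(A :: (nat \<Rightarrow> int) monoid) (B :: (nat \<Rightarrow> int) monoid).
         elem_abelian_2_rank A ((d - 1) * (d - 2)) \<and>
         elem_abelian_2_rank B ((d - 1) * (d - 3)) \<and>
         rigid_kernel d (grpD d) \<cong> A \<times>\<times> product_group (words d - {[]}) (\<lambda>_. B)) \<and>
      (d = 3 \<longrightarrow> rigid_kernel d (grpD d) \<cong> integer_mod_group 2 \<times>\<times> integer_mod_group 2) \<and>
      (d > 3 \<longrightarrow>
         rigid_kernel d (grpD d) \<cong> product_group (UNIV :: nat set) (\<lambda>_. integer_mod_group 2))"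
    using elem_abelian_2_rigid_kernel rigid_kernel_iso_Z2 elem_abelian_2_rank_product_Z2
      rigid_kernel_d_3 rigid_kernel_d_gt_3 by blast
  have vi: "subgroup (clos d (grpD d)) (tree_aut d) \<and>
      clos d (grpD d) = finitely_constrained d {p \<in> patterns d. allowed d p} \<and>
      (\<forall>p\<in>patterns d. allowed d p \<longleftrightarrow> even (card {w \<in> pattern_dom d. p w \<in> mirrors d}))"
    using subgroup_constrained constrained_eq allowed_iff_even by (simp add: clos_D)
  have vii: "regular_branch d (clos d (grpD d)) \<and>
      regular_branch_over d (clos d (grpD d)) (clos d (grpD d) \<inter> St d 1) \<and>
      (\<forall>n\<ge>1.
         index d (grpD d) (grpD d \<inter> St d n) =
           index d (clos d (grpD d)) (clos d (grpD d \<inter> St d n)) \<and>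
         index d (clos d (grpD d)) (clos d (grpD d \<inter> St d n)) =
           2 ^ (d ^ (n - 1)) * d ^ ((d ^ n - 1) div (d - 1))) \<and>
      hdim d (clos d (grpD d)) = ereal (1 - 1 / real d * (ln 2 / ln (2 * real d)))"
    unfolding clos_D clos_D_St regular_branch_def
    using regular_branch_over_constrained index_D_St index_constrained_St hdim_constrained by blast
  show ?thesis
    by (rule conjI[OF i conjI[OF ii conjI[OF iii conjI[OF iv conjI[OF v conjI[OF vi vii]]]]]])
qed

end
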